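(* Let $n\ge 3$, $p\in[1,\infty]$, and let $q\in[1,\infty]$ be the conjugate exponent, $\frac1p+\frac1q=1$. For $r\in[0,1)$ define $$G_p(r)=\begin{cases}\displaystyle\inf_{a\in[0,\infty)}\ \sup_{\eta\in\mathbb{S}^{n-1}}|P_h(re_n,\eta)-a|, & q=\infty,\\[2mm] \displaystyle\inf_{a\in[0,\infty)}\left(\int_{\mathbb{S}^{n-1}}|P_h(re_n,\eta)-a|^q\,d\sigma(\eta)\right)^{1/q}, & q\in[1,\infty).\end{cases}$$ Suppose that $u=P_h[\phi]$ with $\phi\in L^p(\mathbb{S}^{n-1},\mathbb{R}^n)$ and $u(0)=0$. Then for every $x\in\mathbb{B}^n$, $$|u(x)|\le G_p(|x|)\,\|\phi\|_{L^p}\qquad(\mathrm{A})$$ and $$\|Du(0)\|\le 2(n-1)\left(\frac{\Gamma\left(\frac n2\right)\Gamma\left(\frac{1+q}2\right)}{\sqrt\pi\,\Gamma\left(\frac{n+q}2\right)}\right)^{1/q}\|\phi\|_{L^p},\qquad(\mathrm{B})$$ where for $q=\infty$ the factor $(\cdots)^{1/q}$ is understood as its limit as $q\to\infty$, namely $1$. Both inequalities are sharp: for each fixed $x\in\mathbb{B}^n$ the constant $G_p(|x|)$ in (A), and the constant in (B), cannot be replaced by any smaller constant valid for all such $\phi$. Moreover: (i) if $p\in[1,\infty)$, then $G_p$ is an increasing diffeomorphism of $[0,1)$ onto $[0,\infty)$ with $G_p(0)=0$; (ii) if $p=\infty$, then $G_\infty(r)=U_h(re_n)$ for all $r\in[0,1)$,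 where $U_h=P_h[\chi_{\mathbb{S}^{n-1}_+}-\chi_{\mathbb{S}^{n-1}_-}]$, and $G_\infty$ is an increasing diffeomorphism of $[0,1)$ onto itself.
   Context: $\mathbb{B}^n$ is the open unit ball of $\mathbb{R}^n$, $\mathbb{S}^{n-1}$ the unit sphere, $|\cdot|$ the Euclidean norm, $e_n=(0,\dots,0,1)$, and $\sigma$ the rotation-invariant surface measure on $\mathbb{S}^{n-1}$ normalized so that $\sigma(\mathbb{S}^{n-1})=1$. The norm $\|\phi\|_{L^p}$ of $\phi:\mathbb{S}^{n-1}\to\mathbb{R}^n$ is the $L^p(\sigma)$ norm of $|\phi|$. The Poisson–Szegő kernel (for the hyperbolic Laplacian) is $$P_h(x,\zeta)=\left(\frac{1-|x|^2}{|x-\zeta|^2}\right)^{n-1},\qquad x\in\mathbb{B}^n,\ \zeta\in\mathbb{S}^{n-1},$$ and for an integrable $\phi$ on $\mathbb{S}^{n-1}$ (real- or vector-valued), $P_h[\phi](x)=\int_{\mathbb{S}^{n-1}}P_h(x,\zeta)\phi(\zeta)\,d\sigma(\zeta)$ for $x\in\mathbb{B}^n$. $Du(0)$ is the Jacobian matrix of $u$ at $0$, and $\|A\|=\sup\{|A\xi|:\xi\in\mathbb{S}^{n-1}\}$. $\mathbb{S}^{n-1}_+=\{x\in\mathbb{S}^{n-1}:x_n\ge0\}$, $\mathbb{S}^{n-1}_-=\{x\in\mathbb{S}^{n-1}:x_n\le0\}$, and $\chi_E$ is the indicator function of $E$. A diffeomorphism between intervals containing their left endpoint $0$ is understood with one-sided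 derivatives at $0$. *)

theory Defs
  imports "HOL-Probability.Probability"
begin

text \<open>
  The normalized surface measure on the unit sphere, as the image of the normalized Lebesgue measure
  of the unit ball under the radial projection \<open>x \<mapsto> x / |x|\<close>. The value \<open>sgn 0 = 0\<close> is off the sphere
  and only affects a null set.
\<close>

definition surface_measure :: "(real ^ 'n) measure"  (\<open>\<sigma>\<close>) where
  "\<sigma> = restrict_space (distr (uniform_measure lborel (ball 0 1)) borel sgn) (sphere 0 1)"

lemma space_surface_measure [simp]: "space \<sigma> = sphere 0 1"
  by (simp add: surface_measure_def space_restrict_space)

lemma sets_surface_measure [measurable_cong]:
  "sets \<sigma> = sets (restrict_space borel (sphere 0 1))"
  by (simp add: surface_measure_def sets_restrict_space)

lemma borel_measurable_sgn_vec [measurable]: "(sgn :: real ^ 'n \<Rightarrow> real ^ 'n) \<in> borel_measurable borel"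
proof -
  have "(\<lambda>x :: real ^ 'n. x /\<^sub>R norm x) \<in> borel_measurable borel"
    by measurable
  then show ?thesis
    by (simp add: sgn_div_norm[abs_def])
qed

lemma emeasure_ball_pos: "emeasure lborel (ball (0 :: real ^ 'n) 1) > 0"
proof (rule ccontr)
  assume "\<not> ?thesis"
  then have "ball (0 :: real ^ 'n) 1 \<in> null_sets lborel"
    by (auto simp: null_sets_def)
  then have "negligible (ball (0 :: real ^ 'n) 1)"
    using negligible_iff_null_sets null_sets_completionI by blast
  then show False
    using open_not_negligible[of "ball (0 :: real ^ 'n) 1"] by auto
qed

lemma emeasure_surface_measure:
  fixes A :: "(real ^ 'n) set"
  assumes "A \<in> sets \<sigma>"
  shows "emeasure \<sigma> A =
    emeasure lborel {x \<in> ball 0 1. sgn x \<in> A} / emeasure lborel (ball 0 1 :: (real ^ 'n) set)"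
proof -
  have A: "A \<subseteq> sphere 0 1" "A \<in> sets borel"
    using assms by (auto simp: sets_surface_measure sets_restrict_space_iff)
  have [measurable]: "A \<in> sets borel" by (fact A)
  have m: "sgn -` A \<in> sets borel"
    using measurable_sets[OF borel_measurable_sgn_vec A(2)] by simp
  have "emeasure \<sigma> A = emeasure (distr (uniform_measure lborel (ball 0 1)) borel sgn) A"
    unfolding surface_measure_def by (rule emeasure_restrict_space) (use A in auto)
  also have "\<dots> = emeasure (uniform_measure lborel (ball 0 1)) (sgn -` A)"
    by (subst emeasure_distr) auto
  also have "\<dots> = emeasure lborel (ball 0 1 \<inter> sgn -` A) / emeasure lborel (ball (0 :: real ^ 'n) 1)"
    using m by (subst emeasure_uniform_measure) auto
  also have "ball 0 1 \<inter> sgn -` A = {x \<in> ball 0 1. sgn x \<in> A}"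
    by auto
  finally show ?thesis .
qed

lemma prob_space_surface_measure: "prob_space (\<sigma> :: (real ^ 'n) measure)"
proof
  have fin: "emeasure lborel (ball (0 :: real ^ 'n) 1) \<noteq> \<infinity>"
    using emeasure_bounded_finite[of "ball (0 :: real ^ 'n) 1"] by auto
  have eq: "{x \<in> ball 0 1. sgn x \<in> sphere (0 :: real ^ 'n) 1} = ball 0 1 - {0}"
    by (auto simp: norm_sgn)
  have "emeasure \<sigma> (sphere (0 :: real ^ 'n) 1) =
      emeasure lborel (ball (0 :: real ^ 'n) 1 - {0}) / emeasure lborel (ball (0 :: real ^ 'n) 1)"
    using emeasure_surface_measure[of "sphere (0 :: real ^ 'n) 1"] unfolding eq
    by (simp add: sets_surface_measure sets_restrict_space_iff)
  also have "emeasure lborel (ball (0 :: real ^ 'n) 1 - {0}) = emeasure lborel (ball (0 :: real ^ 'n) 1)"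
    by (rule emeasure_Diff_null_set) auto
  finally show "emeasure \<sigma> (space (\<sigma> :: (real ^ 'n) measure)) = 1"
    using fin emeasure_ball_pos[where 'n = 'n] by (simp add: ennreal_divide_self less_top)
qed

lemma rotation_invariant_surface_measure:
  fixes T :: "real ^ 'n::{finite,wellorder} \<Rightarrow> real ^ 'n::_"
  assumes T: "orthogonal_transformation T"
  shows "distr \<sigma> \<sigma> T = \<sigma>"
proof -
  have [measurable]: "T \<in> borel_measurable borel"
    using T by (intro borel_measurable_continuous_onI linear_continuous_on)
      (simp add: orthogonal_transformation_linear flip: linear_conv_bounded_linear)
  have normT: "norm (T x) = norm x" for x
    using T by (simp add: orthogonal_transformation)
  have Tm: "T \<in> \<sigma> \<rightarrow>\<^sub>M \<sigma>"
    by (subst measurable_cong_sets[OF sets_surface_measure sets_surface_measure],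
        rule measurable_restrict_space3) (auto simp: normT)
  have T': "orthogonal_transformation (inv T)"
    using T by (rule orthogonal_transformation_inv)
  have bij: "bij T"
    using T by (rule orthogonal_transformation_bij)
  have sgnT: "sgn (T x) = T (sgn x)" for x
    using T by (simp add: sgn_div_norm normT orthogonal_transformation_linear linear_scale)
  show ?thesis
  proof (rule measure_eqI)
    fix A assume "A \<in> sets (distr \<sigma> \<sigma> T)"
    then have A: "A \<in> sets \<sigma>" by simp
    have Ab: "A \<subseteq> sphere 0 1" "A \<in> sets borel"
      using A by (auto simp: sets_surface_measure sets_restrict_space_iff)
    let ?B = "{x \<in> ball 0 1. sgn x \<in> A}" and ?C = "{x \<in> ball 0 1. sgn x \<in> T -` A \<inter> space \<sigma>}"
    have C: "T -` A \<inter> space \<sigma> \<in> sets \<sigma>"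
      using Tm A by (rule measurable_sets)
    have Cb: "T -` A \<inter> space \<sigma> \<in> sets borel"
      using C by (auto simp: sets_surface_measure sets_restrict_space_iff)
    have aux: "{x \<in> ball 0 1. sgn x \<in> X} \<in> sets borel" if "X \<in> sets borel" for X :: "(real ^ 'n::_) set"
    proof -
      have "{x \<in> ball 0 1. sgn x \<in> X} = ball 0 1 \<inter> (sgn -` X \<inter> space borel)" by auto
      then show ?thesis
        using measurable_sets[OF borel_measurable_sgn_vec that] by auto
    qed
    have BC: "?C = inv T ` ?B"
    proof (intro equalityI subsetI)
      fix x assume x: "x \<in> ?C"
      then have "T x \<in> ?B" by (auto simp: normT sgnT)
      moreover have "x = inv T (T x)" using bij by (simp add: bij_is_inj)
      ultimately show "x \<in> inv T ` ?B" by blast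
    next
      fix x assume "x \<in> inv T ` ?B"
      then obtain y where y: "y \<in> ?B" "x = inv T y" by blast
      then have "T x = y" using bij by (simp add: bij_is_surj surj_f_inv_f)
      moreover have "norm x = norm y" using calculation normT[of x] by simp
      moreover have "T (sgn x) = sgn y" using calculation sgnT[of x] by simp
      moreover have "norm (sgn x) = 1"
        using calculation y Ab normT[of "sgn x"] by (auto simp: subset_iff)
      ultimately show "x \<in> ?C" using y by simp
    qed
    have lm: "X \<in> lmeasurable" if "X \<in> sets borel" "X \<subseteq> ball 0 1" for X :: "(real ^ 'n::_) set"
      using that by (intro bounded_set_imp_lmeasurable) (auto intro: bounded_subset)
    have em: "emeasure lborel X = ennreal (measure lebesgue X)" if "X \<in> sets borel" "X \<subseteq> ball 0 1" for X :: "(real ^ 'n::_) set"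
      using emeasure_eq_measure2[OF lm[OF that]] that by simp
    have B: "?B \<in> sets borel" using aux Ab by blast
    have "emeasure (distr \<sigma> \<sigma> T) A = emeasure \<sigma> (T -` A \<inter> space \<sigma>)"
      using Tm A by (rule emeasure_distr)
    also have "\<dots> = emeasure lborel ?C / emeasure lborel (ball (0 :: real ^ 'n::_) 1)"
      using C by (rule emeasure_surface_measure)
    also have "emeasure lborel ?C = ennreal (measure lebesgue (inv T ` ?B))"
      unfolding BC[symmetric] by (rule em[OF aux[OF Cb]]) auto
    also have "measure lebesgue (inv T ` ?B) = measure lebesgue ?B"
      by (rule measure_orthogonal_image[OF T'], rule lm[OF B]) auto
    also have "ennreal \<dots> = emeasure lborel ?B"
      by (rule em[symmetric]) (use B in auto)
    also have "\<dots> / emeasure lborel (ball (0 :: real ^ 'n::_) 1) = emeasure \<sigma> A"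
      using A by (rule emeasure_surface_measure[symmetric])
    finally show "emeasure (distr \<sigma> \<sigma> T) A = emeasure \<sigma> A" .
  qed simp
qed

text \<open>
  \<open>in_Lp\<close> is membership in \<open>L\<^sup>p(\<sigma>)\<close> for \<open>1 \<le> p \<le> \<infinity>\<close>, phrased for Borel representatives; values off
  the sphere are irrelevant. \<open>Lp_norm\<close> is meaningful only for functions satisfying \<open>in_Lp\<close>.
\<close>

definition in_Lp :: "ennreal \<Rightarrow> (real ^ 'n \<Rightarrow> real ^ 'm) \<Rightarrow> bool" where
  "in_Lp p \<phi> \<longleftrightarrow> \<phi> \<in> borel_measurable \<sigma> \<and>
     (if p = \<infinity> then esssup \<sigma> (\<lambda>\<zeta>. ereal (norm (\<phi> \<zeta>))) < \<infinity>
      else integrable \<sigma> (\<lambda>\<zeta>. norm (\<phi> \<zeta>) powr enn2real p))"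

definition Lp_norm :: "ennreal \<Rightarrow> (real ^ 'n \<Rightarrow> real ^ 'm) \<Rightarrow> real" where
  "Lp_norm p \<phi> =
     (if p = \<infinity> then real_of_ereal (esssup \<sigma> (\<lambda>\<zeta>. ereal (norm (\<phi> \<zeta>))))
      else (\<integral>\<zeta>. norm (\<phi> \<zeta>) powr enn2real p \<partial>\<sigma>) powr (1 / enn2real p))"

definition poisson_kernel :: "real ^ 'n \<Rightarrow> real ^ 'n \<Rightarrow> real"  (\<open>P\<^sub>h\<close>) where
  "P\<^sub>h x \<zeta> = ((1 - (norm x)\<^sup>2) / (norm (x - \<zeta>))\<^sup>2) ^ (CARD('n) - 1)"

definition poisson_integral ::
    "(real ^ 'n \<Rightarrow> 'b::{banach, second_countable_topology}) \<Rightarrow> real ^ 'n \<Rightarrow> 'b"  (\<open>P\<^sub>h[_]\<close>) where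
  "P\<^sub>h[\<phi>] x = (\<integral>\<zeta>. P\<^sub>h x \<zeta> *\<^sub>R \<phi> \<zeta> \<partial>\<sigma>)"

definition matrix_norm :: "real ^ 'n ^ 'm \<Rightarrow> real" where
  "matrix_norm A = (SUP \<xi> \<in> sphere 0 1. norm (A *v \<xi>))"

text \<open>
  With a linearly ordered index type the last coordinate is the one with index \<open>Max UNIV\<close>. Every
  dimension is covered, since numeral types such as \<open>3\<close>, \<open>4\<close>, \<dots> are instances of the class used.
\<close>

definition e\<^sub>n :: "real ^ 'n::{finite,wellorder}" where
  "e\<^sub>n = axis (Max UNIV) 1"

text \<open>
  \<open>G TYPE('n) q\<close> is \<open>G\<^sub>p\<close> for the exponent \<open>p\<close> conjugate to \<open>q\<close>.
\<close>

definition G :: "'n::{finite,wellorder} itself \<Rightarrow> ennreal \<Rightarrow> real \<Rightarrow> real" where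
  "G _ q r =
     (if q = \<infinity> then INF a \<in> {0..}. SUP \<eta> \<in> sphere 0 1. \<bar>P\<^sub>h (r *\<^sub>R e\<^sub>n :: real ^ 'n::_) \<eta> - a\<bar>
      else INF a \<in> {0..}.
        (\<integral>\<eta>. \<bar>P\<^sub>h (r *\<^sub>R e\<^sub>n :: real ^ 'n::_) \<eta> - a\<bar> powr enn2real q \<partial>\<sigma>) powr (1 / enn2real q))"

text \<open>For \<open>q = \<infinity>\<close> the Gamma factor is its limit as \<open>q \<rightarrow> \<infinity>\<close>, which is \<open>1\<close>.\<close>

definition gradient_const :: "nat \<Rightarrow> ennreal \<Rightarrow> real" where
  "gradient_const n q = 2 * (real n - 1) *
     (if q = \<infinity> then 1
      else (Gamma (real n / 2) * Gamma ((1 + enn2real q) / 2) /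
            (sqrt pi * Gamma ((real n + enn2real q) / 2))) powr (1 / enn2real q))"

definition upper_hemisphere :: "(real ^ 'n::{finite,wellorder}) set" where
  "upper_hemisphere = {x \<in> sphere 0 1. x $ Max UNIV \<ge> 0}"

definition lower_hemisphere :: "(real ^ 'n::{finite,wellorder}) set" where
  "lower_hemisphere = {x \<in> sphere 0 1. x $ Max UNIV \<le> 0}"

definition U\<^sub>h :: "real ^ 'n::{finite,wellorder} \<Rightarrow> real" where
  "U\<^sub>h = P\<^sub>h[\<lambda>\<zeta>. indicator upper_hemisphere \<zeta> - indicator lower_hemisphere \<zeta>]"

text \<open>
  Diffeomorphisms are taken in the \<open>C\<^sup>1\<close> sense. Derivatives within the interval \<open>S\<close> are one-sided at
  an endpoint belonging to \<open>S\<close> and two-sided in the interior.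
\<close>

definition C1_on :: "real set \<Rightarrow> (real \<Rightarrow> real) \<Rightarrow> bool" where
  "C1_on S f \<longleftrightarrow>
     (\<exists>f'. (\<forall>x\<in>S. (f has_real_derivative f' x) (at x within S)) \<and> continuous_on S f')"

definition increasing_diffeomorphism :: "(real \<Rightarrow> real) \<Rightarrow> real set \<Rightarrow> real set \<Rightarrow> bool" where
  "increasing_diffeomorphism f S T \<longleftrightarrow>
     strict_mono_on S f \<and> bij_betw f S T \<and> C1_on S f \<and> C1_on T (inv_into S f)"

end

theory Submission
  imports Defs
begin

text \<open>
  All kernels involved depend on \<open>\<zeta>\<close> only through \<open>t = \<zeta> \<bullet> b\<close> for a unit vector \<open>b\<close>, and \<open>t\<close> has density
  proportional to \<open>(1 - t\<^sup>2) powr ((n - 3) / 2)\<close> on \<open>[-1, 1]\<close>. Since \<open>u(0) = 0\<close>, a constant may be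
  subtracted from the kernel, and Hoelder's inequality gives both estimates; they are sharp because
  \<open>L\<^sup>q\<close> duality can be realised by mean-zero functions once the constant is the best one.

  For \<open>1 < q < \<infinity>\<close> write the kernel as \<open>1 + r * Q r t\<close>. Then \<open>G r = r * E r powr (1 / q)\<close> where \<open>E r\<close> is the
  minimum over \<open>c\<close> of the integral of \<open>\<bar>Q r t - c\<bar> powr q\<close>, which is smooth up to \<open>r = 0\<close> by an envelope
  argument. Up to a positive factor, \<open>G'\<close> is the integral of \<open>sgn (Q - c) * \<bar>Q - c\<bar> powr (q - 1)\<close> against
  the \<open>r\<close>-derivative of the kernel. That derivative is a positive multiple of the kernel times the
  Moebius image \<open>s\<close> of \<open>t\<close>, and the kernel is the Jacobian of \<open>t \<mapsto> s\<close>; so \<open>G'\<close> becomes the integral of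
  an increasing function of \<open>s\<close> against \<open>s\<close>, which is positive. The cases \<open>q = 1\<close> and \<open>q = \<infinity>\<close> are explicit.
\<close>

section \<open>The distribution of a coordinate on the sphere\<close>

text \<open>Two obstacles shape the case 1 < q < infinity. First, \<open>G\<close> vanishes at r =
  0, exactly where a q-th root fails to be differentiable. Splitting off the factor r cures this:
  the distance of Q to the constants stays positive down to r = 0, so the root is taken away from
  its singularity. Secondly, the best constant is known only to be continuous in r: for q < 2 the
  second derivative of |y|^q blows up at 0, which obstructs implicit differentiation. But the
  subgradient at the best constant has mean zero, so a change of the constant drops out of the
  first-order comparison. The same mean-zero identity says that the extremal field satisfies u(0) =
  0; this is why the bound with the best constant is sharp. Restricting to a >= 0 costs nothing,
  since the best constant is at least the minimum of a positive kernel. The constant in (B) is the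
  L^q norm of 2(n-1)t, the value of Q at r = 0. That function is odd, so its best constant is 0, and
  its norm is a Beta integral.\<close>

lemma has_integral_cap_profile:
  fixes s :: real and d :: nat
  assumes s: "0 < s" "s < 1" and d: "d \<ge> 2"
  shows "((\<lambda>t. min (sqrt (1 - t\<^sup>2)) (t * sqrt (1 - s\<^sup>2) / s) ^ d) has_integral
           real d / (real d + 1) * integral {s..1} (\<lambda>t. sqrt (1 - t\<^sup>2) ^ (d - 2))) {0..1}"
proof -
  \<comment> \<open>\<open>l\<close> is the tangent of the opening angle of a cone around the axis.
    The profile is the radius, at height \<open>t\<close>, of the part of the unit ball inside the
    cone: the cone bounds it up to height \<open>s\<close>, the sphere beyond.\<close>
  define l where "l = sqrt (1 - s\<^sup>2) / s"
  have s2: "s\<^sup>2 < 1" using s by (simp add: abs_square_less_1)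
  have l: "l > 0" using s s2 by (simp add: l_def)
  have ls: "l * s = sqrt (1 - s\<^sup>2)" using s by (simp add: l_def)
  have cmp: "t * l \<le> sqrt (1 - t\<^sup>2) \<longleftrightarrow> t \<le> s" if "0 \<le> t" "t \<le> 1" for t
  proof -
    have t2: "t\<^sup>2 \<le> 1" using that by (simp add: abs_square_le_1)
    have "t * l \<le> sqrt (1 - t\<^sup>2) \<longleftrightarrow> (t * l)\<^sup>2 \<le> 1 - t\<^sup>2"
    proof -
      have "t * l = sqrt ((t * l)\<^sup>2)" using that l by simp
      then show ?thesis by (metis real_sqrt_le_iff)
    qed
    also have "(t * l)\<^sup>2 = t\<^sup>2 * (1 - s\<^sup>2) / s\<^sup>2"
      using s s2 by (simp add: l_def power_mult_distrib power_divide)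
    also have "t\<^sup>2 * (1 - s\<^sup>2) / s\<^sup>2 \<le> 1 - t\<^sup>2 \<longleftrightarrow> t\<^sup>2 \<le> s\<^sup>2"
      using s by (simp add: field_simps)
    also have "\<dots> \<longleftrightarrow> t \<le> s"
      using that s by (simp add: power2_le_iff_abs_le)
    finally show ?thesis .
  qed
  have cmp': "min (sqrt (1 - t\<^sup>2)) (t * l) = sqrt (1 - t\<^sup>2)" if "s \<le> t" "t \<le> 1" for t
    using cmp[of t] that s ls by (cases "t = s") (auto simp: mult.commute)
  have 1: "((\<lambda>t. (t * l) ^ d) has_integral (s * sqrt (1 - s\<^sup>2) ^ d / (real d + 1))) {0..s}"
  proof -
    have "((\<lambda>t. (t * l) ^ d) has_integral (s * (s * l) ^ d / (real d + 1) - 0 * (0 * l) ^ d / (real d + 1))) {0..s}"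
    proof (rule fundamental_theorem_of_calculus)
      fix t :: real
      have "((\<lambda>t. t * (t * l) ^ d / (real d + 1)) has_field_derivative (t * l) ^ d) (at t within {0..s})"
      proof -
        have "((t * l) ^ d + t * (real d * (t * l) ^ (d - 1) * l)) / (real d + 1) = (t * l) ^ d"
          using d by (cases d) (auto simp: field_simps)
        moreover have "((\<lambda>t. t * (t * l) ^ d / (real d + 1)) has_field_derivative
            ((t * l) ^ d + t * (real d * (t * l) ^ (d - 1) * l)) / (real d + 1)) (at t within {0..s})"
          by (auto intro!: derivative_eq_intros)
        ultimately show ?thesis by simp
      qed
      then show "((\<lambda>t. t * (t * l) ^ d / (real d + 1)) has_vector_derivative (t * l) ^ d) (at t within {0..s})"
        by (simp add: has_real_derivative_iff_has_vector_derivative)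
    qed (use s in auto)
    then show ?thesis by (simp add: ls mult.commute)
  qed
  have cont: "continuous_on {s..1} (\<lambda>t. sqrt (1 - t\<^sup>2) ^ m)" for m
    by (intro continuous_intros)
  let ?I = "integral {s..1} (\<lambda>t. sqrt (1 - t\<^sup>2) ^ (d - 2))"
  have Id: "((\<lambda>t. sqrt (1 - t\<^sup>2) ^ m) has_integral integral {s..1} (\<lambda>t. sqrt (1 - t\<^sup>2) ^ m)) {s..1}" for m
    using integrable_integral[OF integrable_continuous_real[OF cont]] .
  let ?J = "integral {s..1} (\<lambda>t. sqrt (1 - t\<^sup>2) ^ d)"
  \<comment> \<open>The antiderivative \<open>t * sqrt (1 - t\<^sup>2) ^ d\<close> lowers the
    exponent from \<open>d\<close> to \<open>d - 2\<close>, and its boundary term at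
    \<open>s\<close> cancels the contribution of the cone. The derivative of the square root blows
    up at 1, hence the interior form of the fundamental theorem.\<close>
  have "((\<lambda>t. (real d + 1) * sqrt (1 - t\<^sup>2) ^ d - real d * sqrt (1 - t\<^sup>2) ^ (d - 2)) has_integral
      (1 * sqrt (1 - 1\<^sup>2) ^ d - s * sqrt (1 - s\<^sup>2) ^ d)) {s..1}"
  proof (rule fundamental_theorem_of_calculus_interior)
    fix t assume t: "t \<in> {s<..<1}"
    have t2: "t\<^sup>2 < 1" using t s by (simp add: abs_square_less_1)
    obtain e where e: "d = Suc (Suc e)" using d by (metis add_2_eq_Suc le_Suc_ex)
    have sq: "t * t + sqrt (1 - t * t) * sqrt (1 - t * t) = 1" using t2 by (simp add: power2_eq_square)
    have nz: "sqrt (1 - t * t) > 0" using t2 by (simp add: power2_eq_square)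
    have eq: "t\<^sup>2 = 1 - sqrt (1 - t * t) * sqrt (1 - t * t)" using sq by (simp add: power2_eq_square)
    have D: "((\<lambda>t. sqrt (1 - t\<^sup>2)) has_field_derivative - t / sqrt (1 - t\<^sup>2)) (at t)"
      using t2 by (auto intro!: derivative_eq_intros simp: divide_simps)
    have "((\<lambda>t. t * sqrt (1 - t\<^sup>2) ^ d) has_field_derivative
        sqrt (1 - t\<^sup>2) ^ d - real d * (t\<^sup>2 * sqrt (1 - t\<^sup>2) ^ (d - 2))) (at t)"
      unfolding e
      by (rule DERIV_cong[OF DERIV_mult[OF DERIV_ident DERIV_power[OF D]]])
        (use nz in \<open>simp add: power2_eq_square\<close>)
    also have "sqrt (1 - t\<^sup>2) ^ d - real d * (t\<^sup>2 * sqrt (1 - t\<^sup>2) ^ (d - 2)) =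
       (real d + 1) * sqrt (1 - t\<^sup>2) ^ d - real d * sqrt (1 - t\<^sup>2) ^ (d - 2)"
    proof -
      define y where "y = sqrt (1 - t\<^sup>2)"
      have t: "t\<^sup>2 = 1 - y * y" using sq by (simp add: y_def power2_eq_square)
      show ?thesis unfolding y_def[symmetric] e t by (simp add: algebra_simps)
    qed
    finally show "((\<lambda>t. t * sqrt (1 - t\<^sup>2) ^ d) has_vector_derivative
        (real d + 1) * sqrt (1 - t\<^sup>2) ^ d - real d * sqrt (1 - t\<^sup>2) ^ (d - 2)) (at t)"
      by (simp add: has_real_derivative_iff_has_vector_derivative)
  qed (use s in \<open>auto intro!: continuous_intros\<close>)
  moreover have "((\<lambda>t. (real d + 1) * sqrt (1 - t\<^sup>2) ^ d - real d * sqrt (1 - t\<^sup>2) ^ (d - 2)) has_integral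
      (real d + 1) * ?J - real d * ?I) {s..1}"
    by (intro has_integral_diff has_integral_mult_right Id)
  ultimately have "(real d + 1) * ?J - real d * ?I = 1 * sqrt (1 - 1\<^sup>2) ^ d - s * sqrt (1 - s\<^sup>2) ^ d"
    using has_integral_unique by blast
  then have J: "s * sqrt (1 - s\<^sup>2) ^ d / (real d + 1) + ?J = real d / (real d + 1) * ?I"
    using d by (auto simp: field_simps power_0_left)
  have "((\<lambda>t. min (sqrt (1 - t\<^sup>2)) (t * l) ^ d) has_integral
      (s * sqrt (1 - s\<^sup>2) ^ d / (real d + 1) + ?J)) {0..1}"
  proof (rule has_integral_combine[where c = s])
    show "((\<lambda>t. min (sqrt (1 - t\<^sup>2)) (t * l) ^ d) has_integral s * sqrt (1 - s\<^sup>2) ^ d / (real d + 1)) {0..s}"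
      by (rule has_integral_eq[OF _ 1]) (use cmp s in \<open>auto simp: min_absorb2\<close>)
    show "((\<lambda>t. min (sqrt (1 - t\<^sup>2)) (t * l) ^ d) has_integral ?J) {s..1}"
      by (rule has_integral_eq[OF _ Id])
        (use cmp' s in auto)
  qed (use s in auto)
  then show ?thesis unfolding J by (simp add: l_def)
qed

text \<open>The surface measure of a cap is by definition a ratio of volumes, and for
  \<open>x \<noteq> 0\<close> the cap condition on \<open>sgn x\<close> clears denominators to
  \<open>s * norm x \<le> x \<bullet> b\<close>. Fubini along \<open>b\<close> slices this sector
  into \<open>d\<close>-dimensional balls whose radius is the profile integrated above.\<close>

lemma emeasure_ball_cap:
  fixes b :: "'a::euclidean_space" and s :: real
  defines "d \<equiv> DIM('a) - 1"
  assumes b: "b \<in> Basis" and s: "0 < s" "s < 1" and d: "d \<ge> 2"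
  shows "emeasure lborel {x. norm x \<le> 1 \<and> s * norm x \<le> x \<bullet> b} =
    ennreal (unit_ball_vol d * (real d / (real d + 1) * integral {s..1} (\<lambda>t. sqrt (1 - t\<^sup>2) ^ (d - 2))))"
proof -
  interpret product_sigma_finite "\<lambda>_. lborel :: real measure"
    by standard
  define A where "A = Basis - {b}"
  have A: "finite A" "b \<notin> A" "Basis = insert b A" "card A = d"
    using b by (auto simp: A_def d_def)
  define \<rho> where "\<rho> t = min (sqrt (1 - t\<^sup>2)) (t * sqrt (1 - s\<^sup>2) / s)" for t
  let ?C = "{x :: 'a. norm x \<le> 1 \<and> s * norm x \<le> x \<bullet> b}"
  have [measurable]: "?C \<in> sets borel"
  proof -
    have "closed ?C" by (intro closed_Collect_conj closed_Collect_le continuous_intros)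
    then show ?thesis by (rule borel_closed)
  qed
  have s2: "s\<^sup>2 < 1" using s by (simp add: abs_square_less_1)
  let ?M = "\<lambda>A. Pi\<^sub>M A (\<lambda>_. lborel :: real measure)"
  let ?S = "\<lambda>r. {f. sqrt (\<Sum>i\<in>A. (f i)\<^sup>2) \<le> r} \<inter> space (?M A)"
  have cond: "norm (\<Sum>i\<in>Basis. (f(b := t)) i *\<^sub>R i) \<le> 1 \<and>
      s * norm (\<Sum>i\<in>Basis. (f(b := t)) i *\<^sub>R i) \<le> (\<Sum>i\<in>Basis. (f(b := t)) i *\<^sub>R i) \<bullet> b \<longleftrightarrow>
      t \<in> {0..1} \<and> sqrt (\<Sum>i\<in>A. (f i)\<^sup>2) \<le> \<rho> t" for f :: "'a \<Rightarrow> real" and t :: real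
  proof -
    define S where "S = (\<Sum>i\<in>A. (f i)\<^sup>2)"
    have S: "S \<ge> 0" by (auto simp: S_def intro: sum_nonneg)
    have nrm: "norm (\<Sum>i\<in>Basis. (f(b := t)) i *\<^sub>R i) = sqrt (t\<^sup>2 + S)"
    proof -
      have "(\<Sum>i\<in>A. ((f(b := t)) i)\<^sup>2) = S"
        unfolding S_def using A by (intro sum.cong) auto
      then have "(\<Sum>i\<in>Basis. ((f(b := t)) i)\<^sup>2) = t\<^sup>2 + S"
        using A by (simp only: A(3) sum.insert[OF A(1,2)]) simp
      then show ?thesis
        using euclidean_dist_l2[of 0 "\<Sum>i\<in>Basis. (f(b := t)) i *\<^sub>R i"]
        by (simp only: dist_0_norm L2_set_def) (simp add: fun_upd_def cong: if_cong)
    qed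
    have inn: "(\<Sum>i\<in>Basis. (f(b := t)) i *\<^sub>R i) \<bullet> b = t"
      using b by (simp del: fun_upd_apply) simp
    have "sqrt (t\<^sup>2 + S) \<le> 1 \<and> s * sqrt (t\<^sup>2 + S) \<le> t \<longleftrightarrow> t \<in> {0..1} \<and> sqrt S \<le> \<rho> t"
    proof -
      have e1: "sqrt (t\<^sup>2 + S) \<le> 1 \<longleftrightarrow> S \<le> 1 - t\<^sup>2" by auto
      have e2: "s * sqrt (t\<^sup>2 + S) \<le> t \<longleftrightarrow> 0 \<le> t \<and> s\<^sup>2 * (t\<^sup>2 + S) \<le> t\<^sup>2"
      proof -
        have "s * sqrt (t\<^sup>2 + S) = sqrt (s\<^sup>2 * (t\<^sup>2 + S))" using s by (simp add: real_sqrt_mult)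
        moreover have "sqrt (s\<^sup>2 * (t\<^sup>2 + S)) \<le> t \<longleftrightarrow> 0 \<le> t \<and> s\<^sup>2 * (t\<^sup>2 + S) \<le> t\<^sup>2"
        proof (cases "0 \<le> t")
          case True
          then show ?thesis using S by (subst real_sqrt_le_iff') auto
        next
          case False
          then have "t < sqrt (s\<^sup>2 * (t\<^sup>2 + S))" using S by (smt (verit) real_sqrt_ge_zero zero_le_power2 mult_nonneg_nonneg)
          then show ?thesis using False by auto
        qed
        ultimately show ?thesis by simp
      qed
      have e3: "s\<^sup>2 * (t\<^sup>2 + S) \<le> t\<^sup>2 \<longleftrightarrow> S \<le> (t * sqrt (1 - s\<^sup>2) / s)\<^sup>2"
        using s s2 by (simp add: power_mult_distrib power_divide field_simps)
      have e4: "sqrt S \<le> t * sqrt (1 - s\<^sup>2) / s \<longleftrightarrow> S \<le> (t * sqrt (1 - s\<^sup>2) / s)\<^sup>2" if "0 \<le> t"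
        using that s s2 S by (intro real_sqrt_le_iff') auto
      have e5: "S \<le> 1 - t\<^sup>2 \<Longrightarrow> 0 \<le> t \<Longrightarrow> t \<le> 1" using S
        by (smt (verit, ccfv_SIG) one_less_power pos2)
      show ?thesis unfolding e1 e2 e3 \<rho>_def using e4 e5 by auto
    qed
    then show ?thesis unfolding nrm inn S_def .
  qed
  have "emeasure lborel ?C = emeasure (?M Basis) ((\<lambda>f. \<Sum>b\<in>Basis. f b *\<^sub>R b) -` ?C \<inter> space (?M Basis))"
  proof -
    have "emeasure lborel ?C = emeasure (distr (?M Basis) borel (\<lambda>f. \<Sum>b\<in>Basis. f b *\<^sub>R b)) ?C"
      by (rule arg_cong2[OF lborel_eq refl])
    also have "\<dots> = emeasure (?M Basis) ((\<lambda>f. \<Sum>b\<in>Basis. f b *\<^sub>R b) -` ?C \<inter> space (?M Basis))"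
      by (rule emeasure_distr) auto
    finally show ?thesis .
  qed
  also have "\<dots> = (\<integral>\<^sup>+ f. indicator ?C (\<Sum>i\<in>Basis. f i *\<^sub>R i) \<partial>?M Basis)"
  proof -
    have "(\<lambda>f. \<Sum>b\<in>Basis. f b *\<^sub>R b) -` ?C \<inter> space (?M Basis) \<in> sets (?M Basis)"
      by (rule measurable_sets[OF _ \<open>?C \<in> sets borel\<close>]) measurable
    from nn_integral_indicator[OF this] show ?thesis
      by (auto intro!: nn_integral_cong simp: indicator_def simp flip: nn_integral_indicator)
  qed
  also have "\<dots> = (\<integral>\<^sup>+ t. \<integral>\<^sup>+ f. indicator ?C (\<Sum>i\<in>Basis. (f(b := t)) i *\<^sub>R i) \<partial>?M A \<partial>lborel)"
    unfolding A(3) by (subst product_nn_integral_insert_rev[OF A(1,2)]) (simp_all add: A(3)[symmetric])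
  also have "\<dots> = (\<integral>\<^sup>+ t. indicator {0..1} t * emeasure (?M A) (?S (\<rho> t)) \<partial>lborel)"
  proof (intro nn_integral_cong)
    fix t :: real
    have [measurable]: "?S (\<rho> t) \<in> sets (?M A)"
      using A(1) by measurable
    have "(\<integral>\<^sup>+ f. indicator ?C (\<Sum>i\<in>Basis. (f(b := t)) i *\<^sub>R i) \<partial>?M A) =
       (\<integral>\<^sup>+ f. indicator {0..1} t * indicator (?S (\<rho> t)) f \<partial>?M A)"
      using cond[of _ t] by (intro nn_integral_cong) (auto simp: indicator_def)
    also have "\<dots> = indicator {0..1} t * emeasure (?M A) (?S (\<rho> t))"
      by (subst nn_integral_cmult) auto
    finally show "(\<integral>\<^sup>+ f. indicator ?C (\<Sum>i\<in>Basis. (f(b := t)) i *\<^sub>R i) \<partial>?M A) =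
       indicator {0..1} t * emeasure (?M A) (?S (\<rho> t))" .
  qed
  also have "\<dots> = (\<integral>\<^sup>+ t. ennreal (unit_ball_vol d) * ennreal (indicator {0..1} t * \<rho> t ^ d) \<partial>lborel)"
  proof (intro nn_integral_cong_AE)
    \<comment> \<open>At these two heights the slice degenerates to radius 0, while the volume
      formula for balls is applied with a positive radius.\<close>
    have "AE t in lborel. t \<noteq> (0::real) \<and> t \<noteq> 1"
      using AE_lborel_singleton[of 0] AE_lborel_singleton[of 1] by auto
    then show "AE t in lborel. indicator {0..1} t * emeasure (?M A) (?S (\<rho> t)) =
       ennreal (unit_ball_vol d) * ennreal (indicator {0..1} t * \<rho> t ^ d)"
    proof eventually_elim
      case (elim t)
      show ?case
      proof (cases "t \<in> {0..1}")
        case True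
        then have "\<rho> t > 0" using elim s s2 by (auto simp: \<rho>_def abs_square_less_1)
        then show ?thesis
          using True emeasure_cball_aux[OF A(1), of "\<rho> t"] A(4)
          by (simp add: ennreal_mult)
      qed auto
    qed
  qed
  also have "\<dots> = ennreal (unit_ball_vol d) * (\<integral>\<^sup>+ t. ennreal (indicator {0..1} t * \<rho> t ^ d) \<partial>lborel)"
    by (intro nn_integral_cmult) (simp add: \<rho>_def)
  also have "(\<integral>\<^sup>+ t. ennreal (indicator {0..1} t * \<rho> t ^ d) \<partial>lborel) =
      ennreal (real d / (real d + 1) * integral {s..1} (\<lambda>t. sqrt (1 - t\<^sup>2) ^ (d - 2)))"
    using has_integral_cap_profile[OF s d] s s2
    by (intro nn_integral_has_integral_lebesgue) (auto simp: \<rho>_def abs_square_le_1)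
  finally show ?thesis
    by (simp only: ennreal_mult'[OF unit_ball_vol_nonneg[OF of_nat_0_le_iff]])
qed

text \<open>Caps are computed at positive heights only, and symmetry supplies the rest. For
  \<open>x < 0\<close> the value of the cdf is itself a tail at \<open>- x\<close>; for
  \<open>x \<ge> 0\<close> the open tail beyond \<open>x\<close> is an increasing union of closed
  tails at positive points.\<close>

lemma symmetric_real_distribution_eqI:
  assumes M: "real_distribution M" and N: "real_distribution N"
    and symM: "\<And>s. measure M {..- s} = measure M {s..}"
    and symN: "\<And>s. measure N {..- s} = measure N {s..}"
    and eq: "\<And>s. s > 0 \<Longrightarrow> measure M {s..} = measure N {s..}"
  shows "M = N"
proof (rule cdf_unique[OF M N], rule ext)
  interpret M: real_distribution M by fact
  interpret N: real_distribution N by fact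
  fix x :: real
  show "cdf M x = cdf N x"
  proof (cases "x < 0")
    case True
    then show ?thesis using symM[of "-x"] symN[of "-x"] eq[of "-x"] by (simp add: cdf_def)
  next
    case False
    have U: "(\<Union>k. {x + inverse (real (Suc k))..}) = {x<..}"
    proof safe
      fix y assume "x < y"
      then obtain k where "inverse (real (Suc k)) < y - x"
        using reals_Archimedean[of "y - x"] by auto
      then show "y \<in> (\<Union>k. {x + inverse (real (Suc k))..})" by (auto intro!: exI[of _ k])
    next
      fix y k assume "x + inverse (real (Suc k)) \<le> y"
      moreover have "inverse (real (Suc k)) > 0" by simp
      ultimately show "x < y" by linarith
    qed
    have inc: "incseq (\<lambda>k. {x + inverse (real (Suc k))..})"
      by (auto simp: incseq_def intro: order_trans[rotated] le_imp_inverse_le)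
    have "(\<lambda>k. measure M {x + inverse (real (Suc k))..}) \<longlonglongrightarrow> measure M {x<..}"
      using M.finite_Lim_measure_incseq[OF image_subsetI inc] unfolding U by simp
    moreover have "(\<lambda>k. measure N {x + inverse (real (Suc k))..}) \<longlonglongrightarrow> measure N {x<..}"
      using N.finite_Lim_measure_incseq[OF image_subsetI inc] unfolding U by simp
    moreover have "measure M {x + inverse (real (Suc k))..} = measure N {x + inverse (real (Suc k))..}" for k
      using False by (intro eq add_nonneg_pos) auto
    ultimately have *: "measure M {x<..} = measure N {x<..}"
      using LIMSEQ_unique by simp
    have "UNIV - {x<..} = {..x}" by auto
    then have "measure M {..x} = 1 - measure M {x<..}" "measure N {..x} = 1 - measure N {x<..}"
      using M.prob_compl[of "{x<..}"] N.prob_compl[of "{x<..}"] by auto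
    then show ?thesis using * by (simp add: cdf_def)
  qed
qed

text \<open>The power (n - 3)/2 of \<open>1 - t\<^sup>2\<close> is written as a natural power of the
  square root. It is then continuous on the closed interval even for \<open>n = 3\<close>, where it
  is constantly 1, endpoints included.\<close>

definition axial_density :: "nat \<Rightarrow> real \<Rightarrow> real" where
  "axial_density n t = indicator {-1..1} t * sqrt (1 - t\<^sup>2) ^ (n - 3) / Beta (1/2) ((real n - 1) / 2)"

lemma axial_density_measurable [measurable]: "axial_density n \<in> borel_measurable borel"
  unfolding axial_density_def by measurable

lemma axial_Beta_pos: "n \<ge> 3 \<Longrightarrow> Beta (1/2) ((real n - 1) / 2) > (0::real)"
  by (auto simp: Beta_def field_simps intro!: divide_pos_pos mult_pos_pos Gamma_real_pos)

lemma axial_density_nonneg: "n \<ge> 3 \<Longrightarrow> axial_density n t \<ge> 0"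
  using axial_Beta_pos[of n] by (auto simp: axial_density_def indicator_def abs_square_le_1)

lemma axial_density_minus: "axial_density n (- t) = axial_density n t"
  by (auto simp: axial_density_def indicator_def)

definition axial_real :: "nat \<Rightarrow> real measure" where
  "axial_real n = density lborel (\<lambda>t. ennreal (axial_density n t))"

lemma real_distribution_axial_real:
  assumes n: "n \<ge> 3"
  shows "real_distribution (axial_real n)"
proof -
  have B: "Beta (1/2) ((real n - 1) / 2) > (0::real)" using axial_Beta_pos[OF n] .
  have "(\<integral>\<^sup>+ t. ennreal (axial_density n t) \<partial>lborel) =
    (\<integral>\<^sup>+ t. ennreal (indicator {-1..1} t * sqrt (1 - t\<^sup>2) ^ (n - 3)) * ennreal (1 / Beta (1/2) ((real n - 1) / 2)) \<partial>lborel)"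
    using B by (intro nn_integral_cong) (simp add: axial_density_def flip: ennreal_mult'')
  also have "\<dots> = ennreal (Beta (1/2) (real (n - 3) / 2 + 1)) * ennreal (1 / Beta (1/2) ((real n - 1) / 2))"
    by (subst nn_integral_multc) (auto simp: emeasure_cball_aux_integral)
  also have "real (n - 3) / 2 + 1 = (real n - 1) / 2" using n by (simp add: field_simps of_nat_diff)
  also have "ennreal (Beta (1/2) ((real n - 1) / 2)) * ennreal (1 / Beta (1/2) ((real n - 1) / 2)) = 1"
    using B by (simp flip: ennreal_mult')
  finally have "prob_space (axial_real n)"
    unfolding axial_real_def by (intro prob_spaceI) (simp add: emeasure_density)
  then show ?thesis by (simp add: real_distribution_def real_distribution_axioms_def axial_real_def)
qed

lemma axial_real_symmetric: "distr (axial_real n) borel uminus = axial_real n"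
proof (rule measure_eqI)
  fix A :: "real set" assume "A \<in> sets (distr (axial_real n) borel uminus)"
  then have A [measurable]: "A \<in> sets borel" by simp
  have [measurable]: "uminus -` A \<in> sets borel"
  proof -
    have "(uminus :: real \<Rightarrow> real) \<in> borel_measurable borel" by measurable
    from measurable_sets[OF this A] show ?thesis by simp
  qed
  have "emeasure (distr (axial_real n) borel uminus) A = emeasure (axial_real n) (uminus -` A)"
    by (subst emeasure_distr) (auto simp: axial_real_def)
  also have "\<dots> = (\<integral>\<^sup>+ t. ennreal (axial_density n t) * indicator (uminus -` A) t \<partial>lborel)"
    unfolding axial_real_def by (intro emeasure_density) auto
  also have "\<dots> = (\<integral>\<^sup>+ t. ennreal (axial_density n t) * indicator A t \<partial>lborel)"
  proof -
    have [measurable]: "(\<lambda>t. ennreal (axial_density n t) * indicator (uminus -` A) t) \<in> borel_measurable borel"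
      by measurable
    show ?thesis
      by (subst nn_integral_real_affine[where c = "-1" and t = 0])
        (simp_all add: axial_density_minus indicator_def)
  qed
  also have "\<dots> = emeasure (axial_real n) A"
    unfolding axial_real_def by (intro emeasure_density[symmetric]) auto
  finally show "emeasure (distr (axial_real n) borel uminus) A = emeasure (axial_real n) A" .
qed (simp add: axial_real_def)

lemma axial_real_tail:
  assumes n: "n \<ge> 3" and s: "0 < s" "s < 1"
  shows "measure (axial_real n) {s..} =
    integral {s..1} (\<lambda>t. sqrt (1 - t\<^sup>2) ^ (n - 3)) / Beta (1/2) ((real n - 1) / 2)"
proof -
  have B: "Beta (1/2) ((real n - 1) / 2) > (0::real)" using axial_Beta_pos[OF n] .
  have "((\<lambda>t. sqrt (1 - t\<^sup>2) ^ (n - 3)) has_integral integral {s..1} (\<lambda>t. sqrt (1 - t\<^sup>2) ^ (n - 3))) {s..1}"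
    by (intro integrable_integral integrable_continuous_real continuous_intros)
  then have *: "((\<lambda>t. sqrt (1 - t\<^sup>2) ^ (n - 3) / Beta (1/2) ((real n - 1) / 2)) has_integral
     integral {s..1} (\<lambda>t. sqrt (1 - t\<^sup>2) ^ (n - 3)) / Beta (1/2) ((real n - 1) / 2)) {s..1}"
    by (rule has_integral_divide)
  have "emeasure (axial_real n) {s..} = (\<integral>\<^sup>+ t. ennreal (axial_density n t) * indicator {s..} t \<partial>lborel)"
    unfolding axial_real_def by (intro emeasure_density) auto
  also have "\<dots> = (\<integral>\<^sup>+ t. ennreal (indicator {s..1} t * (sqrt (1 - t\<^sup>2) ^ (n - 3) / Beta (1/2) ((real n - 1) / 2))) \<partial>lborel)"
    using s by (intro nn_integral_cong) (auto simp: axial_density_def indicator_def)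
  also have "\<dots> = ennreal (integral {s..1} (\<lambda>t. sqrt (1 - t\<^sup>2) ^ (n - 3)) / Beta (1/2) ((real n - 1) / 2))"
    using s B by (intro nn_integral_has_integral_lebesgue[OF _ *]) (auto simp: abs_square_le_1)
  finally have "emeasure (axial_real n) {s..} =
    ennreal (integral {s..1} (\<lambda>t. sqrt (1 - t\<^sup>2) ^ (n - 3)) / Beta (1/2) ((real n - 1) / 2))" .
  moreover have "integral {s..1} (\<lambda>t. sqrt (1 - t\<^sup>2) ^ (n - 3)) \<ge> 0"
    using s by (intro integral_nonneg integrable_continuous_real continuous_intros) (auto simp: abs_square_le_1)
  ultimately show ?thesis using B by (simp add: measure_def)
qed

text \<open>The Beta recurrence writes the volume of the whole ball as
  \<open>unit_ball_vol d * d / (d + 1)\<close> times \<open>Beta (1/2) ((n - 1) / 2)\<close>. The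
  sector has the same factor in front of its tail integral, so the quotient is exactly the
  normalised tail.\<close>

lemma measure_surface_cap:
  fixes b :: "real ^ 'n"
  assumes n: "CARD('n) \<ge> 3" and b: "b \<in> Basis" and s: "0 < s" "s < 1"
  shows "measure \<sigma> {\<zeta> \<in> sphere 0 1. s \<le> \<zeta> \<bullet> b} = measure (axial_real CARD('n)) {s..}"
proof -
  let ?n = "CARD('n)" and ?d = "DIM(real ^ 'n) - 1"
  let ?C = "{x :: real ^ 'n. norm x \<le> 1 \<and> s * norm x \<le> x \<bullet> b}"
  let ?A = "{\<zeta> \<in> sphere (0 :: real ^ 'n) 1. s \<le> \<zeta> \<bullet> b}"
  let ?I = "integral {s..1} (\<lambda>t. sqrt (1 - t\<^sup>2) ^ (?n - 3))"
  have C: "?C \<in> sets lborel"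
  proof -
    have "closed ?C" by (intro closed_Collect_conj closed_Collect_le continuous_intros)
    then show ?thesis by (simp add: borel_closed)
  qed
  have A: "?A \<in> sets \<sigma>"
  proof -
    have "closed ?A" unfolding Collect_conj_eq Collect_mem_eq
      by (intro closed_Int closed_Collect_le continuous_intros) auto
    then show ?thesis by (auto simp: sets_surface_measure sets_restrict_space_iff borel_closed)
  qed
  have sgn_iff: "sgn x \<in> ?A \<longleftrightarrow> x \<noteq> 0 \<and> s * norm x \<le> x \<bullet> b" for x
    by (auto simp: sgn_div_norm field_simps norm_sgn)
  have null: "sphere (0 :: real ^ 'n) 1 \<union> {0} \<in> null_sets lborel"
  proof -
    have "negligible (sphere (0 :: real ^ 'n) 1 \<union> {0})" by (intro negligible_Un negligible_sphere) auto
    then show ?thesis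
      by (subst null_sets_completion_iff[symmetric]) (auto simp: negligible_iff_null_sets)
  qed
  have "emeasure \<sigma> ?A = emeasure lborel {x \<in> ball 0 1. sgn x \<in> ?A} / emeasure lborel (ball 0 1 :: (real ^ 'n) set)"
    using A by (rule emeasure_surface_measure)
  also have "{x \<in> ball 0 1. sgn x \<in> ?A} = ?C - (sphere 0 1 \<union> {0})"
    unfolding sgn_iff by auto
  also have "emeasure lborel \<dots> = emeasure lborel ?C"
    using null C by (intro emeasure_Diff_null_set)
  also have "\<dots> = ennreal (unit_ball_vol ?d * (real ?d / (real ?d + 1) * ?I))"
  proof -
    have "?d - 2 = ?n - 3" by simp
    then show ?thesis using n emeasure_ball_cap[OF b s] by simp
  qed
  also have "emeasure lborel (ball (0 :: real ^ 'n) 1) = ennreal (unit_ball_vol ?n)"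
    by (simp add: emeasure_ball)
  also have "unit_ball_vol ?n = unit_ball_vol ?d * (real ?d / (real ?d + 1) * Beta (1/2) ((real ?n - 1) / 2))"
  proof -
    have d: "real ?d = real ?n - 1" "real ?d > 0" using n by (auto simp: of_nat_diff)
    have "unit_ball_vol ?n = unit_ball_vol ?d * Beta (1/2) (real ?d / 2 + 1)"
    proof -
      have "real ?n = 1 + real ?d" using d by simp
      then show ?thesis using d
        by (auto simp: unit_ball_vol_def Beta_def Gamma_eq_zero_iff field_simps
          Gamma_one_half_real powr_half_sqrt [symmetric] powr_add [symmetric])
    qed
    also have "Beta (1/2) (real ?d / 2 + 1) = real ?d / (real ?d + 1) * Beta (1/2) (real ?d / 2)"
    proof -
      have "(1/2 + real ?d / 2) * Beta (1/2) (real ?d / 2 + 1) = real ?d / 2 * Beta (1/2) (real ?d / 2)"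
        by (rule Beta_plus1_right) (use d in \<open>auto elim!: nonpos_Ints_cases'\<close>)
      then show ?thesis using d by (simp add: field_simps)
    qed
    finally show ?thesis using d by simp
  qed
  finally have e: "emeasure \<sigma> ?A = ennreal (unit_ball_vol ?d * (real ?d / (real ?d + 1) * ?I)) /
     ennreal (unit_ball_vol ?d * (real ?d / (real ?d + 1) * Beta (1/2) ((real ?n - 1) / 2)))" .
  have I: "?I \<ge> 0"
    using s by (intro integral_nonneg integrable_continuous_real continuous_intros) (auto simp: abs_square_le_1)
  have B: "Beta (1/2) ((real ?n - 1) / 2) > 0" by (rule axial_Beta_pos[OF n])
  have div: "ennreal (c * (a * x)) / ennreal (c * (a * y)) = ennreal (x / y)"
    if "c > 0" "a > 0" "x \<ge> 0" "y > 0" for c a x y :: real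
    using that by (subst divide_ennreal) auto
  have "emeasure \<sigma> ?A = ennreal (?I / Beta (1/2) ((real ?n - 1) / 2))"
    unfolding e using n by (intro div I B) auto
  then show ?thesis
    using I B axial_real_tail[OF n s] by (simp add: measure_def)
qed

text \<open>An orthogonal map carrying one unit vector to another preserves the measure, so
  \<open>b\<close> may be replaced by a coordinate vector \<open>c\<close>. The map carrying
  \<open>c\<close> to \<open>- c\<close> gives the symmetry that reduces the claim to tails at
  positive heights.\<close>

lemma distr_surface_inner:
  fixes b :: "real ^ 'n::{finite,wellorder}"
  assumes n: "CARD('n) \<ge> 3" and b: "norm b = 1"
  shows "distr \<sigma> borel (\<lambda>\<zeta>. \<zeta> \<bullet> b) = axial_real CARD('n)"
proof -
  interpret S: prob_space "\<sigma> :: (real ^ 'n::_) measure" by (rule prob_space_surface_measure)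
  have sm: "f \<in> borel_measurable \<sigma>" if "f \<in> borel_measurable borel" for f :: "real ^ 'n::_ \<Rightarrow> real"
    using that by (simp add: measurable_cong_sets[OF sets_surface_measure refl] measurable_restrict_space1)
  obtain c :: "real ^ 'n::_" where c: "c \<in> Basis" using nonempty_Basis by blast
  have rot: "distr \<sigma> borel (\<lambda>\<zeta>. \<zeta> \<bullet> v) = distr \<sigma> borel (\<lambda>\<zeta>. \<zeta> \<bullet> w)"
    if vw: "norm v = norm w" for v w :: "real ^ 'n::_"
  proof -
    obtain T where T: "orthogonal_transformation T" "T v = w"
      using orthogonal_transformation_exists[OF vw] by blast
    have Tm: "T \<in> \<sigma> \<rightarrow>\<^sub>M \<sigma>"
    proof -
      have "T \<in> borel_measurable borel"
        using T by (intro borel_measurable_continuous_onI linear_continuous_on)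
          (simp add: orthogonal_transformation_linear flip: linear_conv_bounded_linear)
      then show ?thesis using T
        by (subst measurable_cong_sets[OF sets_surface_measure sets_surface_measure],
            intro measurable_restrict_space3) (auto simp: orthogonal_transformation)
    qed
    have "distr \<sigma> borel (\<lambda>\<zeta>. \<zeta> \<bullet> w) = distr (distr \<sigma> \<sigma> T) borel (\<lambda>\<zeta>. \<zeta> \<bullet> w)"
      by (simp add: rotation_invariant_surface_measure[OF T(1)])
    also have "\<dots> = distr \<sigma> borel (\<lambda>\<zeta>. T \<zeta> \<bullet> w)"
      using Tm by (subst distr_distr) (auto intro!: sm simp: comp_def)
    also have "(\<lambda>\<zeta>. T \<zeta> \<bullet> w) = (\<lambda>\<zeta>. \<zeta> \<bullet> v)"
      using T by (auto simp: orthogonal_transformation_def)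
    finally show ?thesis ..
  qed
  let ?M = "distr \<sigma> borel (\<lambda>\<zeta>. \<zeta> \<bullet> c)"
  interpret N: real_distribution "axial_real CARD('n)" by (rule real_distribution_axial_real[OF n])
  have M: "real_distribution ?M"
    by (simp add: real_distribution_def real_distribution_axioms_def S.prob_space_distr sm)
  interpret M: real_distribution ?M by (rule M)
  have meas: "measure ?M X = measure \<sigma> {\<zeta> \<in> sphere 0 1. \<zeta> \<bullet> c \<in> X}" if "X \<in> sets borel" for X
    using that by (subst measure_distr) (auto intro!: sm arg_cong[where f = "measure \<sigma>"])
  have "?M = axial_real CARD('n)"
  proof (rule symmetric_real_distribution_eqI[OF M N.real_distribution_axioms])
    show "measure ?M {..- s} = measure ?M {s..}" for s
    proof -
      have "measure ?M {..- s} = measure (distr \<sigma> borel (\<lambda>\<zeta>. \<zeta> \<bullet> (- c))) {..- s}"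
        by (subst rot[of "- c" c]) auto
      also have "\<dots> = measure \<sigma> {\<zeta> \<in> sphere 0 1. \<zeta> \<bullet> c \<in> {s..}}"
        by (subst measure_distr) (auto intro!: sm arg_cong[where f = "measure \<sigma>"])
      finally show ?thesis by (subst (asm) meas[symmetric]) auto
    qed
    show "measure (axial_real CARD('n)) {..- s} = measure (axial_real CARD('n)) {s..}" for s
    proof -
      have "measure (axial_real CARD('n)) {..- s} = measure (distr (axial_real CARD('n)) borel uminus) {..- s}"
        by (simp add: axial_real_symmetric)
      also have "\<dots> = measure (axial_real CARD('n)) {s..}"
        by (subst measure_distr) (auto simp: axial_real_def intro!: arg_cong[where f = "measure _"])
      finally show ?thesis .
    qed
    have lt1: "measure ?M {s..} = measure (axial_real CARD('n)) {s..}" if "0 < s" "s < 1" for s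
      using measure_surface_cap[OF n c that] by (subst meas) auto
    have null: "measure (axial_real CARD('n)) {1..} = 0"
    proof -
      have "emeasure (axial_real CARD('n)) {1..} =
          (\<integral>\<^sup>+ t. ennreal (axial_density CARD('n) t) * indicator {1..} t \<partial>lborel)"
        unfolding axial_real_def by (intro emeasure_density) auto
      also have "\<dots> = (\<integral>\<^sup>+ t. 0 \<partial>(lborel :: real measure))"
        using AE_lborel_singleton[of 1]
        by (intro nn_integral_cong_AE) (auto simp: axial_density_def indicator_def elim!: eventually_mono)
      finally show ?thesis by (simp add: measure_def)
    qed
    \<comment> \<open>The double successor keeps every height \<open>1 - 1 / (k + 2)\<close>
      strictly positive, as the cap formula requires.\<close>
    have ex: "(\<lambda>k. measure (axial_real CARD('n)) {1 - inverse (real (Suc (Suc k)))..}) \<longlonglongrightarrow> measure (axial_real CARD('n)) {1..}"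
    proof -
      have "(\<Inter>k. {1 - inverse (real (Suc (Suc k)))..}) = {1::real..}"
      proof safe
        fix y :: real assume "y \<in> (\<Inter>k. {1 - inverse (real (Suc (Suc k)))..})"
        then have *: "1 - inverse (real (Suc (Suc k))) \<le> y" for k by auto
        show "1 \<le> y"
        proof (rule ccontr)
          assume "\<not> 1 \<le> y"
          then obtain k where "inverse (real (Suc k)) < 1 - y" using reals_Archimedean[of "1 - y"] by auto
          moreover have "inverse (real (Suc (Suc k))) \<le> inverse (real (Suc k))"
            by (intro le_imp_inverse_le) auto
          ultimately show False using *[of k] by linarith
        qed
      next
        fix y :: real and k assume "1 \<le> y"
        moreover have "inverse (real (Suc (Suc k))) > 0" by simp
        ultimately show "1 - inverse (real (Suc (Suc k))) \<le> y" by linarith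
      qed
      note I = this
      have dec: "decseq (\<lambda>k. {1 - inverse (real (Suc (Suc k)))..})"
        by (auto simp: decseq_def intro: order_trans[rotated] le_imp_inverse_le)
      from N.finite_Lim_measure_decseq[OF image_subsetI dec] show ?thesis unfolding I by simp
    qed
    \<comment> \<open>From height 1 on the cap formula says nothing; there the tail is squeezed
      between 0 and the tails just below 1, which tend to the tail at 1, a null set for the
      density.\<close>
    show "measure ?M {s..} = measure (axial_real CARD('n)) {s..}" if "0 < s" for s
    proof (cases "s < 1")
      case False
      have "measure ?M {s..} \<le> measure (axial_real CARD('n)) {1 - inverse (real (Suc (Suc k)))..}" for k
      proof -
        have i: "inverse (real (Suc (Suc k))) > 0" "inverse (real (Suc (Suc k))) < 1"
          by (auto simp: field_simps)
        have "{s..} \<subseteq> {1 - inverse (real (Suc (Suc k)))..}"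
        proof (rule subsetI)
          fix y assume "y \<in> {s..}"
          then show "y \<in> {1 - inverse (real (Suc (Suc k)))..}"
            using False i(1) unfolding atLeast_iff by linarith
        qed
        then have "measure ?M {s..} \<le> measure ?M {1 - inverse (real (Suc (Suc k)))..}"
          by (rule M.finite_measure_mono) simp
        also have "\<dots> = measure (axial_real CARD('n)) {1 - inverse (real (Suc (Suc k)))..}"
          using i by (intro lt1) auto
        finally show ?thesis .
      qed
      then have "measure ?M {s..} \<le> 0"
        unfolding null[symmetric] by (intro LIMSEQ_le_const[OF ex] exI allI impI)
      moreover have "measure (axial_real CARD('n)) {s..} \<le> 0"
        unfolding null[symmetric] using False by (intro N.finite_measure_mono) auto
      ultimately show ?thesis using measure_nonneg[of ?M "{s..}"] measure_nonneg[of "axial_real CARD('n)" "{s..}"] by linarith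
    qed (use that lt1 in auto)
  qed
  then show ?thesis using rot[of b c] b c by simp
qed

section \<open>Convexity of powers and the envelope theorem\<close>

text \<open>For \<open>q > 1\<close> this is the derivative of \<open>\<bar>y\<bar> powr q\<close>
  divided by \<open>q\<close>; for \<open>q = 1\<close> it is the sign, the subgradient of the
  absolute value that is 0 at the origin.\<close>

definition signed_power :: "real \<Rightarrow> real \<Rightarrow> real" where
  "signed_power q y = sgn y * \<bar>y\<bar> powr (q - 1)"

lemma signed_power_zero [simp]: "signed_power q 0 = 0"
  by (simp add: signed_power_def)

lemma signed_power_minus: "signed_power q (- y) = - signed_power q y"
  by (simp add: signed_power_def sgn_minus)

text \<open>Free of \<open>sgn\<close>, so that continuity and measurability are inherited from
  \<open>max\<close> and \<open>powr\<close>.\<close>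

lemma signed_power_alt:
  "signed_power q y = max y 0 powr (q - 1) - max (- y) 0 powr (q - 1)"
  by (cases "y = 0") (auto simp: signed_power_def sgn_if max_def)

lemma signed_power_mult_self: "signed_power q y * y = \<bar>y\<bar> powr q"
  by (cases "y = 0") (auto simp: signed_power_def sgn_if powr_diff)

lemma abs_signed_power: "\<bar>signed_power q y\<bar> = \<bar>y\<bar> powr (q - 1)"
  by (cases "y = 0") (auto simp: signed_power_def abs_mult sgn_if)

lemma abs_signed_power_powr:
  assumes "q > 1" shows "\<bar>signed_power q y\<bar> powr (q / (q - 1)) = \<bar>y\<bar> powr q"
  using assms by (simp add: abs_signed_power powr_powr)

lemma signed_power_strict_mono:
  assumes "q > 1" "x < y" shows "signed_power q x < signed_power q y"
proof -
  consider "0 \<le> x" | "y \<le> 0" | "x < 0" "0 < y" using assms by linarith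
  then show ?thesis
  proof cases
    case 1 then show ?thesis using assms
      by (simp add: signed_power_alt max_def powr_less_mono2)
  next
    case 2 then show ?thesis using assms
      by (cases "y = 0") (simp_all add: signed_power_alt max_def powr_less_mono2)
  next
    case 3 
    then have "signed_power q x < 0" "0 < signed_power q y" by (auto simp: signed_power_def sgn_if)
    then show ?thesis by linarith
  qed
qed

lemma continuous_on_signed_power [continuous_intros]:
  assumes "q > 1" "continuous_on A f" shows "continuous_on A (\<lambda>x. signed_power q (f x))"
  unfolding signed_power_alt using assms
  by (intro continuous_on_diff continuous_on_powr' continuous_on_max continuous_on_minus continuous_on_const) auto

lemma signed_power_measurable [measurable]: "signed_power q \<in> borel_measurable borel"
  unfolding signed_power_alt[abs_def] by measurable

lemma continuous_on_abs_powr [continuous_intros]: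
  fixes f :: "'a::topological_space \<Rightarrow> real"
  assumes "q > 0" "continuous_on A f" shows "continuous_on A (\<lambda>x. \<bar>f x\<bar> powr q)"
  using assms by (intro continuous_on_powr' continuous_intros) auto

text \<open>This makes every zero of the integral of \<open>signed_power q (f - a)\<close> in \<open>a\<close> a minimiser, and it
  replaces the differentiation under the integral in the envelope theorem.\<close>

lemma abs_powr_subgradient:
  assumes "q \<ge> 1"
  shows "\<bar>y\<bar> powr q + q * (signed_power q y * (z - y)) \<le> \<bar>z\<bar> powr q"
proof (cases "q = 1")
  case True
  then show ?thesis by (auto simp: signed_power_def sgn_if abs_if)
next
  case False
  then have q: "q > 1" using assms by simp
  let ?p = "q / (q - 1)"
  have p: "?p > 1" "1 / q + 1 / ?p = 1" using q by (auto simp: field_simps)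
  \<comment> \<open>Convexity in dual form: Young's inequality for \<open>z\<close> and the slope at
    \<open>y\<close>, whose conjugate power is again \<open>\<bar>y\<bar> powr q\<close>.\<close>
  have "\<bar>z\<bar> * \<bar>signed_power q y\<bar> \<le> \<bar>z\<bar> powr q / q + \<bar>signed_power q y\<bar> powr ?p / ?p"
    using q p by (intro Youngs_inequality) auto
  also have "\<dots> = \<bar>z\<bar> powr q / q + \<bar>y\<bar> powr q * (q - 1) / q"
    using q by (simp add: abs_signed_power_powr)
  finally have "q * (\<bar>z\<bar> * \<bar>signed_power q y\<bar>) \<le> \<bar>z\<bar> powr q + q * \<bar>y\<bar> powr q - \<bar>y\<bar> powr q"
    using q by (simp add: field_simps)
  moreover have "signed_power q y * z \<le> \<bar>z\<bar> * \<bar>signed_power q y\<bar>"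
    by (metis abs_ge_self abs_mult mult.commute)
  then have "q * (signed_power q y * z) \<le> q * (\<bar>z\<bar> * \<bar>signed_power q y\<bar>)"
    using q by (intro mult_left_mono) auto
  moreover have "q * (signed_power q y * (z - y)) = q * (signed_power q y * z) - q * \<bar>y\<bar> powr q"
    by (simp add: right_diff_distrib signed_power_mult_self)
  ultimately show ?thesis by linarith
qed

lemma Holder_inequality:
  fixes f g :: "'a \<Rightarrow> real"
  assumes pq: "p > 1" "q > 1" "1 / p + 1 / q = 1"
    and [measurable]: "f \<in> borel_measurable M" "g \<in> borel_measurable M"
    and f: "integrable M (\<lambda>x. \<bar>f x\<bar> powr p)" and g: "integrable M (\<lambda>x. \<bar>g x\<bar> powr q)"
  shows "integrable M (\<lambda>x. f x * g x)"
    and "(\<integral>x. \<bar>f x * g x\<bar> \<partial>M) \<le> (\<integral>x. \<bar>f x\<bar> powr p \<partial>M) powr (1 / p) * (\<integral>x. \<bar>g x\<bar> powr q \<partial>M) powr (1 / q)"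
proof -
  have Y: "\<bar>x * y\<bar> \<le> \<bar>x\<bar> powr p / p + \<bar>y\<bar> powr q / q" for x y :: real
    unfolding abs_mult using pq by (intro Youngs_inequality) auto
  show int: "integrable M (\<lambda>x. f x * g x)"
  proof (rule Bochner_Integration.integrable_bound)
    show "integrable M (\<lambda>x. \<bar>f x\<bar> powr p / p + \<bar>g x\<bar> powr q / q)" using f g by simp
    show "AE x in M. norm (f x * g x) \<le> norm (\<bar>f x\<bar> powr p / p + \<bar>g x\<bar> powr q / q)"
      unfolding real_norm_def by (intro AE_I2 order_trans[OF Y abs_ge_self])
  qed measurable
  define A where "A = (\<integral>x. \<bar>f x\<bar> powr p \<partial>M)"
  define B where "B = (\<integral>x. \<bar>g x\<bar> powr q \<partial>M)"
  have AB: "A \<ge> 0" "B \<ge> 0" unfolding A_def B_def by auto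
  show "(\<integral>x. \<bar>f x * g x\<bar> \<partial>M) \<le> A powr (1 / p) * B powr (1 / q)"
  proof (cases "A = 0 \<or> B = 0")
    case True
    then have "AE x in M. f x * g x = 0"
    proof
      assume "A = 0"
      then have "AE x in M. \<bar>f x\<bar> powr p = 0" unfolding A_def using f
        by (subst (asm) integral_nonneg_eq_0_iff_AE) auto
      then show ?thesis by eventually_elim auto
    next
      assume "B = 0"
      then have "AE x in M. \<bar>g x\<bar> powr q = 0" unfolding B_def using g
        by (subst (asm) integral_nonneg_eq_0_iff_AE) auto
      then show ?thesis by eventually_elim auto
    qed
    then have "(\<integral>x. \<bar>f x * g x\<bar> \<partial>M) = (\<integral>x. 0 \<partial>M)"
      by (intro integral_cong_AE) auto
    then show ?thesis by simp
  next
    case False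
    define a where "a = A powr (1 / p)"
    define b where "b = B powr (1 / q)"
    have ab: "a > 0" "b > 0" using False AB by (auto simp: a_def b_def)
    have apow: "a powr p = A" "b powr q = B"
      using False AB pq by (auto simp: a_def b_def powr_powr)
    have "(\<integral>x. \<bar>f x * g x\<bar> \<partial>M) \<le> (\<integral>x. a * b * (\<bar>f x\<bar> powr p / A / p + \<bar>g x\<bar> powr q / B / q) \<partial>M)"
    proof (rule integral_mono)
      show "integrable M (\<lambda>x. \<bar>f x * g x\<bar>)" using int by (rule integrable_abs)
      show "integrable M (\<lambda>x. a * b * (\<bar>f x\<bar> powr p / A / p + \<bar>g x\<bar> powr q / B / q))"
        using f g by auto
      fix x
      have "\<bar>f x * g x\<bar> = a * b * \<bar>(f x / a) * (g x / b)\<bar>" using ab by (simp add: abs_mult)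
      also have "\<dots> \<le> a * b * (\<bar>f x / a\<bar> powr p / p + \<bar>g x / b\<bar> powr q / q)"
        using ab by (intro mult_left_mono Y) auto
      also have "\<dots> = a * b * (\<bar>f x\<bar> powr p / A / p + \<bar>g x\<bar> powr q / B / q)"
        using ab apow by (simp add: powr_divide)
      finally show "\<bar>f x * g x\<bar> \<le> a * b * (\<bar>f x\<bar> powr p / A / p + \<bar>g x\<bar> powr q / B / q)" .
    qed
    also have "\<dots> = a * b * (A / A / p + B / B / q)"
      using f g by (simp add: A_def B_def)
    also have "\<dots> = a * b" using False pq by simp
    finally show ?thesis by (simp add: a_def b_def)
  qed
qed

section \<open>Integrals of continuous functions against a probability on the compact
  interval\<close>

locale interval_prob = prob_space M for M :: "real measure" +
  assumes sets_interval: "sets M = sets (restrict_space borel {-1..1})"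
begin

lemma space_interval [simp]: "space M = {-1..1}"
  using sets_eq_imp_space_eq[OF sets_interval] by (simp add: space_restrict_space)

lemma prob_interval [simp]: "prob {-1..1} = 1"
  using prob_space by simp

lemma continuous_bounded:
  fixes h :: "real \<Rightarrow> real"
  assumes "continuous_on {-1..1} h"
  obtains B where "\<And>t. t \<in> {-1..1} \<Longrightarrow> \<bar>h t\<bar> \<le> B"
proof -
  have "bounded (h ` {-1..1})"
    using assms by (intro compact_imp_bounded compact_continuous_image) auto
  then obtain B where "\<forall>x\<in>h ` {-1..1}. norm x \<le> B" unfolding bounded_iff by blast
  then show thesis by (intro that[of B]) auto
qed

lemma measurable_continuous:
  fixes h :: "real \<Rightarrow> real"
  assumes "continuous_on {-1..1} h" shows "h \<in> borel_measurable M"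
  using borel_measurable_continuous_on_restrict[OF assms]
  by (simp add: measurable_cong_sets[OF sets_interval refl])

lemma integrable_continuous:
  fixes h :: "real \<Rightarrow> real"
  assumes "continuous_on {-1..1} h" shows "integrable M h"
proof -
  obtain B where "\<And>t. t \<in> {-1..1} \<Longrightarrow> \<bar>h t\<bar> \<le> B" using continuous_bounded[OF assms] by blast
  then show ?thesis
    using measurable_continuous[OF assms] by (intro integrable_const_bound[of _ B] AE_I2) auto
qed

lemma integral_dist_le:
  fixes g h :: "real \<Rightarrow> real"
  assumes "continuous_on {-1..1} g" "continuous_on {-1..1} h"
    and "\<And>t. t \<in> {-1..1} \<Longrightarrow> \<bar>g t - h t\<bar> \<le> e"
  shows "\<bar>(\<integral>t. g t \<partial>M) - (\<integral>t. h t \<partial>M)\<bar> \<le> e"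
proof -
  have "(\<integral>t. g t \<partial>M) - (\<integral>t. h t \<partial>M) = (\<integral>t. g t - h t \<partial>M)"
    using assms by (simp add: integrable_continuous)
  moreover have "\<bar>\<integral>t. g t - h t \<partial>M\<bar> \<le> (\<integral>t. \<bar>g t - h t\<bar> \<partial>M)"
    by (rule integral_abs_bound)
  moreover have "(\<integral>t. \<bar>g t - h t\<bar> \<partial>M) \<le> (\<integral>t. e \<partial>M)"
    using assms by (intro integral_mono integrable_continuous continuous_intros) auto
  then have "(\<integral>t. \<bar>g t - h t\<bar> \<partial>M) \<le> e" by simp
  ultimately show ?thesis by linarith
qed

lemma continuous_on_integral:
  fixes h :: "'a::metric_space \<Rightarrow> real \<Rightarrow> real"
  assumes h: "continuous_on (U \<times> {-1..1}) (\<lambda>(r, t). h r t)"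
  shows "continuous_on U (\<lambda>r. \<integral>t. h r t \<partial>M)"
  unfolding continuous_on_iff
proof safe
  fix r e assume r: "r \<in> U" and e: "(0::real) < e"
  have c: "continuous_on {-1..1} (h r')" if "r' \<in> U" for r'
    using that by (auto intro!: continuous_on_compose2[OF h, where f = "\<lambda>t. (r', t)", simplified] continuous_intros)
  obtain X where X: "r \<in> X" "open X" "\<forall>r'\<in>X \<inter> U. \<forall>t\<in>{-1..1}. dist (h r' t) (h r t) \<le> e / 2"
    using continuous_on_prod_compactE[OF h compact_Icc r, of "e / 2"] e by auto
  obtain d where d: "d > 0" "ball r d \<subseteq> X" using X by (auto simp: open_contains_ball)
  show "\<exists>d>0. \<forall>r'\<in>U. dist r' r < d \<longrightarrow> dist (\<integral>t. h r' t \<partial>M) (\<integral>t. h r t \<partial>M) < e"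
  proof (intro exI[of _ d] conjI ballI impI d)
    fix r' assume r': "r' \<in> U" "dist r' r < d"
    then have "r' \<in> X" using d by (auto simp: dist_commute)
    then have "\<bar>(\<integral>t. h r' t \<partial>M) - (\<integral>t. h r t \<partial>M)\<bar> \<le> e / 2"
      using r r' X(3) by (intro integral_dist_le c) (auto simp: dist_real_def)
    then show "dist (\<integral>t. h r' t \<partial>M) (\<integral>t. h r t \<partial>M) < e" using e by (simp add: dist_real_def)
  qed
qed

lemma integral_pos_of_continuous:
  fixes h :: "real \<Rightarrow> real"
  assumes h: "continuous_on {-1..1} h" "\<And>t. t \<in> {-1..1} \<Longrightarrow> 0 < h t"
  shows "0 < (\<integral>t. h t \<partial>M)"
proof -
  have "{-1..1::real} \<noteq> {}" by simp
  then obtain t0 where t0: "t0 \<in> {-1..1}" "\<And>t. t \<in> {-1..1} \<Longrightarrow> h t0 \<le> h t"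
    using continuous_attains_inf[OF compact_Icc _ h(1)] by blast
  have "(\<integral>t. h t0 \<partial>M) \<le> (\<integral>t. h t \<partial>M)"
    using t0 by (intro integral_mono integrable_continuous h) auto
  then show ?thesis using h(2)[OF t0(1)] by simp
qed

lemma signed_power_integral_strict_antimono:
  assumes q: "q > 1" and g: "continuous_on {-1..1} g" and ab: "a < b"
  shows "(\<integral>t. signed_power q (g t - b) \<partial>M) < (\<integral>t. signed_power q (g t - a) \<partial>M)"
proof -
  have c: "continuous_on {-1..1} (\<lambda>t. signed_power q (g t - a))" for a
    using q g by (intro continuous_intros)
  have "0 < (\<integral>t. signed_power q (g t - a) - signed_power q (g t - b) \<partial>M)"
    using ab by (intro integral_pos_of_continuous continuous_on_diff c)
      (auto intro!: signed_power_strict_mono q)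
  then show ?thesis by (simp add: integrable_continuous c)
qed

text \<open>Intermediate value theorem between the minimum and the maximum of \<open>g\<close>. The
  second conclusion is kept because it later makes the optimal constant for the positive kernel
  nonnegative.\<close>

lemma ex_center:
  assumes q: "q > 1" and g: "continuous_on {-1..1} g"
  obtains c where "(\<integral>t. signed_power q (g t - c) \<partial>M) = 0"
    "\<exists>t\<in>{-1..1}. g t \<le> c"
proof -
  have ne: "{-1..1::real} \<noteq> {}" by simp
  obtain t0 where t0: "t0 \<in> {-1..1}" "\<And>t. t \<in> {-1..1} \<Longrightarrow> g t0 \<le> g t"
    using continuous_attains_inf[OF compact_Icc ne g] by blast
  obtain t1 where t1: "t1 \<in> {-1..1}" "\<And>t. t \<in> {-1..1} \<Longrightarrow> g t \<le> g t1"
    using continuous_attains_sup[OF compact_Icc ne g] by blast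
  let ?F = "\<lambda>c. \<integral>t. signed_power q (g t - c) \<partial>M"
  have F: "continuous_on UNIV ?F"
  proof (rule continuous_on_integral)
    have "continuous_on (UNIV \<times> {-1..1}) (\<lambda>p. g (snd p))"
      by (rule continuous_on_compose2[OF g]) (auto intro: continuous_intros)
    then show "continuous_on (UNIV \<times> {-1..1}) (\<lambda>(c, t). signed_power q (g t - c))"
      unfolding split_beta' using q by (intro continuous_intros)
  qed
  have mono: "signed_power q x \<le> signed_power q y" if "x \<le> y" for x y
    using signed_power_strict_mono[OF q, of x y] that by (cases "x = y") auto
  have c: "continuous_on {-1..1} (\<lambda>t. signed_power q (g t - a))" for a
    using q g by (intro continuous_intros)
  have "?F (g t1) \<le> (\<integral>t. 0 \<partial>M)"
  proof (rule integral_mono)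
    fix t assume "t \<in> space M"
    then show "signed_power q (g t - g t1) \<le> 0" using mono[of "g t - g t1" 0] t1 by simp
  qed (auto intro: integrable_continuous c)
  moreover have "(\<integral>t. 0 \<partial>M) \<le> ?F (g t0)"
  proof (rule integral_mono)
    fix t assume "t \<in> space M"
    then show "0 \<le> signed_power q (g t - g t0)" using mono[of 0 "g t - g t0"] t0 by simp
  qed (auto intro: integrable_continuous c)
  ultimately obtain c where "g t0 \<le> c" "c \<le> g t1" "?F c = 0"
    using IVT2'[of ?F "g t1" 0 "g t0"] continuous_on_subset[OF F] t0(2)[OF t1(1)] by auto
  then show thesis using t0 t1 by (intro that[of c]) auto
qed

text \<open>Integrating the subgradient inequality at \<open>g t - a\<close> leaves no linear term,
  because \<open>a - b\<close> does not depend on \<open>t\<close>. Measurability is assumed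
  separately: for \<open>q = 1\<close> the integrand is a discontinuous sign.\<close>

lemma center_minimal:
  assumes q: "q \<ge> 1" and g: "continuous_on {-1..1} g"
    and meas: "(\<lambda>t. signed_power q (g t - a)) \<in> borel_measurable M"
    and zero: "(\<integral>t. signed_power q (g t - a) \<partial>M) = 0"
  shows "(\<integral>t. \<bar>g t - a\<bar> powr q \<partial>M) \<le> (\<integral>t. \<bar>g t - b\<bar> powr q \<partial>M)"
proof -
  have int: "integrable M (\<lambda>t. \<bar>g t - a\<bar> powr q)" for a
    using q g by (intro integrable_continuous continuous_intros) auto
  have "continuous_on {-1..1} (\<lambda>t. g t - a)" using g by (intro continuous_intros)
  then obtain B where B: "\<And>t. t \<in> {-1..1} \<Longrightarrow> \<bar>g t - a\<bar> \<le> B" using continuous_bounded by blast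
  have ints: "integrable M (\<lambda>t. signed_power q (g t - a))"
    using meas B q by (intro integrable_const_bound[of _ "B powr (q - 1)"] AE_I2)
      (auto simp: abs_signed_power intro!: powr_mono2)
  have "(\<integral>t. \<bar>g t - a\<bar> powr q + q * (signed_power q (g t - a) * (a - b)) \<partial>M) \<le> (\<integral>t. \<bar>g t - b\<bar> powr q \<partial>M)"
  proof (rule integral_mono)
    show "integrable M (\<lambda>t. \<bar>g t - a\<bar> powr q + q * (signed_power q (g t - a) * (a - b)))"
      using int ints by auto
    show "\<bar>g t - a\<bar> powr q + q * (signed_power q (g t - a) * (a - b)) \<le> \<bar>g t - b\<bar> powr q" for t
      using abs_powr_subgradient[OF q, of "g t - a" "g t - b"] by simp
  qed (rule int)
  then show ?thesis using int ints zero by simp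
qed

end

section \<open>Uniform limits in a parameter\<close>

lemma uniform_limit_of_continuous_on_prod:
  fixes f :: "'a::topological_space \<Rightarrow> 'b::topological_space \<Rightarrow> 'c::metric_space"
  assumes f: "continuous_on (U \<times> K) (\<lambda>(r, t). f r t)" and U: "open U" "r \<in> U" and K: "compact K"
  shows "uniform_limit K f (f r) (at r)"
proof (rule uniform_limitI)
  fix e :: real assume e: "e > 0"
  obtain X where X: "r \<in> X" "open X" "\<forall>r'\<in>X \<inter> U. \<forall>t\<in>K. dist (f r' t) (f r t) \<le> e / 2"
    using continuous_on_prod_compactE[OF f K U(2), of "e / 2"] e by auto
  have "\<forall>\<^sub>F r' in at r. r' \<in> X \<inter> U"
    using X U by (intro eventually_at_in_open') auto
  then show "\<forall>\<^sub>F r' in at r. \<forall>t\<in>K. dist (f r' t) (f r t) < e"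
  proof eventually_elim
    case (elim r')
    show ?case
    proof
      fix t assume "t \<in> K"
      then have "dist (f r' t) (f r t) \<le> e / 2" using X(3) elim by blast
      then show "dist (f r' t) (f r t) < e" using e by linarith
    qed
  qed
qed

text \<open>By the mean value theorem each quotient is a value of \<open>f'\<close> at an
  intermediate radius. That radius depends on \<open>t\<close>, but \<open>f'\<close> is close to
  \<open>f' r\<close> uniformly in \<open>t\<close> near \<open>r\<close>.\<close>

lemma uniform_limit_difference_quotient:
  fixes f f' :: "real \<Rightarrow> 'b::topological_space \<Rightarrow> real"
  assumes f': "continuous_on (U \<times> K) (\<lambda>(r, t). f' r t)" and U: "open U" "r \<in> U" and K: "compact K"
    and deriv: "\<And>r t. r \<in> U \<Longrightarrow> t \<in> K \<Longrightarrow> ((\<lambda>r. f r t) has_real_derivative f' r t) (at r)"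
  shows "uniform_limit K (\<lambda>r' t. (f r' t - f r t) / (r' - r)) (f' r) (at r)"
proof (rule uniform_limitI)
  fix e :: real assume e: "e > 0"
  have "\<forall>\<^sub>F r' in at r. \<forall>t\<in>K. dist (f' r' t) (f' r t) < e"
    using uniform_limit_of_continuous_on_prod[OF f' U K] e by (auto simp: uniform_limit_iff)
  moreover have "\<forall>\<^sub>F r' in at r. r' \<in> U" using U by (intro eventually_at_in_open')
  ultimately have "\<forall>\<^sub>F r' in at r. r' \<in> U \<and> (\<forall>t\<in>K. dist (f' r' t) (f' r t) < e)"
    by eventually_elim auto
  then obtain d where d: "d > 0"
    "\<And>r'. r' \<noteq> r \<Longrightarrow> dist r' r < d \<Longrightarrow> r' \<in> U \<and> (\<forall>t\<in>K. dist (f' r' t) (f' r t) < e)"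
    unfolding eventually_at by auto
  have ex: "\<exists>\<xi>. \<xi> \<noteq> r \<and> dist \<xi> r < d \<and> (f r' t - f r t) / (r' - r) = f' \<xi> t"
    if r': "r' \<noteq> r" "dist r' r < d" and t: "t \<in> K" for r' t
  proof -
    have D: "((\<lambda>r. f r t) has_real_derivative f' x t) (at x)" if "dist x r < d" for x
      using deriv[OF _ t, of x] d(2)[of x] that U by (cases "x = r") auto
    consider "r' < r" | "r < r'" using r' by linarith
    then show ?thesis
    proof cases
      case 1
      obtain \<xi> where "r' < \<xi>" "\<xi> < r" "f r t - f r' t = (r - r') * f' \<xi> t"
        using MVT2[OF 1, of "\<lambda>r. f r t" "\<lambda>x. f' x t"] D r' by (auto simp: dist_real_def)
      then show ?thesis using 1 r' by (intro exI[of _ \<xi>]) (auto simp: dist_real_def field_simps)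
    next
      case 2
      obtain \<xi> where "r < \<xi>" "\<xi> < r'" "f r' t - f r t = (r' - r) * f' \<xi> t"
        using MVT2[OF 2, of "\<lambda>r. f r t" "\<lambda>x. f' x t"] D r' by (auto simp: dist_real_def)
      then show ?thesis using 2 r' by (intro exI[of _ \<xi>]) (auto simp: dist_real_def field_simps)
    qed
  qed
  show "\<forall>\<^sub>F r' in at r. \<forall>t\<in>K. dist ((f r' t - f r t) / (r' - r)) (f' r t) < e"
    unfolding eventually_at using d ex by metis
qed

context interval_prob
begin

lemma tendsto_integral_uniform_limit:
  fixes h :: "'a \<Rightarrow> real \<Rightarrow> real"
  assumes lim: "uniform_limit {-1..1} h l F"
    and h: "\<forall>\<^sub>F x in F. continuous_on {-1..1} (h x)" and l: "continuous_on {-1..1} l"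
  shows "((\<lambda>x. \<integral>t. h x t \<partial>M) \<longlongrightarrow> (\<integral>t. l t \<partial>M)) F"
proof (rule tendstoI)
  fix e :: real assume e: "e > 0"
  have "\<forall>\<^sub>F x in F. \<forall>t\<in>{-1..1}. dist (h x t) (l t) < e / 2"
    using lim e unfolding uniform_limit_iff by (meson half_gt_zero)
  then show "\<forall>\<^sub>F x in F. dist (\<integral>t. h x t \<partial>M) (\<integral>t. l t \<partial>M) < e"
    using h
  proof eventually_elim
    case (elim x)
    then have "\<bar>(\<integral>t. h x t \<partial>M) - (\<integral>t. l t \<partial>M)\<bar> \<le> e / 2"
      using l by (intro integral_dist_le) (auto simp: dist_real_def intro: less_imp_le)
    then show ?case using e by (simp add: dist_real_def)
  qed
qed

section \<open>The envelope theorem for the distance to the constants\<close>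

context
  fixes q :: real and U :: "real set" and f f' :: "real \<Rightarrow> real \<Rightarrow> real" and c :: "real \<Rightarrow> real"
  assumes q: "q > 1" and U: "open U"
    and f: "continuous_on (U \<times> {-1..1}) (\<lambda>(r, t). f r t)"
    and f': "continuous_on (U \<times> {-1..1}) (\<lambda>(r, t). f' r t)"
    and deriv: "\<And>r t. r \<in> U \<Longrightarrow> t \<in> {-1..1} \<Longrightarrow> ((\<lambda>r. f r t) has_real_derivative f' r t) (at r)"
    and c: "\<And>r. r \<in> U \<Longrightarrow> (\<integral>t. signed_power q (f r t - c r) \<partial>M) = 0"
begin

lemma continuous_slice: "r \<in> U \<Longrightarrow> continuous_on {-1..1} (f r)" "r \<in> U \<Longrightarrow> continuous_on {-1..1} (f' r)"
  by (auto intro!: continuous_on_compose2[OF f, where f = "\<lambda>t. (r, t)", simplified]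
    continuous_on_compose2[OF f', where f = "\<lambda>t. (r, t)", simplified] continuous_intros)

text \<open>Nothing but its defining equation is known about \<open>c\<close>. For fixed
  \<open>a\<close> the sign of the integral tells on which side of \<open>a\<close> the value
  \<open>c r\<close> lies, by strict monotonicity in \<open>a\<close>; a strict sign at
  \<open>r\<close> persists nearby.\<close>

lemma continuous_on_center: "continuous_on U c"
proof (rule continuous_at_imp_continuous_on, safe)
  fix r assume r: "r \<in> U"
  have F: "isCont (\<lambda>r. \<integral>t. signed_power q (f r t - a) \<partial>M) r" for a
  proof -
    have "continuous_on U (\<lambda>r. \<integral>t. signed_power q (f r t - a) \<partial>M)"
      using q f unfolding split_beta'
      by (intro continuous_on_integral) (auto simp: split_beta' intro!: continuous_intros)
    then show ?thesis using U r by (simp add: continuous_on_eq_continuous_at)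
  qed
  have le: "(\<integral>t. signed_power q (f r t - b) \<partial>M) \<le> (\<integral>t. signed_power q (f r t - a) \<partial>M)"
    if "r \<in> U" "a \<le> b" for r a b
    using signed_power_integral_strict_antimono[OF q continuous_slice(1)[OF that(1)], of a b] that
    by (cases "a = b") auto
  have evU: "\<forall>\<^sub>F r' in at r. r' \<in> U" using U r by (intro eventually_at_in_open')
  show "isCont c r" unfolding isCont_def
  proof (rule order_tendstoI)
    fix a assume "a < c r"
    then have "0 < (\<integral>t. signed_power q (f r t - a) \<partial>M)"
      using signed_power_integral_strict_antimono[OF q continuous_slice(1)[OF r], of a "c r"] c[OF r] by simp
    then have "\<forall>\<^sub>F r' in at r. 0 < (\<integral>t. signed_power q (f r' t - a) \<partial>M)"
      using F[of a] unfolding isCont_def by (rule order_tendstoD(1)[rotated])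
    then show "\<forall>\<^sub>F r' in at r. a < c r'" using evU
      by eventually_elim (use le c in \<open>metis not_less\<close>)
  next
    fix a assume "c r < a"
    then have "(\<integral>t. signed_power q (f r t - a) \<partial>M) < 0"
      using signed_power_integral_strict_antimono[OF q continuous_slice(1)[OF r], of "c r" a] c[OF r] by simp
    then have "\<forall>\<^sub>F r' in at r. (\<integral>t. signed_power q (f r' t - a) \<partial>M) < 0"
      using F[of a] unfolding isCont_def by (rule order_tendstoD(2)[rotated])
    then show "\<forall>\<^sub>F r' in at r. c r' < a" using evU
      by eventually_elim (use le c in \<open>metis not_less\<close>)
  qed
qed

lemma continuous_on_centered: "continuous_on (U \<times> {-1..1}) (\<lambda>(r, t). f r t - c r)"
proof -
  have "continuous_on (U \<times> {-1..1}) (\<lambda>p. c (fst p))"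
    by (rule continuous_on_compose2[OF continuous_on_center]) (auto intro: continuous_intros)
  then show ?thesis using f unfolding split_beta' by (intro continuous_intros)
qed

lemma continuous_on_envelope: "continuous_on U (\<lambda>r. \<integral>t. \<bar>f r t - c r\<bar> powr q \<partial>M)"
  using q continuous_on_centered unfolding split_beta'
  by (intro continuous_on_integral) (auto simp: split_beta' intro!: continuous_intros)

lemma continuous_on_signed_centered:
  "continuous_on (U \<times> {-1..1}) (\<lambda>(r, t). signed_power q (f r t - c r))"
  using q continuous_on_centered unfolding split_beta' by (intro continuous_on_signed_power)

lemma continuous_on_envelope_derivative:
  "continuous_on U (\<lambda>r. \<integral>t. signed_power q (f r t - c r) * f' r t \<partial>M)"
  using continuous_on_signed_centered f' 
  by (intro continuous_on_integral) (auto simp: split_beta' intro!: continuous_intros)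

text \<open>The subgradient inequality also produces the increment \<open>c r - c r'\<close>, but it
  multiplies an integral that vanishes by the choice of \<open>c r\<close>. This is how
  differentiability of \<open>c\<close> is avoided.\<close>

lemma envelope_diff_ge:
  assumes r: "r \<in> U" "r' \<in> U"
  shows "(\<integral>t. \<bar>f r t - c r\<bar> powr q \<partial>M) + q * (\<integral>t. signed_power q (f r t - c r) * (f r' t - f r t) \<partial>M)
    \<le> (\<integral>t. \<bar>f r' t - c r'\<bar> powr q \<partial>M)"
proof -
  have ints: "integrable M (\<lambda>t. signed_power q (f r t - c r) * (f r' t - f r t))"
    "integrable M (\<lambda>t. signed_power q (f r t - c r))"
    "integrable M (\<lambda>t. \<bar>f r t - c r\<bar> powr q)" "integrable M (\<lambda>t. \<bar>f r' t - c r'\<bar> powr q)"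
    using q r by (auto intro!: integrable_continuous continuous_intros continuous_slice)
  have "(\<integral>t. \<bar>f r t - c r\<bar> powr q + q * (signed_power q (f r t - c r) * (f r' t - f r t)
      + signed_power q (f r t - c r) * (c r - c r')) \<partial>M) \<le> (\<integral>t. \<bar>f r' t - c r'\<bar> powr q \<partial>M)"
  proof (rule integral_mono)
    show "integrable M (\<lambda>t. \<bar>f r t - c r\<bar> powr q + q * (signed_power q (f r t - c r) * (f r' t - f r t)
      + signed_power q (f r t - c r) * (c r - c r')))"
      using ints by (intro Bochner_Integration.integrable_add integrable_mult_right integrable_mult_left)
    fix t
    have "signed_power q (f r t - c r) * (f r' t - f r t) + signed_power q (f r t - c r) * (c r - c r') =
      signed_power q (f r t - c r) * ((f r' t - c r') - (f r t - c r))" by (simp add: algebra_simps)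
    then show "\<bar>f r t - c r\<bar> powr q + q * (signed_power q (f r t - c r) * (f r' t - f r t)
      + signed_power q (f r t - c r) * (c r - c r')) \<le> \<bar>f r' t - c r'\<bar> powr q"
      using abs_powr_subgradient[of q "f r t - c r" "f r' t - c r'"] q by simp
  qed (rule ints)
  then show ?thesis using ints c[OF r(1)] by simp
qed

text \<open>\<open>envelope_diff_ge\<close>, used once from \<open>r\<close> and once from
  \<open>r'\<close>, traps the difference quotient between \<open>?L\<close> and \<open>?R\<close>,
  which share the limit \<open>?D\<close>. Dividing by \<open>r' - r\<close> swaps the two bounds to
  the left of \<open>r\<close>, hence the \<open>min\<close> and \<open>max\<close>.\<close>

lemma has_real_derivative_envelope:
  assumes r: "r \<in> U"
  shows "((\<lambda>r. \<integral>t. \<bar>f r t - c r\<bar> powr q \<partial>M) has_real_derivative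
    q * (\<integral>t. signed_power q (f r t - c r) * f' r t \<partial>M)) (at r)"
proof -
  let ?E = "\<lambda>r. \<integral>t. \<bar>f r t - c r\<bar> powr q \<partial>M"
  let ?S = "\<lambda>r' t. (f r' t - f r t) / (r' - r)"
  let ?L = "\<lambda>r'. q * (\<integral>t. signed_power q (f r t - c r) * ?S r' t \<partial>M)"
  let ?R = "\<lambda>r'. q * (\<integral>t. signed_power q (f r' t - c r') * ?S r' t \<partial>M)"
  let ?D = "q * (\<integral>t. signed_power q (f r t - c r) * f' r t \<partial>M)"
  have evU: "\<forall>\<^sub>F r' in at r. r' \<in> U" using U r by (intro eventually_at_in_open')
  have S: "uniform_limit {-1..1} ?S (f' r) (at r)"
    by (rule uniform_limit_difference_quotient[OF f' U r _ deriv]) auto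
  have P: "uniform_limit {-1..1} (\<lambda>r' t. signed_power q (f r' t - c r')) (\<lambda>t. signed_power q (f r t - c r)) (at r)"
    using uniform_limit_of_continuous_on_prod[OF continuous_on_signed_centered U r] by simp
  have cP: "continuous_on {-1..1} (\<lambda>t. signed_power q (f r t - c r))" if "r \<in> U" for r
    using q that by (intro continuous_intros continuous_slice)
  have bP: "bounded ((\<lambda>t. signed_power q (f r t - c r)) ` {-1..1})" "bounded (f' r ` {-1..1})"
    using r cP continuous_slice by (auto intro!: compact_imp_bounded compact_continuous_image)
  have cS: "continuous_on {-1..1} (?S r')" if "r' \<in> U" for r'
    unfolding divide_inverse using r that by (intro continuous_intros continuous_slice)
  have L: "(?L \<longlongrightarrow> ?D) (at r)"
    by (intro tendsto_mult_left tendsto_integral_uniform_limit uniform_lim_mult[OF uniform_limit_const S] bP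
        eventually_mono[OF evU] continuous_on_mult cP cS continuous_slice r)
  have R: "(?R \<longlongrightarrow> ?D) (at r)"
    by (intro tendsto_mult_left tendsto_integral_uniform_limit uniform_lim_mult[OF P S] bP
        eventually_mono[OF evU] continuous_on_mult cP cS continuous_slice r)
  have sandwich: "min (?L r') (?R r') \<le> (?E r' - ?E r) / (r' - r) \<and>
      (?E r' - ?E r) / (r' - r) \<le> max (?L r') (?R r')" if r': "r' \<in> U" "r' \<noteq> r" for r'
  proof -
    have Leq: "?L r' * (r' - r) = q * (\<integral>t. signed_power q (f r t - c r) * (f r' t - f r t) \<partial>M)"
      using r' by simp
    have Req: "?R r' * (r' - r) = - (q * (\<integral>t. signed_power q (f r' t - c r') * (f r t - f r' t) \<partial>M))"
    proof -
      have "(\<lambda>t. signed_power q (f r' t - c r') * (f r t - f r' t)) =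
          (\<lambda>t. - (signed_power q (f r' t - c r') * (f r' t - f r t)))"
        by (auto simp: algebra_simps)
      then show ?thesis using r' by simp
    qed
    have l: "?L r' * (r' - r) \<le> ?E r' - ?E r"
      using envelope_diff_ge[OF r r'(1)] unfolding Leq by simp
    have u: "?E r' - ?E r \<le> ?R r' * (r' - r)"
      using envelope_diff_ge[OF r'(1) r] unfolding Req by simp
    show ?thesis
    proof (cases "r' > r")
      case True
      then have "?L r' \<le> (?E r' - ?E r) / (r' - r)" "(?E r' - ?E r) / (r' - r) \<le> ?R r'"
        using l u by (simp_all only: pos_le_divide_eq pos_divide_le_eq diff_gt_0_iff_gt)
      then show ?thesis by linarith
    next
      case False
      then have "r' - r < 0" using r' by simp
      then have "?R r' \<le> (?E r' - ?E r) / (r' - r)" "(?E r' - ?E r) / (r' - r) \<le> ?L r'"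
        using l u by (simp_all only: neg_le_divide_eq neg_divide_le_eq)
      then show ?thesis by linarith
    qed
  qed
  have "((\<lambda>r'. (?E r' - ?E r) / (r' - r)) \<longlongrightarrow> ?D) (at r)"
  proof (rule tendsto_sandwich)
    have ne: "\<forall>\<^sub>F r' in at r. r' \<in> U \<and> r' \<noteq> r"
      using evU eventually_neq_at_within[of r r] by eventually_elim auto
    show "\<forall>\<^sub>F r' in at r. min (?L r') (?R r') \<le> (?E r' - ?E r) / (r' - r)"
      using ne by eventually_elim (use sandwich in blast)
    show "\<forall>\<^sub>F r' in at r. (?E r' - ?E r) / (r' - r) \<le> max (?L r') (?R r')"
      using ne by eventually_elim (use sandwich in blast)
    show "((\<lambda>r'. min (?L r') (?R r')) \<longlongrightarrow> ?D) (at r)" using tendsto_min[OF L R] by simp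
    show "((\<lambda>r'. max (?L r') (?R r')) \<longlongrightarrow> ?D) (at r)" using tendsto_max[OF L R] by simp
  qed
  then show ?thesis by (simp add: has_field_derivative_iff)
qed

end

end

section \<open>The kernel as a function of the radius and one coordinate\<close>

definition ball_ratio :: "real \<Rightarrow> real \<Rightarrow> real" where
  "ball_ratio r t = (1 - r\<^sup>2) / (1 + r\<^sup>2 - 2 * r * t)"

definition axial_kernel :: "nat \<Rightarrow> real \<Rightarrow> real \<Rightarrow> real" where
  "axial_kernel k r t = ball_ratio r t ^ k"

text \<open>The axial coordinate of the image of a boundary point under the conformal automorphism
  of the ball that translates the centre by \<open>r\<close> along the axis; on the circle this is
  the real part of (z + r) / (1 + r z).\<close>

definition mobius :: "real \<Rightarrow> real \<Rightarrow> real" where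
  "mobius r s = ((1 + r\<^sup>2) * s + 2 * r) / (1 + r\<^sup>2 + 2 * r * s)"

text \<open>The quotient of the kernel minus 1 by \<open>r\<close>. Factoring it through the
  geometric sum leaves no division by \<open>r\<close>, so the formula remains valid and smooth at
  \<open>r = 0\<close>.\<close>

definition kernel_slope :: "nat \<Rightarrow> real \<Rightarrow> real \<Rightarrow> real" where
  "kernel_slope k r t = 2 * (t - r) / (1 + r\<^sup>2 - 2 * r * t) * (\<Sum>j<k. ball_ratio r t ^ j)"

lemma ball_denominator_pos:
  fixes r t :: real
  assumes "\<bar>r\<bar> < 1" "\<bar>t\<bar> \<le> 1"
  shows "0 < 1 + r\<^sup>2 - 2 * r * t"
proof -
  have "r * t \<le> \<bar>r * t\<bar>" by (rule abs_ge_self)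
  also have "\<dots> \<le> \<bar>r\<bar> * 1" using assms unfolding abs_mult by (intro mult_left_mono) auto
  finally have "r * t \<le> \<bar>r\<bar>" by simp
  moreover have "0 < (1 - \<bar>r\<bar>)\<^sup>2" using assms by simp
  ultimately show ?thesis by (simp add: power2_diff)
qed

lemma ball_denominator_pos': "\<bar>r\<bar> < 1 \<Longrightarrow> \<bar>t\<bar> \<le> 1 \<Longrightarrow> 0 < 1 + r\<^sup>2 + 2 * r * (t::real)"
  using ball_denominator_pos[of "- r" t] by simp

lemma ball_denominator_neq:
  fixes r t :: real
  assumes "\<bar>r\<bar> < 1" "\<bar>t\<bar> \<le> 1"
  shows "1 + r\<^sup>2 \<noteq> 2 * r * t" "1 + r\<^sup>2 + 2 * r * t \<noteq> 0"
  using ball_denominator_pos[OF assms] ball_denominator_pos'[OF assms] by auto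

lemma ball_ratio_pos: "\<bar>r\<bar> < 1 \<Longrightarrow> \<bar>t\<bar> \<le> 1 \<Longrightarrow> 0 < ball_ratio r t"
  using ball_denominator_pos[of r t] by (auto simp: ball_ratio_def abs_square_less_1)

lemma axial_kernel_pos: "\<bar>r\<bar> < 1 \<Longrightarrow> \<bar>t\<bar> \<le> 1 \<Longrightarrow> 0 < axial_kernel k r t"
  using ball_ratio_pos[of r t] by (simp add: axial_kernel_def)

lemma axial_kernel_eq:
  assumes "\<bar>r\<bar> < 1" "\<bar>t\<bar> \<le> 1"
  shows "axial_kernel k r t = 1 + r * kernel_slope k r t"
proof -
  have "ball_ratio r t - 1 = r * (2 * (t - r) / (1 + r\<^sup>2 - 2 * r * t))"
    using ball_denominator_pos[OF assms] by (simp add: ball_ratio_def field_simps power2_eq_square)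
  then show ?thesis
    using power_diff_1_eq[of "ball_ratio r t" k] by (simp add: axial_kernel_def kernel_slope_def)
qed

lemma kernel_slope_0 [simp]: "kernel_slope k 0 t = 2 * real k * t"
  by (simp add: kernel_slope_def ball_ratio_def)

lemma ball_ratio_strict_mono:
  assumes "0 < r" "r < 1" "\<bar>s\<bar> \<le> 1" "\<bar>t\<bar> \<le> 1" "s < t"
  shows "ball_ratio r s < ball_ratio r t"
  unfolding ball_ratio_def using assms ball_denominator_pos[of r t]
  by (intro divide_strict_left_mono mult_pos_pos ball_denominator_pos) (auto simp: abs_square_less_1)

lemma axial_kernel_strict_mono:
  assumes "0 < r" "r < 1" "\<bar>s\<bar> \<le> 1" "\<bar>t\<bar> \<le> 1" "s < t" "k > 0"
  shows "axial_kernel k r s < axial_kernel k r t"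
  unfolding axial_kernel_def using assms
  by (intro power_strict_mono ball_ratio_strict_mono less_imp_le[OF ball_ratio_pos]) auto

lemma kernel_slope_strict_mono:
  assumes "0 \<le> r" "r < 1" "\<bar>s\<bar> \<le> 1" "\<bar>t\<bar> \<le> 1" "s < t" "k > 0"
  shows "kernel_slope k r s < kernel_slope k r t"
proof (cases "r = 0")
  case False
  have "r * kernel_slope k r s < r * kernel_slope k r t"
    using axial_kernel_strict_mono[of r s t k] assms False by (simp add: axial_kernel_eq)
  then show ?thesis using False assms by simp
qed (use assms in simp)

lemma mobius_props:
  assumes "\<bar>r\<bar> < 1" "\<bar>s\<bar> \<le> 1"
  shows "1 - mobius r s = (1 - r)\<^sup>2 * (1 - s) / (1 + r\<^sup>2 + 2 * r * s)"
    and "1 + mobius r s = (1 + r)\<^sup>2 * (1 + s) / (1 + r\<^sup>2 + 2 * r * s)"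
    and "\<bar>mobius r s\<bar> \<le> 1"
    and "1 + r\<^sup>2 - 2 * r * mobius r s = (1 - r\<^sup>2)\<^sup>2 / (1 + r\<^sup>2 + 2 * r * s)"
proof -
  note D = ball_denominator_pos'[OF assms]
  show 1: "1 - mobius r s = (1 - r)\<^sup>2 * (1 - s) / (1 + r\<^sup>2 + 2 * r * s)"
    and 2: "1 + mobius r s = (1 + r)\<^sup>2 * (1 + s) / (1 + r\<^sup>2 + 2 * r * s)"
    using D by (simp_all add: mobius_def field_simps power2_eq_square)
  have "0 \<le> 1 - mobius r s" "0 \<le> 1 + mobius r s"
    unfolding 1 2 using D assms by (auto intro!: divide_nonneg_pos mult_nonneg_nonneg)
  then show "\<bar>mobius r s\<bar> \<le> 1" by linarith
  show "1 + r\<^sup>2 - 2 * r * mobius r s = (1 - r\<^sup>2)\<^sup>2 / (1 + r\<^sup>2 + 2 * r * s)"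
    using D by (simp_all add: mobius_def field_simps power2_eq_square)
qed

lemma mobius_derivative:
  assumes "\<bar>r\<bar> < 1" "\<bar>s\<bar> \<le> 1"
  shows "(mobius r has_real_derivative ((1 - r\<^sup>2) / (1 + r\<^sup>2 + 2 * r * s))\<^sup>2) (at s within S)"
proof -
  note D = ball_denominator_pos'[OF assms]
  have "((\<lambda>s. ((1 + r\<^sup>2) * s + 2 * r) / (1 + r\<^sup>2 + 2 * r * s)) has_real_derivative
     ((1 + r\<^sup>2) * (1 + r\<^sup>2 + 2 * r * s) - ((1 + r\<^sup>2) * s + 2 * r) * (2 * r)) /
       ((1 + r\<^sup>2 + 2 * r * s) * (1 + r\<^sup>2 + 2 * r * s))) (at s within S)"
    using D by (auto intro!: derivative_eq_intros)
  moreover have "(1 + r\<^sup>2) * (1 + r\<^sup>2 + 2 * r * s) - ((1 + r\<^sup>2) * s + 2 * r) * (2 * r) = (1 - r\<^sup>2)\<^sup>2"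
    by (simp add: power2_eq_square algebra_simps)
  ultimately show ?thesis
    unfolding mobius_def[abs_def] by (simp add: power_divide power2_eq_square)
qed

lemma mobius_strict_mono:
  assumes "0 \<le> r" "r < 1" "\<bar>s\<bar> \<le> 1" "\<bar>t\<bar> \<le> 1" "s < t"
  shows "mobius r s < mobius r t"
proof (rule DERIV_pos_imp_increasing[OF assms(5)])
  fix x assume "s \<le> x" "x \<le> t"
  then have x: "\<bar>x\<bar> \<le> 1" using assms by linarith
  have "0 < ((1 - r\<^sup>2) / (1 + r\<^sup>2 + 2 * r * x))\<^sup>2"
    using assms ball_denominator_pos'[OF _ x, of r] by (auto simp: abs_square_eq_1)
  then show "\<exists>y. DERIV (mobius r) x :> y \<and> 0 < y"
    using mobius_derivative[OF _ x, of r UNIV] assms by auto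
qed

lemma mobius_inverse:
  assumes "\<bar>r\<bar> < 1" "\<bar>s\<bar> \<le> 1"
  shows "mobius (- r) (mobius r s) = s"
proof -
  note D = ball_denominator_pos'[OF assms]
  have "1 - r\<^sup>2 \<noteq> 0" using assms by (auto simp: abs_square_eq_1)
  have "mobius (- r) (mobius r s) = ((1 + r\<^sup>2) * mobius r s - 2 * r) / (1 + r\<^sup>2 - 2 * r * mobius r s)"
    by (simp add: mobius_def)
  also have "1 + r\<^sup>2 - 2 * r * mobius r s = (1 - r\<^sup>2)\<^sup>2 / (1 + r\<^sup>2 + 2 * r * s)"
    by (rule mobius_props[OF assms])
  also have "(1 + r\<^sup>2) * mobius r s - 2 * r = (1 - r\<^sup>2)\<^sup>2 * s / (1 + r\<^sup>2 + 2 * r * s)"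
    using D by (auto simp: mobius_def divide_simps) (simp add: power2_eq_square algebra_simps)
  finally show ?thesis using D \<open>1 - r\<^sup>2 \<noteq> 0\<close> by simp
qed

lemma axial_kernel_derivative:
  assumes "\<bar>r\<bar> < 1" "\<bar>t\<bar> \<le> 1"
  shows "((\<lambda>r. axial_kernel k r t) has_real_derivative
    2 * real k / (1 - r\<^sup>2) * axial_kernel k r t * mobius (- r) t) (at r)"
proof -
  note D = ball_denominator_pos[OF assms]
  have A: "1 - r\<^sup>2 > 0" using assms by (simp add: abs_square_less_1)
  have "((\<lambda>r. ball_ratio r t) has_real_derivative
      (- (2 * r) * (1 + r\<^sup>2 - 2 * r * t) - (1 - r\<^sup>2) * (2 * r - 2 * t)) /
      ((1 + r\<^sup>2 - 2 * r * t) * (1 + r\<^sup>2 - 2 * r * t))) (at r)"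
    unfolding ball_ratio_def using D by (auto intro!: derivative_eq_intros)
  moreover have "(- (2 * r) * (1 + r\<^sup>2 - 2 * r * t) - (1 - r\<^sup>2) * (2 * r - 2 * t)) /
      ((1 + r\<^sup>2 - 2 * r * t) * (1 + r\<^sup>2 - 2 * r * t)) = 2 / (1 - r\<^sup>2) * ball_ratio r t * mobius (- r) t"
    using A D by (auto simp: ball_ratio_def mobius_def divide_simps) (auto simp: power2_eq_square algebra_simps)
  ultimately have "((\<lambda>r. ball_ratio r t) has_real_derivative 2 / (1 - r\<^sup>2) * ball_ratio r t * mobius (- r) t) (at r)"
    by simp
  from DERIV_power[OF this, of k] show ?thesis
    unfolding axial_kernel_def by (rule DERIV_cong) (cases k, simp_all add: field_simps)
qed

lemma continuous_on_ball_ratio [continuous_intros]: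
  fixes f g :: "'a::topological_space \<Rightarrow> real"
  assumes "continuous_on A f" "continuous_on A g" "\<And>x. x \<in> A \<Longrightarrow> \<bar>f x\<bar> < 1" "\<And>x. x \<in> A \<Longrightarrow> \<bar>g x\<bar> \<le> 1"
  shows "continuous_on A (\<lambda>x. ball_ratio (f x) (g x))"
  unfolding ball_ratio_def using assms
  by (intro continuous_intros) (auto simp: ball_denominator_neq)

lemma continuous_on_axial_kernel [continuous_intros]:
  fixes f g :: "'a::topological_space \<Rightarrow> real"
  assumes "continuous_on A f" "continuous_on A g" "\<And>x. x \<in> A \<Longrightarrow> \<bar>f x\<bar> < 1" "\<And>x. x \<in> A \<Longrightarrow> \<bar>g x\<bar> \<le> 1"
  shows "continuous_on A (\<lambda>x. axial_kernel k (f x) (g x))"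
  unfolding axial_kernel_def using assms by (intro continuous_intros) auto

lemma continuous_on_kernel_slope [continuous_intros]:
  fixes f g :: "'a::topological_space \<Rightarrow> real"
  assumes "continuous_on A f" "continuous_on A g" "\<And>x. x \<in> A \<Longrightarrow> \<bar>f x\<bar> < 1" "\<And>x. x \<in> A \<Longrightarrow> \<bar>g x\<bar> \<le> 1"
  shows "continuous_on A (\<lambda>x. kernel_slope k (f x) (g x))"
  unfolding kernel_slope_def using assms
  by (intro continuous_intros) (auto simp: ball_denominator_neq)

lemma continuous_on_mobius [continuous_intros]:
  fixes f g :: "'a::topological_space \<Rightarrow> real"
  assumes "continuous_on A f" "continuous_on A g" "\<And>x. x \<in> A \<Longrightarrow> \<bar>f x\<bar> < 1" "\<And>x. x \<in> A \<Longrightarrow> \<bar>g x\<bar> \<le> 1"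
  shows "continuous_on A (\<lambda>x. mobius (f x) (g x))"
  unfolding mobius_def using assms
  by (intro continuous_intros) (auto simp: ball_denominator_neq)

definition kernel_slope_deriv :: "nat \<Rightarrow> real \<Rightarrow> real \<Rightarrow> real" where
  "kernel_slope_deriv k r t =
    (- 2 * (1 + r\<^sup>2 - 2 * r * t) - 2 * (t - r) * (2 * r - 2 * t)) / (1 + r\<^sup>2 - 2 * r * t)\<^sup>2 *
      (\<Sum>j<k. axial_kernel j r t) +
    2 * (t - r) / (1 + r\<^sup>2 - 2 * r * t) *
      (\<Sum>j<k. 2 * real j / (1 - r\<^sup>2) * axial_kernel j r t * mobius (- r) t)"

lemma kernel_slope_has_derivative:
  assumes "\<bar>r\<bar> < 1" "\<bar>t\<bar> \<le> 1"
  shows "((\<lambda>r. kernel_slope k r t) has_real_derivative kernel_slope_deriv k r t) (at r)"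
proof -
  note D = ball_denominator_pos[OF assms]
  have 1: "((\<lambda>r. 2 * (t - r) / (1 + r\<^sup>2 - 2 * r * t)) has_real_derivative
    (- 2 * (1 + r\<^sup>2 - 2 * r * t) - 2 * (t - r) * (2 * r - 2 * t)) / (1 + r\<^sup>2 - 2 * r * t)\<^sup>2) (at r)"
    using D by (auto intro!: derivative_eq_intros simp: power2_eq_square)
  have 2: "((\<lambda>r. \<Sum>j<k. axial_kernel j r t) has_real_derivative
    (\<Sum>j<k. 2 * real j / (1 - r\<^sup>2) * axial_kernel j r t * mobius (- r) t)) (at r)"
    by (intro DERIV_sum axial_kernel_derivative assms)
  show ?thesis
    using DERIV_mult[OF 1 2]
    unfolding kernel_slope_def kernel_slope_deriv_def axial_kernel_def by (simp add: mult_ac add_ac)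
qed

lemma continuous_on_kernel_slope_deriv:
  "continuous_on ({-1<..<1} \<times> {-1..1}) (\<lambda>(r, t). kernel_slope_deriv k r t)"
proof -
  have A: "1 - r\<^sup>2 \<noteq> 0" if "r \<in> {-1<..<1}" for r :: real
    using that by (auto simp: abs_square_eq_1)
  have D: "1 + r\<^sup>2 - 2 * r * t \<noteq> 0" if "r \<in> {-1<..<1}" "t \<in> {-1..1}" for r t :: real
    using ball_denominator_neq[of r t] that by (auto simp: abs_le_iff abs_less_iff)
  show ?thesis
    unfolding kernel_slope_deriv_def split_beta'
    by (intro continuous_intros) (use A D in \<open>auto simp: abs_le_iff abs_less_iff\<close>)
qed

text \<open>Uniqueness of the \<open>r\<close>-derivative of the kernel, computed once from
  \<open>1 + r * kernel_slope k r t\<close> and once directly; this spares any manipulation of the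
  geometric sum.\<close>

lemma kernel_slope_derivative_eq:
  assumes "\<bar>r\<bar> < 1" "\<bar>t\<bar> \<le> 1"
  shows "kernel_slope k r t + r * kernel_slope_deriv k r t =
    2 * real k / (1 - r\<^sup>2) * axial_kernel k r t * mobius (- r) t"
proof -
  have "((\<lambda>r. 1 + r * kernel_slope k r t) has_real_derivative
      kernel_slope k r t + r * kernel_slope_deriv k r t) (at r)"
    using kernel_slope_has_derivative[OF assms, of k] by (auto intro!: derivative_eq_intros)
  then have "((\<lambda>r. axial_kernel k r t) has_real_derivative
      kernel_slope k r t + r * kernel_slope_deriv k r t) (at r)"
  proof (rule has_field_derivative_transform_within_open[where S = "{-1<..<1}"])
    show "1 + x * kernel_slope k x t = axial_kernel k x t" if "x \<in> {-1<..<1}" for x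
      using that assms by (subst axial_kernel_eq) auto
  qed (use assms in auto)
  then show ?thesis using axial_kernel_derivative[OF assms] DERIV_unique by blast
qed

text \<open>Isolates what the analysis of the gain uses about the coordinate law: symmetry, the
  Moebius change of variables, not being concentrated at 0, and no mass at the endpoints. The
  density itself enters only in the instantiation.\<close>

locale axial_prob = interval_prob +
  fixes k :: nat
  assumes k_pos: "k > 0"
    and symmetric: "\<And>g :: real \<Rightarrow> real. continuous_on {-1..1} g \<Longrightarrow> (\<integral>t. g (- t) \<partial>M) = (\<integral>t. g t \<partial>M)"
    and mobius_invariant: "\<And>r (g :: real \<Rightarrow> real). 0 \<le> r \<Longrightarrow> r < 1 \<Longrightarrow> continuous_on {-1..1} g \<Longrightarrow>
      (\<integral>t. axial_kernel k r t * g t \<partial>M) = (\<integral>s. g (mobius r s) \<partial>M)"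
    and second_moment_pos: "0 < (\<integral>t. t\<^sup>2 \<partial>M)"
    and no_endpoints: "AE t in M. \<bar>t\<bar> < 1"
begin

text \<open>Averaging with the reflected integral gives twice the value as the integral of
  \<open>(h t - h (- t)) * t\<close>, which is nonnegative and vanishes only at
  \<open>t = 0\<close>. The positive second moment rules out that all mass sits there.\<close>

lemma integral_mult_increasing_pos:
  assumes h: "continuous_on {-1..1} h" and mono: "\<And>s t. s \<in> {-1..1} \<Longrightarrow> t \<in> {-1..1} \<Longrightarrow> s < t \<Longrightarrow> h s < h t"
  shows "0 < (\<integral>t. h t * t \<partial>M)"
proof -
  have c: "continuous_on {-1..1} (\<lambda>t. h (- t))"
    by (rule continuous_on_compose2[OF h]) (auto intro: continuous_intros)
  have c1: "continuous_on {-1..1} (\<lambda>t. h t * t)" using h by (intro continuous_intros)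
  have c2: "continuous_on {-1..1} (\<lambda>t. h (- t) * t)" using c by (intro continuous_intros)
  have "(\<integral>t. h (- t) * (- t) \<partial>M) = (\<integral>t. h t * t \<partial>M)"
    using symmetric[OF c1] by simp
  then have eq: "2 * (\<integral>t. h t * t \<partial>M) = (\<integral>t. h t * t - h (- t) * t \<partial>M)"
    using integrable_continuous[OF c1] integrable_continuous[OF c2] by simp
  have nn: "0 \<le> h t * t - h (- t) * t" if t: "t \<in> {-1..1}" for t
  proof -
    consider "t < 0" | "t = 0" | "t > 0" by linarith
    then show ?thesis
    proof cases
      case 1
      then show ?thesis using mono[of t "-t"] t by (simp add: mult_le_cancel_right)
    next
      case 3
      then show ?thesis using mono[of "-t" t] t by (simp add: mult_le_cancel_right)
    qed simp
  qed
  have nz: "t = 0" if t: "t \<in> {-1..1}" "h t * t - h (- t) * t = 0" for t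
  proof (rule ccontr)
    assume "t \<noteq> 0"
    then have "h t = h (- t)" using t(2) by simp
    then show False using mono[of t "- t"] mono[of "- t" t] t(1) \<open>t \<noteq> 0\<close>
      by (cases "t < 0") auto
  qed
  have int: "integrable M (\<lambda>t. h t * t - h (- t) * t)"
    using c1 c2 by (intro integrable_continuous continuous_on_diff)
  have "(\<integral>t. h t * t - h (- t) * t \<partial>M) \<noteq> 0"
  proof
    assume "(\<integral>t. h t * t - h (- t) * t \<partial>M) = 0"
    then have "AE t in M. h t * t - h (- t) * t = 0"
      using int nn by (subst (asm) integral_nonneg_eq_0_iff_AE) auto
    moreover have "AE t in M. t \<in> {-1..1}" by (rule AE_I2) simp
    ultimately have "AE t in M. t\<^sup>2 = 0" by eventually_elim (use nz in auto)
    then have "(\<integral>t. t\<^sup>2 \<partial>M) = (\<integral>t. 0 \<partial>M)"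
      by (intro integral_cong_AE measurable_continuous) (auto intro!: continuous_intros)
    then show False using second_moment_pos by simp
  qed
  moreover have "0 \<le> (\<integral>t. h t * t - h (- t) * t \<partial>M)" using nn by (intro Bochner_Integration.integral_nonneg) auto
  ultimately show ?thesis using eq by linarith
qed

section \<open>The gain for exponents strictly between 1 and infinity\<close>

definition slope_center :: "real \<Rightarrow> real \<Rightarrow> real" where
  "slope_center q r = (SOME c. (\<integral>t. signed_power q (kernel_slope k r t - c) \<partial>M) = 0)"

definition slope_energy :: "real \<Rightarrow> real \<Rightarrow> real" where
  "slope_energy q r = (\<integral>t. \<bar>kernel_slope k r t - slope_center q r\<bar> powr q \<partial>M)"

definition radial_gain :: "real \<Rightarrow> real \<Rightarrow> real" where
  "radial_gain q r = r * slope_energy q r powr (1 / q)"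

lemma continuous_kernel_slope:
  assumes "\<bar>r\<bar> < 1" shows "continuous_on {-1..1} (kernel_slope k r)"
  using assms by (intro continuous_intros) auto

lemma continuous_axial_kernel:
  assumes "\<bar>r\<bar> < 1" shows "continuous_on {-1..1} (axial_kernel k r)"
  using assms by (intro continuous_intros) auto

lemma slope_center:
  assumes "q > 1" "\<bar>r\<bar> < 1"
  shows "(\<integral>t. signed_power q (kernel_slope k r t - slope_center q r) \<partial>M) = 0"
  unfolding slope_center_def
proof (rule someI_ex)
  show "\<exists>c. (\<integral>t. signed_power q (kernel_slope k r t - c) \<partial>M) = 0"
    using ex_center[OF assms(1) continuous_kernel_slope[OF assms(2)]] by metis
qed

text \<open>\<open>slope_center\<close> is an arbitrary choice of a zero, but the integral is
  strictly decreasing in the constant, so the zero is unique and inherits the bound from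
  \<open>ex_center\<close>.\<close>

lemma slope_center_ge:
  assumes "q > 1" "\<bar>r\<bar> < 1"
  shows "\<exists>t\<in>{-1..1}. kernel_slope k r t \<le> slope_center q r"
proof -
  obtain c where c: "(\<integral>t. signed_power q (kernel_slope k r t - c) \<partial>M) = 0"
    "\<exists>t\<in>{-1..1}. kernel_slope k r t \<le> c"
    using ex_center[OF assms(1) continuous_kernel_slope[OF assms(2)]] by metis
  have "c = slope_center q r"
    using signed_power_integral_strict_antimono[OF assms(1) continuous_kernel_slope[OF assms(2)], of c "slope_center q r"]
      signed_power_integral_strict_antimono[OF assms(1) continuous_kernel_slope[OF assms(2)], of "slope_center q r" c]
      c(1) slope_center[OF assms] by (cases c "slope_center q r" rule: linorder_cases) auto
  then show ?thesis using c by simp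
qed

definition gain_numerator :: "real \<Rightarrow> real \<Rightarrow> real" where
  "gain_numerator q r = (\<integral>t. signed_power q (kernel_slope k r t - slope_center q r) *
     (kernel_slope k r t + r * kernel_slope_deriv k r t) \<partial>M)"

text \<open>The \<open>r\<close>-derivative of the kernel is a multiple of \<open>axial_kernel k r t * mobius (- r) t\<close>, so the
  change of variables \<open>t = mobius r s\<close> turns the integral into one of an increasing function of
  \<open>s\<close> against \<open>s\<close>.\<close>

lemma gain_numerator_pos:
  assumes q: "q > 1" and r: "0 \<le> r" "r < 1"
  shows "0 < gain_numerator q r"
proof -
  have r': "\<bar>r\<bar> < 1" using r by simp
  let ?c = "slope_center q r"
  let ?g = "\<lambda>t. signed_power q (kernel_slope k r t - ?c) * mobius (- r) t"
  let ?h = "\<lambda>s. signed_power q (kernel_slope k r (mobius r s) - ?c)"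
  have g: "continuous_on {-1..1} ?g"
    using q r' by (intro continuous_intros) auto
  have mb: "mobius r s \<in> {-1..1}" if "s \<in> {-1..1}" for s
    using mobius_props(3)[OF r', of s] that by (auto simp: abs_le_iff)
  have h: "continuous_on {-1..1} ?h"
    using q r' mobius_props(3)[OF r'] by (intro continuous_intros) (auto simp: abs_le_iff)
  have "0 < (\<integral>s. ?h s * s \<partial>M)"
  proof (rule integral_mult_increasing_pos[OF h])
    fix s t :: real assume st: "s \<in> {-1..1}" "t \<in> {-1..1}" "s < t"
    show "?h s < ?h t"
      using st mb r k_pos
      by (intro signed_power_strict_mono q diff_strict_right_mono kernel_slope_strict_mono mobius_strict_mono)
        (auto simp: abs_le_iff)
  qed
  also have "(\<integral>s. ?h s * s \<partial>M) = (\<integral>s. ?g (mobius r s) \<partial>M)"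
    using r' by (intro Bochner_Integration.integral_cong) (auto simp: mobius_inverse)
  also have "\<dots> = (\<integral>t. axial_kernel k r t * ?g t \<partial>M)"
    by (rule mobius_invariant[OF r g, symmetric])
  finally have pos: "0 < (\<integral>t. axial_kernel k r t * ?g t \<partial>M)" .
  have "gain_numerator q r = (\<integral>t. 2 * real k / (1 - r\<^sup>2) * (axial_kernel k r t * ?g t) \<partial>M)"
    unfolding gain_numerator_def using r'
    by (intro Bochner_Integration.integral_cong) (auto simp: kernel_slope_derivative_eq)
  also have "\<dots> = 2 * real k / (1 - r\<^sup>2) * (\<integral>t. axial_kernel k r t * ?g t \<partial>M)" by simp
  also have "\<dots> > 0" using pos k_pos r by (intro mult_pos_pos divide_pos_pos) (auto simp: abs_square_less_1)
  finally show ?thesis .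
qed

lemma continuous_kernel_slope_deriv:
  assumes "\<bar>r\<bar> < 1" shows "continuous_on {-1..1} (kernel_slope_deriv k r)"
  using assms
  by (auto intro!: continuous_on_compose2[OF continuous_on_kernel_slope_deriv, where f = "\<lambda>t. (r, t)", simplified]
      continuous_intros)

text \<open>Write \<open>kernel_slope\<close> as its deviation from the centre plus the centre: the
  deviation contributes the energy, and the constant integrates to 0 against the signed power. The
  right side is then what the product rule for \<open>radial_gain\<close> produces.\<close>

lemma gain_numerator_eq:
  assumes q: "q > 1" and r: "\<bar>r\<bar> < 1"
  shows "gain_numerator q r = slope_energy q r +
    r * (\<integral>t. signed_power q (kernel_slope k r t - slope_center q r) * kernel_slope_deriv k r t \<partial>M)"
proof -
  let ?c = "slope_center q r"
  let ?P = "\<lambda>t. signed_power q (kernel_slope k r t - ?c)"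
  have P: "continuous_on {-1..1} ?P" using q r by (intro continuous_intros) auto
  have int: "integrable M ?P" "integrable M (\<lambda>t. \<bar>kernel_slope k r t - ?c\<bar> powr q)"
    "integrable M (\<lambda>t. ?P t * kernel_slope_deriv k r t)"
    using q r P by (auto intro!: integrable_continuous continuous_intros continuous_kernel_slope continuous_kernel_slope_deriv)
  have "gain_numerator q r = (\<integral>t. \<bar>kernel_slope k r t - ?c\<bar> powr q + ?P t * ?c + r * (?P t * kernel_slope_deriv k r t) \<partial>M)"
    unfolding gain_numerator_def
    by (intro Bochner_Integration.integral_cong) (auto simp: algebra_simps simp flip: signed_power_mult_self)
  also have "\<dots> = slope_energy q r + r * (\<integral>t. ?P t * kernel_slope_deriv k r t \<partial>M)"
    using int slope_center[OF q r] by (simp add: slope_energy_def)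
  finally show ?thesis .
qed

text \<open>Zero energy would make the signed power, and with it \<open>gain_numerator\<close>,
  vanish, contradicting \<open>gain_numerator_pos\<close>.\<close>

lemma slope_energy_pos:
  assumes q: "q > 1" and r: "0 \<le> r" "r < 1"
  shows "0 < slope_energy q r"
proof -
  have r': "\<bar>r\<bar> < 1" using r by simp
  let ?c = "slope_center q r"
  have int: "integrable M (\<lambda>t. \<bar>kernel_slope k r t - ?c\<bar> powr q)"
    using q r' by (intro integrable_continuous continuous_intros) auto
  have "slope_energy q r \<noteq> 0"
  proof
    assume "slope_energy q r = 0"
    then have "AE t in M. \<bar>kernel_slope k r t - ?c\<bar> powr q = 0"
      unfolding slope_energy_def using int by (subst (asm) integral_nonneg_eq_0_iff_AE) auto
    then have "AE t in M. signed_power q (kernel_slope k r t - slope_center q r) *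
     (kernel_slope k r t + r * kernel_slope_deriv k r t) = 0"
      by eventually_elim auto
    then have "gain_numerator q r = (\<integral>t. 0 \<partial>M)"
      unfolding gain_numerator_def using q r'
      by (intro integral_cong_AE measurable_continuous)
        (auto intro!: continuous_intros continuous_kernel_slope continuous_kernel_slope_deriv)
    then show False using gain_numerator_pos[OF q r] by simp
  qed
  moreover have "0 \<le> slope_energy q r" unfolding slope_energy_def by simp
  ultimately show ?thesis by linarith
qed

lemma continuous_on_slope_prod:
  "continuous_on ({-1<..<1} \<times> {-1..1}) (\<lambda>(r, t). kernel_slope k r t)"
  unfolding split_beta' by (intro continuous_intros) (auto simp: abs_le_iff abs_less_iff)

text \<open>The slopes are defined and smooth for \<open>-1 < r < 1\<close>, so \<open>r = 0\<close>
  is an interior point and the derivative there is two-sided. Positive energy allows the outer power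
  to be differentiated.\<close>

lemma radial_gain_derivative:
  assumes q: "q > 1" and r: "0 \<le> r" "r < 1"
  shows "(radial_gain q has_real_derivative slope_energy q r powr (1 / q - 1) * gain_numerator q r) (at r)"
proof -
  have r': "\<bar>r\<bar> < 1" and rU: "r \<in> {-1<..<1}" using r by auto
  let ?I = "\<integral>t. signed_power q (kernel_slope k r t - slope_center q r) * kernel_slope_deriv k r t \<partial>M"
  note E = slope_energy_pos[OF q r]
  have D: "(slope_energy q has_real_derivative q * ?I) (at r)"
    unfolding slope_energy_def[abs_def]
    by (rule has_real_derivative_envelope[OF q _ continuous_on_slope_prod continuous_on_kernel_slope_deriv _ _ rU])
      (auto intro!: kernel_slope_has_derivative slope_center q simp: abs_le_iff abs_less_iff)
  have "(radial_gain q has_real_derivative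
      slope_energy q r powr (1 / q) + r * (1 / q * slope_energy q r powr (1 / q - 1) * (q * ?I))) (at r)"
    unfolding radial_gain_def[abs_def]
    using DERIV_mult[OF DERIV_ident DERIV_fun_powr[OF D E, of "1 / q"]]
    by (simp add: mult_ac)
  moreover have "slope_energy q r powr (1 / q) = slope_energy q r powr (1 / q - 1) * slope_energy q r"
    using E by (simp add: powr_diff)
  ultimately show ?thesis
    using q by (simp add: gain_numerator_eq[OF q r'] distrib_left mult_ac)
qed

lemma radial_gain_derivative_continuous:
  assumes q: "q > 1"
  shows "continuous_on {0..<1} (\<lambda>r. slope_energy q r powr (1 / q - 1) * gain_numerator q r)"
proof -
  have ctr: "(\<integral>t. signed_power q (kernel_slope k r t - slope_center q r) \<partial>M) = 0" if "r \<in> {-1<..<1}" for r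
    using that by (intro slope_center q) auto
  have der: "((\<lambda>r. kernel_slope k r t) has_real_derivative kernel_slope_deriv k r t) (at r)"
    if "r \<in> {-1<..<1}" "t \<in> {-1..1}" for r t
    using that by (intro kernel_slope_has_derivative) auto
  have 1: "continuous_on {-1<..<1} (slope_energy q)"
    unfolding slope_energy_def[abs_def]
    by (rule continuous_on_envelope[OF q _ continuous_on_slope_prod continuous_on_kernel_slope_deriv der ctr]) auto
  have "continuous_on {-1<..<1} (\<lambda>r. slope_energy q r +
     r * (\<integral>t. signed_power q (kernel_slope k r t - slope_center q r) * kernel_slope_deriv k r t \<partial>M))"
    by (intro continuous_intros 1
      continuous_on_envelope_derivative[OF q _ continuous_on_slope_prod continuous_on_kernel_slope_deriv der ctr]) auto
  then have "continuous_on {-1<..<1} (gain_numerator q)"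
    by (rule continuous_on_eq) (auto simp: gain_numerator_eq q)
  then have 2: "continuous_on {0..<1} (gain_numerator q)" by (rule continuous_on_subset) auto
  have "continuous_on {0..<1} (slope_energy q)" by (rule continuous_on_subset[OF 1]) auto
  moreover have "slope_energy q r \<noteq> 0" if "r \<in> {0..<1}" for r
    using slope_energy_pos[OF q, of r] that by auto
  ultimately show ?thesis using 2 by (intro continuous_intros) auto
qed

text \<open>Transports the centre of the slope to the kernel: deviations of the kernel from
  \<open>1 + r * slope_center q r\<close> are \<open>r\<close> times those of the slope, and the
  powers of \<open>r\<close> factor out. At a point where the slope lies below its centre, the
  kernel is positive and at most \<open>a\<close>, whence \<open>a \<ge> 0\<close>.\<close>

lemma radial_gain_attained:
  assumes q: "q > 1" and r: "0 \<le> r" "r < 1"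
  obtains a where "a \<ge> 0" "(\<integral>t. signed_power q (axial_kernel k r t - a) \<partial>M) = 0"
    "radial_gain q r = (\<integral>t. \<bar>axial_kernel k r t - a\<bar> powr q \<partial>M) powr (1 / q)"
proof -
  have r': "\<bar>r\<bar> < 1" using r by simp
  let ?c = "slope_center q r"
  define a where "a = 1 + r * ?c"
  have eq: "axial_kernel k r t - a = r * (kernel_slope k r t - ?c)" if "t \<in> {-1..1}" for t
    using axial_kernel_eq[OF r', of t k] that by (simp add: a_def algebra_simps abs_le_iff)
  show thesis
  proof
    obtain t where t: "t \<in> {-1..1}" "kernel_slope k r t \<le> ?c" using slope_center_ge[OF q r'] by blast
    have "0 \<le> axial_kernel k r t" using axial_kernel_pos[OF r', of t k] t by (auto simp: abs_le_iff)
    also have "\<dots> \<le> a" using eq[OF t(1)] t r mult_nonneg_nonpos[of r "kernel_slope k r t - ?c"] by linarith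
    finally show "a \<ge> 0" .
    have "(\<integral>t. signed_power q (axial_kernel k r t - a) \<partial>M) =
      (\<integral>t. r powr (q - 1) * signed_power q (kernel_slope k r t - ?c) \<partial>M)"
      using r by (intro Bochner_Integration.integral_cong)
        (auto simp: eq signed_power_def abs_mult powr_mult sgn_mult)
    then show "(\<integral>t. signed_power q (axial_kernel k r t - a) \<partial>M) = 0"
      using slope_center[OF q r'] by simp
    have "(\<integral>t. \<bar>axial_kernel k r t - a\<bar> powr q \<partial>M) = (\<integral>t. r powr q * \<bar>kernel_slope k r t - ?c\<bar> powr q \<partial>M)"
      using r by (intro Bochner_Integration.integral_cong) (auto simp: eq abs_mult powr_mult)
    then have "(\<integral>t. \<bar>axial_kernel k r t - a\<bar> powr q \<partial>M) = r powr q * slope_energy q r"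
      by (simp add: slope_energy_def)
    then show "radial_gain q r = (\<integral>t. \<bar>axial_kernel k r t - a\<bar> powr q \<partial>M) powr (1 / q)"
      using q r by (simp add: radial_gain_def powr_mult powr_powr)
  qed
qed

text \<open>Duality with the odd powers \<open>t ^ (2 * m + 1)\<close>: their integrals against the kernel tend to
  \<open>1\<close> as \<open>r \<rightarrow> 1\<close>, while their \<open>L\<^sup>p\<close> norms tend to \<open>0\<close> as \<open>m \<rightarrow> \<infinity>\<close>.\<close>

lemma radial_gain_unbounded:
  assumes q: "q > 1"
  shows "\<exists>r\<in>{0..<1}. y \<le> radial_gain q r"
proof -
  define p where "p = q / (q - 1)"
  have p: "p > 1" "1 / q + 1 / p = 1" using q by (auto simp: p_def field_simps)
  define N where "N m = (\<integral>t. \<bar>t ^ (2 * m + 1)\<bar> powr p \<partial>M)" for m :: nat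
  have N: "N \<longlonglongrightarrow> 0"
  proof -
    have "(\<lambda>m. \<integral>t. \<bar>t ^ (2 * m + 1)\<bar> powr p \<partial>M) \<longlonglongrightarrow> (\<integral>t. 0 \<partial>M)"
    proof (rule integral_dominated_convergence[where w = "\<lambda>t. 1"])
      show "AE t in M. (\<lambda>m. \<bar>t ^ (2 * m + 1)\<bar> powr p) \<longlonglongrightarrow> 0"
        using no_endpoints
      proof eventually_elim
        case (elim t)
        have "(\<lambda>m. \<bar>t\<bar> ^ m) \<longlonglongrightarrow> 0" using elim by (intro LIMSEQ_realpow_zero) auto
        then have "(\<lambda>m. \<bar>t\<bar> ^ (2 * m + 1)) \<longlonglongrightarrow> 0"
          by (rule filterlim_compose) (auto intro!: filterlim_subseq simp: strict_mono_def)
        then have "(\<lambda>m. \<bar>t ^ (2 * m + 1)\<bar> powr p) \<longlonglongrightarrow> 0 powr p"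
          unfolding power_abs using p by (intro tendsto_powr' tendsto_const) auto
        then show ?case by simp
      qed
      show "AE t in M. norm (\<bar>t ^ (2 * m + 1)\<bar> powr p) \<le> 1" for m
      proof (rule AE_I2)
        fix t assume "t \<in> space M"
        then have "\<bar>t\<bar> \<le> 1" by auto
        then have "\<bar>t ^ (2 * m + 1)\<bar> \<le> 1" unfolding power_abs by (intro power_le_one) auto
        then have "\<bar>t ^ (2 * m + 1)\<bar> powr p \<le> 1 powr p" using p by (intro powr_mono2) auto
        then show "norm (\<bar>t ^ (2 * m + 1)\<bar> powr p) \<le> 1" by simp
      qed
    qed (use p in \<open>auto intro!: measurable_continuous continuous_intros\<close>)
    then show ?thesis unfolding N_def[abs_def] by (simp only: Bochner_Integration.integral_zero)
  qed
  \<comment> \<open>A positive target is needed for the bound \<open>1 / (2 * z)\<close> on the norm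
    of the odd power: against a pairing larger than 1/2 it forces a gain of at least
    \<open>z\<close>.\<close>
  define z where "z = max y 1"
  have z: "z > 0" by (simp add: z_def)
  obtain m where m: "N m < (1 / (2 * z)) powr p"
    using order_tendstoD(2)[OF N, of "(1 / (2 * z)) powr p"] z unfolding eventually_sequentially by auto
  let ?g = "\<lambda>t::real. t ^ (2 * m + 1)"
  have N0: "0 \<le> N m" by (simp add: N_def)
  have Nm: "N m powr (1 / p) \<le> 1 / (2 * z)"
  proof -
    have "N m powr (1 / p) \<le> ((1 / (2 * z)) powr p) powr (1 / p)"
      using m p N0 by (intro powr_mono2) auto
    also have "\<dots> = 1 / (2 * z)" using p z by (simp add: powr_powr)
    finally show ?thesis .
  qed
  define \<rho> where "\<rho> j = 1 - inverse (real (Suc j))" for j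
  have \<rho>: "0 \<le> \<rho> j" "\<rho> j < 1" for j by (auto simp: \<rho>_def field_simps)
  have \<rho>lim: "\<rho> \<longlonglongrightarrow> 1"
    unfolding \<rho>_def[abs_def] using tendsto_diff[OF tendsto_const LIMSEQ_inverse_real_of_nat, of 1] by simp
  \<comment> \<open>By \<open>mobius_invariant\<close> these are the pairings of the kernel with
    \<open>?g\<close>; for every \<open>s > -1\<close> the point \<open>mobius r s\<close> moves to
    the pole 1 as \<open>r\<close> tends to 1.\<close>
  have "(\<lambda>j. \<integral>s. ?g (mobius (\<rho> j) s) \<partial>M) \<longlonglongrightarrow> (\<integral>s. 1 \<partial>M)"
  proof (rule integral_dominated_convergence[where w = "\<lambda>t. 1"])
    show "AE s in M. (\<lambda>j. ?g (mobius (\<rho> j) s)) \<longlonglongrightarrow> 1"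
      using no_endpoints
    proof eventually_elim
      case (elim s)
      have "(\<lambda>j. mobius (\<rho> j) s) \<longlonglongrightarrow> ((1 + 1\<^sup>2) * s + 2 * 1) / (1 + 1\<^sup>2 + 2 * 1 * s)"
        unfolding mobius_def using elim by (intro tendsto_intros \<rho>lim) auto
      also have "((1 + 1\<^sup>2) * s + 2 * 1) / (1 + 1\<^sup>2 + 2 * 1 * s) = 1"
        using elim by (simp add: add.commute)
      finally have "(\<lambda>j. ?g (mobius (\<rho> j) s)) \<longlonglongrightarrow> 1 ^ (2 * m + 1)" by (rule tendsto_power)
      then show ?case by simp
    qed
    show "AE s in M. norm (?g (mobius (\<rho> j) s)) \<le> 1" for j
    proof (rule AE_I2)
      fix s assume "s \<in> space M"
      then have "\<bar>mobius (\<rho> j) s\<bar> \<le> 1" using \<rho>[of j] by (intro mobius_props) auto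
      then show "norm (?g (mobius (\<rho> j) s)) \<le> 1" unfolding norm_power by (intro power_le_one) auto
    qed
    show "(\<lambda>s. ?g (mobius (\<rho> j) s)) \<in> borel_measurable M" for j
      using \<rho>[of j] by (intro measurable_continuous continuous_intros) auto
  qed auto
  then have "(\<lambda>j. \<integral>s. ?g (mobius (\<rho> j) s) \<partial>M) \<longlonglongrightarrow> 1" by simp
  then obtain j where j: "1 / 2 < (\<integral>s. ?g (mobius (\<rho> j) s) \<partial>M)"
    using order_tendstoD(1)[of _ 1 sequentially "1/2"] unfolding eventually_sequentially by force
  let ?r = "\<rho> j"
  have r': "\<bar>?r\<bar> < 1" using \<rho>[of j] by simp
  obtain a where a: "radial_gain q ?r = (\<integral>t. \<bar>axial_kernel k ?r t - a\<bar> powr q \<partial>M) powr (1 / q)"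
    using radial_gain_attained[OF q \<rho>] by metis
  have g: "continuous_on {-1..1} ?g" by (intro continuous_intros)
  \<comment> \<open>Odd powers have mean zero, so the unknown best constant \<open>a\<close> may be
    subtracted from the kernel before Hoelder's inequality is applied.\<close>
  have g0: "(\<integral>t. ?g t \<partial>M) = 0"
    using symmetric[OF g] by simp
  have ck: "continuous_on {-1..1} (\<lambda>t. axial_kernel k ?r t - a)"
    using r' by (intro continuous_intros) auto
  have ints: "integrable M (\<lambda>t. axial_kernel k ?r t * ?g t)" "integrable M ?g"
    using r' by (auto intro!: integrable_continuous continuous_intros)
  have "1 / 2 < (\<integral>t. axial_kernel k ?r t * ?g t \<partial>M)"
    using j mobius_invariant[OF \<rho> g] by simp
  also have "\<dots> = (\<integral>t. axial_kernel k ?r t * ?g t - a * ?g t \<partial>M)"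
    using ints g0 by simp
  also have "\<dots> = (\<integral>t. (axial_kernel k ?r t - a) * ?g t \<partial>M)"
    by (intro Bochner_Integration.integral_cong) (auto simp: left_diff_distrib)
  also have "\<dots> \<le> (\<integral>t. \<bar>(axial_kernel k ?r t - a) * ?g t\<bar> \<partial>M)"
    using integral_abs_bound[of M "\<lambda>t. (axial_kernel k ?r t - a) * ?g t"] by linarith
  also have "\<dots> \<le> radial_gain q ?r * N m powr (1 / p)"
    unfolding a N_def using q p(1)
    by (intro Holder_inequality(2)[OF q p] measurable_continuous integrable_continuous
      continuous_on_abs_powr ck g) auto
  also have "\<dots> \<le> radial_gain q ?r * (1 / (2 * z))"
    using Nm by (intro mult_left_mono) (auto simp: a)
  finally have "z \<le> radial_gain q ?r" using z by (simp add: field_simps)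
  then show ?thesis using \<rho>[of j] by (intro bexI[of _ ?r]) (auto simp: z_def)
qed

end

section \<open>Explicit integrals against the coordinate density\<close>

text \<open>The underlying space is cut down to the interval, so that continuity on
  \<open>{-1..1}\<close> alone gives measurability.\<close>

definition axial :: "nat \<Rightarrow> real measure" where
  "axial n = restrict_space (axial_real n) {-1..1}"

definition axial_weight :: "nat \<Rightarrow> real \<Rightarrow> real" where
  "axial_weight n t = sqrt (1 - t\<^sup>2) ^ (n - 3)"

lemma continuous_on_axial_weight [continuous_intros]:
  fixes f :: "'a::topological_space \<Rightarrow> real"
  assumes "continuous_on A f"
  shows "continuous_on A (\<lambda>x. axial_weight n (f x))"
  unfolding axial_weight_def using assms by (intro continuous_intros)

lemma axial_weight_minus [simp]: "axial_weight n (- t) = axial_weight n t"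
  by (simp add: axial_weight_def)

lemma axial_weight_pos: "\<bar>t\<bar> < 1 \<Longrightarrow> 0 < axial_weight n t"
  by (simp add: axial_weight_def abs_square_less_1)

text \<open>The passage to gauge integrals, where substitution, reflection and splitting of
  intervals are carried out. Subintervals are allowed for the sake of hemispheres and polar
  caps.\<close>

lemma integral_axial_indicator:
  fixes h :: "real \<Rightarrow> real"
  assumes n: "n \<ge> 3" and ab: "-1 \<le> a" "b \<le> 1" and h: "continuous_on {a..b} h"
  shows "integrable (axial n) (\<lambda>t. indicator {a..b} t * h t)"
    and "(\<integral>t. indicator {a..b} t * h t \<partial>axial n) =
      integral {a..b} (\<lambda>t. h t * axial_weight n t) / Beta (1/2) ((real n - 1) / 2)"
proof -
  let ?B = "Beta (1/2) ((real n - 1) / 2)"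
  let ?w = "\<lambda>t. h t * axial_weight n t / ?B"
  have sub: "{a..b} \<subseteq> {-1..1}" using ab by auto
  have c: "continuous_on {a..b} ?w"
    unfolding divide_inverse using h by (intro continuous_intros)
  have int: "set_integrable lborel {a..b} ?w"
    using c by (rule borel_integrable_atLeastAtMost')
  have m: "(\<lambda>t. indicator {a..b} t * h t) \<in> borel_measurable borel"
    using borel_measurable_continuous_on_indicator[OF _ h] by simp
  have \<Omega>: "{-1..1} \<inter> space (axial_real n) \<in> sets (axial_real n)"
    by (simp add: axial_real_def)
  have ind: "indicator {-1..1} t * (indicator {a..b} t * h t) = indicator {a..b} t * h t" for t :: real
    using sub by (auto simp: indicator_def)
  have dens: "axial_density n t * (indicator {a..b} t * h t) = indicator {a..b} t * ?w t" for t
    using sub by (auto simp: axial_density_def axial_weight_def indicator_def)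
  have nn: "AE t in lborel. 0 \<le> axial_density n t" using axial_density_nonneg[OF n] by auto
  have "integrable lborel (\<lambda>t. axial_density n t *\<^sub>R (indicator {a..b} t * h t))"
    using int by (simp add: dens set_integrable_def)
  then have "integrable (axial_real n) (\<lambda>t. indicator {a..b} t * h t)"
    unfolding axial_real_def using m nn by (subst integrable_density) auto
  then show "integrable (axial n) (\<lambda>t. indicator {a..b} t * h t)"
    unfolding axial_def by (subst integrable_restrict_space[OF \<Omega>]) (simp add: ind)
  have "(\<integral>t. indicator {a..b} t * h t \<partial>axial n) = (\<integral>t. indicator {a..b} t * h t \<partial>axial_real n)"
    unfolding axial_def by (subst integral_restrict_space[OF \<Omega>]) (simp add: ind)
  also have "\<dots> = (\<integral>t. axial_density n t *\<^sub>R (indicator {a..b} t * h t) \<partial>lborel)"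
    unfolding axial_real_def using m nn by (intro integral_density) auto
  also have "\<dots> = set_lebesgue_integral lborel {a..b} ?w"
    by (simp add: dens set_lebesgue_integral_def)
  also have "\<dots> = integral {a..b} ?w"
    using int by (rule set_borel_integral_eq_integral)
  finally show "(\<integral>t. indicator {a..b} t * h t \<partial>axial n) = integral {a..b} (\<lambda>t. h t * axial_weight n t) / ?B"
    by simp
qed

lemma sets_axial: "sets (axial n) = sets (restrict_space borel {-1..1})"
  unfolding axial_def by (intro sets_restrict_space_cong) (simp add: axial_real_def)

lemma space_axial: "space (axial n) = {-1..1}"
  by (simp add: axial_def space_restrict_space axial_real_def)

lemma AE_axial:
  "AE t in axial n. t \<noteq> 0 \<and> \<bar>t\<bar> < 1"
proof -
  have "AE t in lborel. t \<in> {-1..1} \<longrightarrow> t \<noteq> 0 \<and> \<bar>t::real\<bar> < 1"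
    using AE_lborel_singleton[of 0] AE_lborel_singleton[of 1] AE_lborel_singleton[of "-1"]
    by eventually_elim auto
  then have "AE t in axial_real n. t \<in> {-1..1} \<longrightarrow> t \<noteq> 0 \<and> \<bar>t\<bar> < 1"
    unfolding axial_real_def by (subst AE_density) (simp_all add: eventually_mono)
  then show ?thesis
    unfolding axial_def by (subst AE_restrict_space_iff) (auto simp: axial_real_def)
qed

lemma interval_prob_axial:
  assumes n: "n \<ge> 3" shows "interval_prob (axial n)"
proof -
  interpret R: real_distribution "axial_real n" by (rule real_distribution_axial_real[OF n])
  have "emeasure (axial_real n) {-1..1} = emeasure (axial_real n) UNIV"
  proof (rule emeasure_eq_AE)
    have "AE t in axial_real n. t \<in> {-1..1}"
      unfolding axial_real_def
      by (subst AE_density) (auto simp: axial_density_def indicator_def intro!: AE_I2)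
    then show "AE t in axial_real n. (t \<in> {-1..1}) = (t \<in> UNIV)" by simp
  qed (auto simp: axial_real_def)
  also have "\<dots> = 1" using R.emeasure_space_1 by (simp add: axial_real_def)
  finally have "emeasure (axial n) {-1..1} = 1"
    unfolding axial_def by (subst emeasure_restrict_space) (auto simp: axial_real_def)
  then have "prob_space (axial n)" by (intro prob_spaceI) (simp add: space_axial)
  then show ?thesis by (simp add: interval_prob_def interval_prob_axioms_def sets_axial)
qed

lemma integral_axial:
  fixes h :: "real \<Rightarrow> real"
  assumes n: "n \<ge> 3" and h: "continuous_on {-1..1} h"
  shows "(\<integral>t. h t \<partial>axial n) =
    integral {-1..1} (\<lambda>t. h t * axial_weight n t) / Beta (1/2) ((real n - 1) / 2)"
proof -
  have "(\<integral>t. h t \<partial>axial n) = (\<integral>t. indicator {-1..1} t * h t \<partial>axial n)"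
    by (intro Bochner_Integration.integral_cong) (auto simp: space_axial)
  then show ?thesis using integral_axial_indicator(2)[OF n _ _ h] by simp
qed

text \<open>With \<open>A = 1 - r\<^sup>2\<close> and \<open>D = 1 + r\<^sup>2 + 2 * r * s\<close> the Jacobian of \<open>mobius r\<close> is
  \<open>(A / D)\<^sup>2\<close> and the weight changes by \<open>(A / D) ^ (n - 3)\<close>; the kernel contributes \<open>(D / A) ^ (n - 1)\<close>.\<close>

lemma integral_kernel_mobius:
  fixes g :: "real \<Rightarrow> real"
  assumes n: "n \<ge> 3" and r: "0 \<le> r" "r < 1" and ab: "-1 \<le> a" "a \<le> b" "b \<le> 1"
    and g: "continuous_on {-1..1} g"
  shows "integral {mobius r a..mobius r b} (\<lambda>t. axial_kernel (n - 1) r t * g t * axial_weight n t) =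
    integral {a..b} (\<lambda>s. g (mobius r s) * axial_weight n s)"
proof -
  have r': "\<bar>r\<bar> < 1" using r by simp
  have mb: "\<bar>mobius r s\<bar> \<le> 1" if "s \<in> {a..b}" for s
    using that ab by (intro mobius_props r') auto
  have le: "mobius r a \<le> mobius r b"
    using mobius_strict_mono[OF r, of a b] ab by (cases "a = b") (auto simp: abs_le_iff)
  let ?f = "\<lambda>t. axial_kernel (n - 1) r t * g t * axial_weight n t"
  let ?J = "\<lambda>s. ((1 - r\<^sup>2) / (1 + r\<^sup>2 + 2 * r * s))\<^sup>2"
  have "((\<lambda>s. ?J s *\<^sub>R ?f (mobius r s)) has_integral integral {mobius r a..mobius r b} ?f) {a..b}"
  proof (rule has_integral_substitution[OF ab(2) le])
    show "mobius r ` {a..b} \<subseteq> {-1..1}" using mb by (auto simp: abs_le_iff)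
    show "continuous_on {-1..1} ?f" using r' g by (intro continuous_intros) auto
    show "(mobius r has_real_derivative ?J x) (at x within {a..b})" if "x \<in> {a..b}" for x
      using that ab by (intro mobius_derivative r') auto
  qed
  moreover have "?J s *\<^sub>R ?f (mobius r s) = g (mobius r s) * axial_weight n s" if s: "s \<in> {a..b}" for s
  proof -
    have s1: "\<bar>s\<bar> \<le> 1" using s ab by auto
    define D where "D = 1 + r\<^sup>2 + 2 * r * s"
    define A where "A = 1 - r\<^sup>2"
    have D: "D > 0" unfolding D_def by (rule ball_denominator_pos'[OF r' s1])
    have A: "A > 0" using r' by (simp add: A_def abs_square_less_1)
    have k: "ball_ratio r (mobius r s) = D / A"
      using D A mobius_props(4)[OF r' s1] by (simp add: ball_ratio_def D_def A_def power2_eq_square)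
    have "1 - (mobius r s)\<^sup>2 = (1 - mobius r s) * (1 + mobius r s)"
      by (simp add: power2_eq_square algebra_simps)
    also have "\<dots> = (A / D)\<^sup>2 * (1 - s\<^sup>2)"
      unfolding mobius_props(1,2)[OF r' s1] D_def[symmetric]
      using D by (simp add: A_def power2_eq_square field_simps)
    finally have "sqrt (1 - (mobius r s)\<^sup>2) = A / D * sqrt (1 - s\<^sup>2)"
      using A D by (simp add: real_sqrt_mult)
    then have w: "axial_weight n (mobius r s) = (A / D) ^ (n - 3) * axial_weight n s"
      unfolding axial_weight_def by (simp only: power_mult_distrib)
    \<comment> \<open>The factors cancel because \<open>2 + (n - 3) = n - 1\<close>; writing
      \<open>n = m + 3\<close> resolves the truncated subtractions.\<close>
    obtain m where m: "n = m + 3" using n by (metis add.commute le_Suc_ex)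
    have "(A / D)\<^sup>2 * (D / A) ^ (n - 1) * (A / D) ^ (n - 3) = ((A / D) * (D / A)) ^ (n - 1)"
      unfolding m power_mult_distrib by (simp add: power2_eq_square)
    also have "\<dots> = 1" using A D by simp
    finally have e: "(A / D)\<^sup>2 * (D / A) ^ (n - 1) * (A / D) ^ (n - 3) = 1" .
    have "?J s *\<^sub>R ?f (mobius r s) =
        ((A / D)\<^sup>2 * (D / A) ^ (n - 1) * (A / D) ^ (n - 3)) * (g (mobius r s) * axial_weight n s)"
      unfolding axial_kernel_def k w A_def[symmetric] D_def[symmetric] by simp
    then show ?thesis unfolding e by simp
  qed
  ultimately show ?thesis
    by (metis (no_types, lifting) has_integral_eq integral_unique)
qed

lemma mobius_endpoints [simp]:
  assumes "\<bar>r\<bar> < 1" shows "mobius r 1 = 1" "mobius r (- 1) = - 1"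
proof -
  show "mobius r 1 = 1" using ball_denominator_neq(2)[OF assms, of 1] by (simp add: mobius_def add.commute)
  show "mobius r (- 1) = - 1" using ball_denominator_neq(2)[OF assms, of "-1"]
    by (simp add: mobius_def divide_simps) 
qed

lemma axial_prob_axial:
  assumes n: "n \<ge> 3" shows "axial_prob (axial n) (n - 1)"
proof -
  interpret interval_prob "axial n" by (rule interval_prob_axial[OF n])
  show ?thesis
  proof
    show "n - 1 > 0" using n by simp
    show "(\<integral>t. g (- t) \<partial>axial n) = (\<integral>t. g t \<partial>axial n)" if g: "continuous_on {-1..1} g" for g :: "real \<Rightarrow> real"
    proof -
      have g': "continuous_on {-1..1} (\<lambda>t. g (- t))"
        by (rule continuous_on_compose2[OF g]) (auto intro: continuous_intros)
      have "integral {-1..1} (\<lambda>t. g (- t) * axial_weight n t) = integral {-1..1} (\<lambda>t. g t * axial_weight n t)"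
        using Henstock_Kurzweil_Integration.integral_reflect_real[of 1 "-1" "\<lambda>t. g t * axial_weight n t"] by simp
      then show ?thesis by (simp add: integral_axial[OF n g] integral_axial[OF n g'])
    qed
    show "(\<integral>t. axial_kernel (n - 1) r t * g t \<partial>axial n) = (\<integral>s. g (mobius r s) \<partial>axial n)"
      if r: "0 \<le> r" "r < 1" and g: "continuous_on {-1..1} g" for r and g :: "real \<Rightarrow> real"
    proof -
      have r': "\<bar>r\<bar> < 1" using r by simp
      have "continuous_on {-1..1} (\<lambda>t. axial_kernel (n - 1) r t * g t)"
        using r' g by (intro continuous_intros) auto
      moreover have "continuous_on {-1..1} (\<lambda>s. g (mobius r s))"
        by (rule continuous_on_compose2[OF g])
          (use r' mobius_props(3)[OF r'] in \<open>auto intro!: continuous_intros simp: abs_le_iff\<close>)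
      ultimately show ?thesis
        using integral_kernel_mobius[OF n r, of "-1" 1 g] r' g by (simp add: integral_axial[OF n])
    qed
    show "AE t in axial n. \<bar>t\<bar> < 1" using AE_axial by eventually_elim auto
    have "(\<integral>t. t\<^sup>2 \<partial>axial n) \<noteq> 0"
    proof
      assume "(\<integral>t. t\<^sup>2 \<partial>axial n) = 0"
      moreover have "integrable (axial n) (\<lambda>t. t\<^sup>2)" by (intro integrable_continuous continuous_intros)
      ultimately have "AE t in axial n. t\<^sup>2 = 0" by (subst (asm) integral_nonneg_eq_0_iff_AE) auto
      with AE_axial[of n] have "AE t in axial n. False" by eventually_elim auto
      then show False using AE_False by simp
    qed
    moreover have "0 \<le> (\<integral>t. t\<^sup>2 \<partial>axial n)" by simp
    ultimately show "0 < (\<integral>t. t\<^sup>2 \<partial>axial n)" by linarith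
  qed
qed

text \<open>Evenness halves the interval, and \<open>x = t\<^sup>2\<close> turns the half into a
  Beta integral with parameters (1 + q)/2 and (n - 1)/2. The Gamma factors of (n - 1)/2 cancel
  against the normalisation.\<close>

lemma axial_moment:
  assumes n: "n \<ge> 3" and q: "q \<ge> 1"
  shows "(\<integral>t. \<bar>t\<bar> powr q \<partial>axial n) =
    Gamma (real n / 2) * Gamma ((1 + q) / 2) / (sqrt pi * Gamma ((real n + q) / 2))"
proof -
  interpret interval_prob "axial n" by (rule interval_prob_axial[OF n])
  let ?B = "Beta (1/2) ((real n - 1) / 2)"
  let ?b = "Beta ((1 + q) / 2) ((real n - 1) / 2)"
  have c: "continuous_on A (\<lambda>t. \<bar>t\<bar> powr q * axial_weight n t)" for A :: "real set"
    using q by (intro continuous_intros) auto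
  have io: "(\<lambda>t. \<bar>t\<bar> powr q * axial_weight n t) integrable_on {a..b}" for a b
    by (rule integrable_continuous_real[OF c])
  have "(\<integral>t. \<bar>t\<bar> powr q \<partial>axial n) = integral {-1..1} (\<lambda>t. \<bar>t\<bar> powr q * axial_weight n t) / ?B"
    using q by (intro integral_axial[OF n] continuous_intros) auto
  also have "integral {-1..1} (\<lambda>t. \<bar>t\<bar> powr q * axial_weight n t) =
      integral {-1..0} (\<lambda>t. \<bar>t\<bar> powr q * axial_weight n t) + integral {0..1} (\<lambda>t. \<bar>t\<bar> powr q * axial_weight n t)"
    by (rule Henstock_Kurzweil_Integration.integral_combine[symmetric]) (auto intro: io)
  also have "integral {-1..0} (\<lambda>t. \<bar>t\<bar> powr q * axial_weight n t) = integral {0..1} (\<lambda>t. \<bar>t\<bar> powr q * axial_weight n t)"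
    using Henstock_Kurzweil_Integration.integral_reflect_real[of 1 0 "\<lambda>t. \<bar>t\<bar> powr q * axial_weight n t"] by simp
  also have "integral {0..1} (\<lambda>t. \<bar>t\<bar> powr q * axial_weight n t) = ?b / 2"
  proof -
    let ?f = "\<lambda>x. x powr ((1 + q) / 2 - 1) * (1 - x) powr ((real n - 1) / 2 - 1)"
    have b: "?b > 0"
      using n q by (auto simp: Beta_def intro!: divide_pos_pos mult_pos_pos Gamma_real_pos add_pos_pos)
    have "(?f has_integral ?b) {0..1}" using n q by (intro has_integral_Beta_real) auto
    then have "ennreal ?b = (\<integral>\<^sup>+x. ?f x * indicator {0\<^sup>2..1\<^sup>2} x \<partial>lborel)"
      by (subst nn_integral_has_integral_lebesgue[symmetric, of "{0..1}" ?f]) (auto simp: mult.commute)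
    also have "\<dots> = (\<integral>\<^sup>+x. ?f (x\<^sup>2) * (2 * x) * indicator {0..1} x \<partial>lborel)"
      by (rule nn_integral_substitution)
        (auto intro!: derivative_eq_intros continuous_intros simp: set_borel_measurable_def)
    also have "\<dots> = (\<integral>\<^sup>+x. indicator {0..1} x * (2 * (\<bar>x\<bar> powr q * axial_weight n x)) \<partial>lborel)"
    proof (rule nn_integral_cong_AE)
      \<comment> \<open>For \<open>n = 3\<close> the two integrands differ at \<open>x = 1\<close>,
        because \<open>0 powr 0 = 0\<close> while \<open>0 ^ 0 = 1\<close>.\<close>
      have "AE x in lborel. x \<noteq> 0 \<and> x \<noteq> (1::real)"
        using AE_lborel_singleton[of 0] AE_lborel_singleton[of 1] by auto
      then show "AE x in lborel. ennreal (?f (x\<^sup>2) * (2 * x) * indicator {0..1} x) =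
        ennreal (indicator {0..1} x * (2 * (\<bar>x\<bar> powr q * axial_weight n x)))"
      proof eventually_elim
        case (elim x)
        show ?case
        proof (cases "x \<in> {0..1}")
          case True
          then have x: "0 < x" "x < 1" using elim by auto
          then have x2: "x\<^sup>2 < 1" by (simp add: abs_square_less_1)
          have f1: "(x\<^sup>2) powr ((1 + q) / 2 - 1) = x powr (q - 1)"
          proof -
            have "(x\<^sup>2) powr ((1 + q) / 2 - 1) = (x powr 2) powr ((1 + q) / 2 - 1)"
              using x by simp
            also have "\<dots> = x powr (q - 1)"
              unfolding powr_powr by (intro arg_cong2[where f = "(powr)"]) (auto simp: field_simps)
            finally show ?thesis .
          qed
          have f2: "x powr (q - 1) * x = x powr q" using x by (simp add: powr_diff)
          have f3: "(1 - x\<^sup>2) powr ((real n - 1) / 2 - 1) = axial_weight n x"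
          proof -
            have "sqrt (1 - x\<^sup>2) ^ (n - 3) = ((1 - x\<^sup>2) powr (1/2)) powr real (n - 3)"
              using x2 by (simp add: powr_half_sqrt powr_realpow)
            also have "\<dots> = (1 - x\<^sup>2) powr ((real n - 1) / 2 - 1)"
              unfolding powr_powr using n by (intro arg_cong2[where f = "(powr)"]) (auto simp: of_nat_diff field_simps)
            finally show ?thesis by (simp add: axial_weight_def)
          qed
          have f4: "?f (x\<^sup>2) * (2 * x) = 2 * (x powr q * axial_weight n x)"
            unfolding f1 f3 f2[symmetric] by simp
          show ?thesis unfolding f4 using x by simp
        qed simp
      qed
    qed
    also have "\<dots> = ennreal (2 * integral {0..1} (\<lambda>t. \<bar>t\<bar> powr q * axial_weight n t))"
    proof -
      have "((\<lambda>t. 2 * (\<bar>t\<bar> powr q * axial_weight n t)) has_integral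
          2 * integral {0..1} (\<lambda>t. \<bar>t\<bar> powr q * axial_weight n t)) {0..1}"
        by (intro has_integral_mult_right integrable_integral io)
      moreover have "0 \<le> 2 * (\<bar>t\<bar> powr q * axial_weight n t)" if "t \<in> {0..1}" for t :: real
        using that by (auto simp: axial_weight_def abs_square_le_1)
      ultimately show ?thesis by (rule nn_integral_has_integral_lebesgue[rotated])
    qed
    finally have "ennreal ?b = ennreal (2 * integral {0..1} (\<lambda>t. \<bar>t\<bar> powr q * axial_weight n t))" .
    moreover have "0 \<le> integral {0..1} (\<lambda>t. \<bar>t\<bar> powr q * axial_weight n t)"
      by (intro integral_nonneg io) (auto simp: axial_weight_def abs_square_le_1)
    ultimately show ?thesis using b by (subst (asm) ennreal_inj) auto
  qed
  finally have "(\<integral>t. \<bar>t\<bar> powr q \<partial>axial n) = ?b / ?B" by simp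
  also have "\<dots> = Gamma (real n / 2) * Gamma ((1 + q) / 2) / (sqrt pi * Gamma ((real n + q) / 2))"
  proof -
    have g: "Gamma ((real n - 1) / 2) > 0" using n by (intro Gamma_real_pos) auto
    have s: "1 / 2 + (real n - 1) / 2 = real n / 2" "(1 + q) / 2 + (real n - 1) / 2 = (real n + q) / 2"
      by (auto simp: field_simps)
    show ?thesis unfolding Beta_def s Gamma_one_half_real using g by (simp add: mult.commute)
  qed
  finally show ?thesis .
qed

section \<open>Increasing diffeomorphisms\<close>

text \<open>One criterion for both target intervals: since \<open>f\<close> starts at 0 and the
  intermediate value theorem fills gaps, surjectivity onto \<open>T\<close> only asks that each
  value be reached or exceeded.\<close>

lemma increasing_diffeomorphismI:
  fixes f f' :: "real \<Rightarrow> real"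
  assumes deriv: "\<And>r. r \<in> {0..<1} \<Longrightarrow> (f has_real_derivative f' r) (at r within {0..<1})"
    and cont: "continuous_on {0..<1} f'"
    and pos: "\<And>r. r \<in> {0..<1} \<Longrightarrow> 0 < f' r"
    and f0: "f 0 = 0" and T: "f ` {0..<1} \<subseteq> T" "T \<subseteq> {0..}"
    and reach: "\<And>y. y \<in> T \<Longrightarrow> \<exists>r\<in>{0..<1}. y \<le> f r"
  shows "increasing_diffeomorphism f {0..<1} T"
proof -
  let ?S = "{0..<1::real}"
  have cf: "continuous_on ?S f" by (rule DERIV_continuous_on[OF deriv])
  have mono: "f x < f y" if "x \<in> ?S" "y \<in> ?S" "x < y" for x y
  proof (rule DERIV_pos_imp_increasing_open[OF \<open>x < y\<close>])
    fix z assume z: "x < z" "z < y"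
    then have "at z within ?S = at z" using that by (intro at_within_interior) (auto simp: interior_atLeastLessThan)
    then show "\<exists>d. DERIV f z :> d \<and> 0 < d" using deriv[of z] pos[of z] z that by auto
  next
    show "continuous_on {x..y} f" by (rule continuous_on_subset[OF cf]) (use that in auto)
  qed
  have sm: "strict_mono_on ?S f" using mono by (auto simp: strict_mono_on_def)
  then have inj: "inj_on f ?S" by (rule strict_mono_on_imp_inj_on)
  have "T \<subseteq> f ` ?S"
  proof
    fix y assume y: "y \<in> T"
    then obtain r where r: "r \<in> ?S" "y \<le> f r" using reach by blast
    have "\<exists>x\<ge>0. x \<le> r \<and> f x = y"
      using y T r f0 by (intro IVT' continuous_on_subset[OF cf]) auto
    then show "y \<in> f ` ?S" using r by force
  qed
  then have im: "f ` ?S = T" using T by auto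
  then have bij: "bij_betw f ?S T" using inj by (simp add: bij_betw_def)
  let ?g = "inv_into ?S f"
  have gf: "?g (f x) = x" if "x \<in> ?S" for x using inj that by (rule inv_into_f_f)
  have gS: "?g y \<in> ?S" "f (?g y) = y" if "y \<in> T" for y
    using that im by (auto intro: inv_into_into f_inv_into_f simp del: atLeastLessThan_iff)
  \<comment> \<open>A continuous injection on an interval is a homeomorphism onto its image;
    continuity of the inverse is required before \<open>has_derivative_inverse_within\<close> can be
    applied.\<close>
  have "path_connected ?S" by (intro convex_imp_path_connected convex_real_interval)
  then obtain h where h: "homeomorphism ?S T f h"
    using homeomorphism_into_1d[OF _ cf im inj] by blast
  have "h y = ?g y" if "y \<in> T" for y
    using h gS[OF that] by (metis homeomorphism_apply1)
  then have cg: "continuous_on T ?g"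
    using continuous_on_eq[of T h ?g] h by (auto simp: homeomorphism_def)
  have "(?g has_real_derivative inverse (f' (?g y))) (at y within T)" if y: "y \<in> T" for y
  proof -
    note x = gS[OF y]
    have "(?g has_derivative (\<lambda>z. inverse (f' (?g y)) * z)) (at (f (?g y)) within f ` ?S)"
    proof (rule has_derivative_inverse_within)
      show "(f has_derivative (\<lambda>z. f' (?g y) * z)) (at (?g y) within ?S)"
        using deriv[OF x(1)] by (simp add: has_field_derivative_def)
      show "continuous (at (f (?g y)) within f ` ?S) ?g"
        using cg y unfolding im x(2) by (simp add: continuous_on_eq_continuous_within)
      show "linear (\<lambda>z. inverse (f' (?g y)) * z)" by (simp add: linear_times)
      show "(\<lambda>z. inverse (f' (?g y)) * z) \<circ> (\<lambda>z. f' (?g y) * z) = id"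
        using pos[OF x(1)] by (auto simp: fun_eq_iff)
    qed (use x gf in auto)
    then show ?thesis unfolding x(2) im by (simp add: has_field_derivative_def)
  qed
  moreover have "continuous_on T (\<lambda>y. inverse (f' (?g y)))"
  proof (rule continuous_on_inverse)
    show "continuous_on T (\<lambda>y. f' (?g y))"
      by (rule continuous_on_compose2[OF cont cg]) (use gS in blast)
    show "\<forall>y\<in>T. f' (?g y) \<noteq> 0"
    proof
      fix y assume "y \<in> T"
      then show "f' (?g y) \<noteq> 0" using pos[OF gS(1)] by force
    qed
  qed
  ultimately have "C1_on T ?g"
    unfolding C1_on_def by (intro exI[of _ "\<lambda>y. inverse (f' (?g y))"] conjI ballI)
  moreover have "C1_on ?S f"
    unfolding C1_on_def by (intro exI[of _ f'] conjI ballI deriv cont)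
  ultimately show ?thesis using sm bij by (simp add: increasing_diffeomorphism_def)
qed

section \<open>The gain for exponent 1: hemispheres\<close>

lemma integral_axial_weight_pos:
  assumes "0 \<le> x" "x < y" "y \<le> 1"
  shows "0 < integral {x..y} (axial_weight n)"
proof -
  let ?F = "\<lambda>u. integral {x..u} (axial_weight n)"
  have d: "(?F has_real_derivative axial_weight n u) (at u within {x..y})" if "u \<in> {x..y}" for u
    by (intro integral_has_real_derivative that continuous_intros)
  have "?F x < ?F y"
  proof (rule DERIV_pos_imp_increasing_open[OF assms(2)])
    fix u assume u: "x < u" "u < y"
    then have "at u within {x..y} = at u" by (intro at_within_interior) auto
    moreover have "0 < axial_weight n u" using u assms by (intro axial_weight_pos) auto
    ultimately show "\<exists>l. DERIV ?F u :> l \<and> 0 < l" using d[of u] u by auto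
  next
    show "continuous_on {x..y} ?F" by (rule DERIV_continuous_on[OF d])
  qed
  then show ?thesis by simp
qed

text \<open>The substitution \<open>t = mobius r s\<close> maps \<open>- 2 * r / (1 + r\<^sup>2)\<close> to \<open>0\<close>, which gives
  \<open>hemisphere_gain n r\<close> as the integral of \<open>sgn t\<close> against the kernel.\<close>

definition hemisphere_gain :: "nat \<Rightarrow> real \<Rightarrow> real" where
  "hemisphere_gain n r = 2 / Beta (1/2) ((real n - 1) / 2) * integral {0..2 * r / (1 + r\<^sup>2)} (axial_weight n)"

lemma double_angle_bounds:
  fixes r :: real
  assumes "0 \<le> r" "r < 1"
  shows "0 \<le> 2 * r / (1 + r\<^sup>2)" "2 * r / (1 + r\<^sup>2) < 1"
proof -
  have p: "0 < 1 + r\<^sup>2" by (simp add: add_pos_nonneg)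
  show "0 \<le> 2 * r / (1 + r\<^sup>2)" using assms p by simp
  have "0 < (1 - r)\<^sup>2" using assms by simp
  then show "2 * r / (1 + r\<^sup>2) < 1" using p by (simp add: power2_diff)
qed

lemma integrable_on_axial_weight: "axial_weight n integrable_on {a..b}"
  by (intro integrable_continuous_real continuous_intros)

lemma hemisphere_gain_eq:
  assumes n: "n \<ge> 3" and r: "0 \<le> r" "r < 1"
  shows "(\<integral>t. sgn t * axial_kernel (n - 1) r t \<partial>axial n) = hemisphere_gain n r"
proof -
  let ?B = "Beta (1/2) ((real n - 1) / 2)"
  let ?k = "axial_kernel (n - 1) r" and ?w = "axial_weight n"
  define \<theta> where "\<theta> = 2 * r / (1 + r\<^sup>2)"
  have \<theta>: "0 \<le> \<theta>" "\<theta> < 1" using double_angle_bounds[OF r] by (auto simp: \<theta>_def)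
  have r': "\<bar>r\<bar> < 1" using r by simp
  have "1 + r\<^sup>2 \<noteq> 0" by (metis add_nonneg_eq_0_iff zero_le_one zero_le_power2 zero_neq_one)
  then have m\<theta>: "mobius r (- \<theta>) = 0" by (simp add: mobius_def \<theta>_def)
  interpret interval_prob "axial n" by (rule interval_prob_axial[OF n])
  have k: "continuous_on A ?k" if "A \<subseteq> {-1..1}" for A
    using r' that by (intro continuous_intros) (auto simp: abs_le_iff)
  have "(\<integral>t. sgn t * ?k t \<partial>axial n) = (\<integral>t. indicator {0..1} t * ?k t - indicator {-1..0} t * ?k t \<partial>axial n)"
  proof (rule integral_cong_AE)
    show "AE t in axial n. sgn t * ?k t = indicator {0..1} t * ?k t - indicator {-1..0} t * ?k t"
      using AE_axial[of n] AE_space by eventually_elim (auto simp: sgn_if indicator_def)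
    show "(\<lambda>t. sgn t * ?k t) \<in> borel_measurable (axial n)"
    proof (rule borel_measurable_times)
      show "sgn \<in> borel_measurable (axial n)"
        by (simp add: measurable_cong_sets[OF sets_axial refl] measurable_restrict_space1)
    qed (rule measurable_continuous[OF k], simp)
    show "(\<lambda>t. indicator {0..1} t * ?k t - indicator {-1..0} t * ?k t) \<in> borel_measurable (axial n)"
      using integral_axial_indicator(1)[OF n _ _ k, of 0 1] integral_axial_indicator(1)[OF n _ _ k, of "-1" 0]
      by (intro borel_measurable_diff) (auto dest: borel_measurable_integrable)
  qed
  also have "\<dots> = (integral {0..1} (\<lambda>t. ?k t * ?w t) - integral {-1..0} (\<lambda>t. ?k t * ?w t)) / ?B"
    using integral_axial_indicator[OF n _ _ k, of 0 1] integral_axial_indicator[OF n _ _ k, of "-1" 0]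
    by (simp add: diff_divide_distrib)
  also have "integral {0..1} (\<lambda>t. ?k t * ?w t) = integral {- \<theta>..1} ?w"
    using integral_kernel_mobius[OF n r, of "- \<theta>" 1 "\<lambda>t. 1"] \<theta> m\<theta> r' by simp
  also have "integral {-1..0} (\<lambda>t. ?k t * ?w t) = integral {-1..- \<theta>} ?w"
    using integral_kernel_mobius[OF n r, of "-1" "- \<theta>" "\<lambda>t. 1"] \<theta> m\<theta> r' by simp
  \<comment> \<open>Evenness moves all pieces to the positive side; there the two integrals over
    \<open>{\<theta>..1}\<close> cancel and twice the integral over \<open>{0..\<theta>}\<close>
    remains.\<close>
  also have "integral {-1..- \<theta>} ?w = integral {\<theta>..1} ?w"
    using Henstock_Kurzweil_Integration.integral_reflect_real[of 1 \<theta> ?w] by simp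
  also have "integral {- \<theta>..1} ?w = integral {- \<theta>..0} ?w + integral {0..1} ?w"
    using \<theta> by (intro Henstock_Kurzweil_Integration.integral_combine[symmetric] integrable_on_axial_weight) auto
  also have "integral {- \<theta>..0} ?w = integral {0..\<theta>} ?w"
    using Henstock_Kurzweil_Integration.integral_reflect_real[of \<theta> 0 ?w] by simp
  also have "integral {0..1} ?w = integral {0..\<theta>} ?w + integral {\<theta>..1} ?w"
    using \<theta> by (intro Henstock_Kurzweil_Integration.integral_combine[symmetric] integrable_on_axial_weight) auto
  finally show ?thesis by (simp add: hemisphere_gain_def \<theta>_def)
qed

text \<open>The gain is a composition: \<open>W x\<close> is the axial probability of
  \<open>\<bar>t\<bar> \<le> x\<close>, and \<open>?\<theta>\<close> maps the radii increasingly
  onto \<open>{0..<1}\<close>. That the total mass is 1 makes the target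
  \<open>{0..<1}\<close>.\<close>

lemma hemisphere_gain_diffeomorphism:
  assumes n: "n \<ge> 3"
  shows "increasing_diffeomorphism (hemisphere_gain n) {0..<1} {0..<1}"
proof -
  let ?B = "Beta (1/2) ((real n - 1) / 2)" and ?w = "axial_weight n"
  define W where "W x = 2 / ?B * integral {0..x} ?w" for x
  have B: "?B > 0" by (rule axial_Beta_pos[OF n])
  have Wd: "(W has_real_derivative 2 / ?B * ?w x) (at x within {0..1})" if "x \<in> {0..1}" for x
    unfolding W_def[abs_def]
    by (intro DERIV_cmult integral_has_real_derivative that continuous_intros)
  have Wc: "continuous_on {0..1} W" by (rule DERIV_continuous_on[OF Wd])
  have W0: "W 0 = 0" by (simp add: W_def)
  have W1: "W 1 = 1"
  proof -
    interpret interval_prob "axial n" by (rule interval_prob_axial[OF n])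
    have "1 = integral {-1..1} ?w / ?B" using integral_axial[OF n, of "\<lambda>t. 1"] by simp
    also have "integral {-1..1} ?w = integral {-1..0} ?w + integral {0..1} ?w"
      by (intro Henstock_Kurzweil_Integration.integral_combine[symmetric] integrable_on_axial_weight) auto
    also have "integral {-1..0} ?w = integral {0..1} ?w"
      using Henstock_Kurzweil_Integration.integral_reflect_real[of 1 0 ?w] by simp
    finally show ?thesis by (simp add: W_def)
  qed
  have Wmono: "W x < W y" if "0 \<le> x" "x < y" "y \<le> 1" for x y
  proof -
    have "integral {0..x} ?w + integral {x..y} ?w = integral {0..y} ?w"
      using that by (intro Henstock_Kurzweil_Integration.integral_combine integrable_on_axial_weight) auto
    then show ?thesis
      unfolding W_def using integral_axial_weight_pos[OF that, of n] B by (intro mult_strict_left_mono) auto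
  qed
  let ?\<theta> = "\<lambda>r::real. 2 * r / (1 + r\<^sup>2)"
  have nz: "1 + r\<^sup>2 \<noteq> 0" for r :: real by (metis add_nonneg_eq_0_iff zero_le_one zero_le_power2 zero_neq_one)
  have \<theta>c: "continuous_on A ?\<theta>" for A using nz by (intro continuous_intros) auto
  have \<theta>S: "?\<theta> r \<in> {0..1}" if "r \<in> {0..<1}" for r using double_angle_bounds[of r] that by auto
  have hg: "hemisphere_gain n r = W (?\<theta> r)" for r by (simp add: hemisphere_gain_def W_def)
  show ?thesis
  proof (rule increasing_diffeomorphismI)
    fix r :: real assume r: "r \<in> {0..<1}"
    have "(?\<theta> has_real_derivative (2 * (1 - r\<^sup>2) / (1 + r\<^sup>2)\<^sup>2)) (at r within {0..<1})"
      using nz[of r] by (auto intro!: derivative_eq_intros simp: power2_eq_square field_simps)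
    \<comment> \<open>For negative \<open>x\<close> the integral over \<open>{0..x}\<close> is 0, so
      \<open>W\<close> is differentiable at 0 only from the right; the chain rule is therefore
      applied within the image of \<open>?\<theta>\<close>, which lies in
      \<open>{0..1}\<close>.\<close>
    moreover have "(W has_real_derivative 2 / ?B * ?w (?\<theta> r)) (at (?\<theta> r) within ?\<theta> ` {0..<1})"
      by (rule DERIV_subset[OF Wd]) (use \<theta>S r in auto)
    ultimately have "(W \<circ> ?\<theta> has_real_derivative
        (2 / ?B * ?w (?\<theta> r)) * (2 * (1 - r\<^sup>2) / (1 + r\<^sup>2)\<^sup>2)) (at r within {0..<1})"
      by (intro DERIV_image_chain)
    then show "(hemisphere_gain n has_real_derivative
        (2 / ?B * ?w (?\<theta> r)) * (2 * (1 - r\<^sup>2) / (1 + r\<^sup>2)\<^sup>2)) (at r within {0..<1})"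
      unfolding hg[abs_def] o_def .
    show "0 < (2 / ?B * ?w (?\<theta> r)) * (2 * (1 - r\<^sup>2) / (1 + r\<^sup>2)\<^sup>2)"
      using B r double_angle_bounds[of r] nz[of r]
      by (intro mult_pos_pos divide_pos_pos axial_weight_pos) (auto simp: abs_square_less_1)
  next
    show "continuous_on {0..<1} (\<lambda>r. (2 / ?B * ?w (?\<theta> r)) * (2 * (1 - r\<^sup>2) / (1 + r\<^sup>2)\<^sup>2))"
      using nz by (intro continuous_intros \<theta>c) auto
    show "hemisphere_gain n 0 = 0" by (simp add: hg W0)
    show "hemisphere_gain n ` {0..<1} \<subseteq> {0..<1}"
    proof safe
      fix r :: real assume r: "r \<in> {0..<1}"
      have "0 \<le> W x" if "0 \<le> x" "x < 1" for x
        using Wmono[of 0 x] W0 that by (cases "x = 0") auto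
      then have "0 \<le> W (?\<theta> r)" using double_angle_bounds[of r] r by simp
      moreover have "W (?\<theta> r) < 1"
        using Wmono[of "?\<theta> r" 1] W1 double_angle_bounds[of r] r by auto
      ultimately show "hemisphere_gain n r \<in> {0..<1}" by (simp add: hg)
    qed
    show "{0..<1} \<subseteq> {0::real..}" by auto
    fix y :: real assume y: "y \<in> {0..<1}"
    then obtain x where x: "0 \<le> x" "x \<le> 1" "W x = y"
      using IVT'[of W 0 y 1] W0 W1 Wc by auto
    then obtain r where r: "0 \<le> r" "r \<le> 1" "?\<theta> r = x"
      using IVT'[of ?\<theta> 0 x 1] \<theta>c by auto
    have "x \<noteq> 1" using x y W1 by auto
    then have "r \<noteq> 1" using r by auto
    then show "\<exists>r\<in>{0..<1}. y \<le> hemisphere_gain n r" using r x by (intro bexI[of _ r]) (auto simp: hg)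
  qed
qed

text \<open>For \<open>r \<ge> 0\<close> the kernel is monotone along the axis, so its uniformly
  nearest constant is the mean of the two polar values, at a distance of half the
  oscillation.\<close>

definition oscillation_gain :: "nat \<Rightarrow> real \<Rightarrow> real" where
  "oscillation_gain k r = (axial_kernel k r 1 - axial_kernel k r (- 1)) / 2"

lemma oscillation_gain_diffeomorphism:
  assumes k: "k > 0"
  shows "increasing_diffeomorphism (oscillation_gain k) {0..<1} {0..}"
proof -
  let ?f' = "\<lambda>r. real k / (1 - r\<^sup>2) * (axial_kernel k r 1 + axial_kernel k r (- 1))"
  have deriv: "(oscillation_gain k has_real_derivative ?f' r) (at r within {0..<1})" if r: "r \<in> {0..<1}" for r
  proof -
    have r': "\<bar>r\<bar> < 1" using r by auto
    have m: "mobius (- r) 1 = 1" "mobius (- r) (- 1) = - 1" using r' by auto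
    have one: "\<bar>1::real\<bar> \<le> 1" "\<bar>- 1::real\<bar> \<le> 1" by simp_all
    note D = DERIV_cdivide[OF DERIV_diff[OF axial_kernel_derivative[OF r' one(1), of k]
      axial_kernel_derivative[OF r' one(2), of k]], of 2, unfolded m, folded oscillation_gain_def]
    have "(2 * c / d * a * 1 - 2 * c / d * b * - 1) / 2 = c / d * (a + b)" for a b c d :: real
      by (cases "d = 0") (simp_all add: field_simps)
    from DERIV_cong[OF D this] have "(oscillation_gain k has_real_derivative ?f' r) (at r)" .
    then show ?thesis by (rule has_field_derivative_at_within)
  qed
  have pos: "0 < ?f' r" if "r \<in> {0..<1}" for r
    using that k by (intro mult_pos_pos divide_pos_pos add_pos_pos axial_kernel_pos) (auto simp: abs_square_less_1)
  have le: "axial_kernel k r (- 1) \<le> 1" "1 / (1 - r) \<le> axial_kernel k r 1" if r: "r \<in> {0..<1}" for r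
  proof -
    have p: "0 < 1 + r" "0 < 1 - r" using r by auto
    have "1 + r\<^sup>2 - 2 * r * (- 1) = (1 + r) * (1 + r)" "1 + r\<^sup>2 - 2 * r * 1 = (1 - r) * (1 - r)"
      "1 - r\<^sup>2 = (1 - r) * (1 + r)" by (simp_all add: power2_eq_square algebra_simps)
    then have b: "ball_ratio r (- 1) = (1 - r) / (1 + r)" "ball_ratio r 1 = (1 + r) / (1 - r)"
      using p by (simp_all add: ball_ratio_def)
    show "axial_kernel k r (- 1) \<le> 1"
      unfolding axial_kernel_def b using r p by (intro power_le_one) auto
    have "1 / (1 - r) \<le> (1 + r) / (1 - r)" using r by (intro divide_right_mono) auto
    also have "\<dots> \<le> ((1 + r) / (1 - r)) ^ k"
      using k r p self_le_power[of "(1 + r) / (1 - r)" k] by simp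
    finally show "1 / (1 - r) \<le> axial_kernel k r 1" unfolding axial_kernel_def b .
  qed
  show ?thesis
  proof (rule increasing_diffeomorphismI[OF deriv _ pos])
    show "continuous_on {0..<1} ?f'"
      by (intro continuous_intros) (auto simp: abs_square_eq_1)
    show "oscillation_gain k 0 = 0" by (simp add: oscillation_gain_def axial_kernel_def ball_ratio_def)
    show "oscillation_gain k ` {0..<1} \<subseteq> {0..}"
    proof (rule image_subsetI)
      fix r :: real assume r: "r \<in> {0..<1}"
      have "1 \<le> 1 / (1 - r)" using r by (simp add: field_simps)
      then show "oscillation_gain k r \<in> {0..}" using le[OF r] by (simp add: oscillation_gain_def)
    qed
    fix y :: real assume y: "y \<in> {0..}"
    \<comment> \<open>Solves \<open>1 / (1 - r) = 2 * y + 1\<close>: subtracting at most 1 for the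
      opposite pole and halving still leaves \<open>y\<close>.\<close>
    define r where "r = 1 - 1 / (2 * y + 1)"
    have r: "r \<in> {0..<1}" using y by (auto simp: r_def field_simps)
    have "1 / (1 - r) = 2 * y + 1" using y by (simp add: r_def)
    then have "y \<le> oscillation_gain k r" using le[OF r] by (simp add: oscillation_gain_def)
    then show "\<exists>r\<in>{0..<1}. y \<le> oscillation_gain k r" using r by blast
  qed auto
qed

lemma (in axial_prob) radial_gain_diffeomorphism:
  assumes q: "q > 1"
  shows "increasing_diffeomorphism (radial_gain q) {0..<1} {0..}"
proof (rule increasing_diffeomorphismI)
  show "(radial_gain q has_real_derivative slope_energy q r powr (1 / q - 1) * gain_numerator q r) (at r within {0..<1})"
    if "r \<in> {0..<1}" for r
    using that by (intro has_field_derivative_at_within[OF radial_gain_derivative] q) auto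
  show "continuous_on {0..<1} (\<lambda>r. slope_energy q r powr (1 / q - 1) * gain_numerator q r)"
    by (rule radial_gain_derivative_continuous[OF q])
  show "0 < slope_energy q r powr (1 / q - 1) * gain_numerator q r" if "r \<in> {0..<1}" for r
    using slope_energy_pos[OF q, of r] gain_numerator_pos[OF q, of r] that by auto
  show "radial_gain q 0 = 0" by (simp add: radial_gain_def)
  show "radial_gain q ` {0..<1} \<subseteq> {0..}" by (auto simp: radial_gain_def)
  show "\<exists>r\<in>{0..<1}. y \<le> radial_gain q r" for y by (rule radial_gain_unbounded[OF q])
qed auto

section \<open>Duality on the sphere\<close>

text \<open>In \<open>ennreal\<close> the reciprocal of infinity is 0, so a single equation covers
  the endpoint pairs; the split leads back to real exponents.\<close>

lemma conjugate_exponent_cases: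
  fixes p q :: ennreal
  assumes pq: "1 \<le> p" "1 \<le> q" "1 / p + 1 / q = 1"
  obtains (inf_one) "p = \<infinity>" "q = 1"
    | (one_inf) "p = 1" "q = \<infinity>"
    | (finite) p' q' where "p = ennreal p'" "q = ennreal q'" "p' > 1" "q' > 1" "1 / p' + 1 / q' = 1"
proof (cases p)
  case top
  then have "1 / q = 1" using pq by simp
  have "q \<noteq> \<top>" using \<open>1 / q = 1\<close> by auto
  then obtain q' where q': "q = ennreal q'" "q' \<ge> 0" by (cases q) auto
  then have "q' \<ge> 1" using pq by (simp flip: ennreal_1 add: ennreal_le_iff)
  then have "ennreal (1 / q') = ennreal 1" using \<open>1 / q = 1\<close> q' by (simp add: divide_ennreal[symmetric])
  then have "1 / q' = 1" using \<open>q' \<ge> 1\<close> by (subst (asm) ennreal_inj) auto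
  then have "q = 1" using q' by simp
  then show thesis using top by (intro inf_one) auto
next
  case (real p')
  then have p1: "p' \<ge> 1" using pq by (simp flip: ennreal_1 add: ennreal_le_iff)
  have ip: "1 / p = ennreal (1 / p')" using p1 real by (simp add: divide_ennreal[symmetric])
  show thesis
  proof (cases q)
    case top
    then have "ennreal (1 / p') = ennreal 1" using pq ip by simp
    then have "1 / p' = 1" using p1 by (subst (asm) ennreal_inj) auto
    then have "p = 1" using real by simp
    then show thesis using top by (intro one_inf) auto
  next
    case (real q')
    then have q1: "q' \<ge> 1" using pq by (simp flip: ennreal_1 add: ennreal_le_iff)
    have iq: "1 / q = ennreal (1 / q')" using q1 real by (simp add: divide_ennreal[symmetric])
    have "ennreal (1 / p' + 1 / q') = ennreal 1"
      using pq(3) p1 q1 unfolding ip iq by (simp flip: ennreal_plus)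
    then have s: "1 / p' + 1 / q' = 1" using p1 q1 by (subst (asm) ennreal_inj) auto
    have "p' \<noteq> 1" "q' \<noteq> 1" using s p1 q1 by auto
    then show thesis using s p1 q1 real \<open>p = ennreal p'\<close> by (intro finite[of p' q']) auto
  qed
qed

section \<open>Transfer of integrals from the sphere to the interval\<close>

lemma surface_measurable:
  fixes f :: "real ^ 'n \<Rightarrow> 'b::topological_space"
  assumes "f \<in> borel_measurable borel" shows "f \<in> borel_measurable \<sigma>"
  using assms by (simp add: measurable_cong_sets[OF sets_surface_measure refl] measurable_restrict_space1)

lemma inner_sphere_le:
  fixes \<zeta> b :: "real ^ 'n"
  assumes "norm \<zeta> = 1" "norm b = 1" shows "\<bar>\<zeta> \<bullet> b\<bar> \<le> 1"
  using Cauchy_Schwarz_ineq2[of \<zeta> b] assms by simp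

lemma inner_measurable_axial:
  fixes b :: "real ^ 'n"
  assumes b: "norm b = 1"
  shows "(\<lambda>\<zeta>. \<zeta> \<bullet> b) \<in> \<sigma> \<rightarrow>\<^sub>M restrict_space borel {-1..1}"
proof (rule measurable_restrict_space2)
  show "(\<lambda>\<zeta>. \<zeta> \<bullet> b) \<in> space \<sigma> \<rightarrow> {-1..1}"
    using inner_sphere_le[OF _ b] by (auto simp: abs_le_iff)
  show "(\<lambda>\<zeta>. \<zeta> \<bullet> b) \<in> borel_measurable \<sigma>" by (rule surface_measurable) simp
qed

lemma distr_surface_axial:
  fixes b :: "real ^ 'n::{finite,wellorder}"
  assumes n: "CARD('n) \<ge> 3" and b: "norm b = 1"
  shows "distr \<sigma> (restrict_space borel {-1..1}) (\<lambda>\<zeta>. \<zeta> \<bullet> b) = axial CARD('n)"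
proof (rule measure_eqI)
  fix A :: "real set" assume "A \<in> sets (distr \<sigma> (restrict_space borel {-1..1}) (\<lambda>\<zeta>. \<zeta> \<bullet> b))"
  then have A: "A \<subseteq> {-1..1}" "A \<in> sets borel" and A': "A \<in> sets (restrict_space borel {-1..1})"
    by (auto simp: sets_restrict_space_iff)
  have "emeasure (distr \<sigma> (restrict_space borel {-1..1}) (\<lambda>\<zeta>. \<zeta> \<bullet> b)) A = emeasure \<sigma> ((\<lambda>\<zeta>. \<zeta> \<bullet> b) -` A \<inter> space \<sigma>)"
    by (rule emeasure_distr[OF inner_measurable_axial[OF b] A'])
  also have "\<dots> = emeasure (distr \<sigma> borel (\<lambda>\<zeta>. \<zeta> \<bullet> b)) A"
    using A by (intro emeasure_distr[symmetric] surface_measurable) auto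
  also have "\<dots> = emeasure (axial_real CARD('n)) A" by (simp add: distr_surface_inner[OF n b])
  also have "\<dots> = emeasure (axial CARD('n)) A"
    unfolding axial_def using A by (intro emeasure_restrict_space[symmetric]) (auto simp: axial_real_def)
  finally show "emeasure (distr \<sigma> (restrict_space borel {-1..1}) (\<lambda>\<zeta>. \<zeta> \<bullet> b)) A = emeasure (axial CARD('n)) A" .
qed (simp add: sets_axial)

lemma integral_surface_axial:
  fixes b :: "real ^ 'n::{finite,wellorder}" and h :: "real \<Rightarrow> real"
  assumes n: "CARD('n) \<ge> 3" and b: "norm b = 1" and h: "h \<in> borel_measurable (axial CARD('n))"
  shows "(\<integral>\<zeta>. h (\<zeta> \<bullet> b) \<partial>\<sigma>) = (\<integral>t. h t \<partial>axial CARD('n))"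
    and "integrable \<sigma> (\<lambda>\<zeta>. h (\<zeta> \<bullet> b)) \<longleftrightarrow> integrable (axial CARD('n)) h"
    and "(\<lambda>\<zeta>. h (\<zeta> \<bullet> b)) \<in> borel_measurable \<sigma>"
proof -
  have h': "h \<in> borel_measurable (restrict_space borel {-1..1})"
    using h by (simp add: measurable_cong_sets[OF sets_axial refl])
  note m = inner_measurable_axial[OF b]
  show "(\<integral>\<zeta>. h (\<zeta> \<bullet> b) \<partial>\<sigma>) = (\<integral>t. h t \<partial>axial CARD('n))"
    unfolding distr_surface_axial[OF n b, symmetric] by (rule integral_distr[OF m h', symmetric])
  show "integrable \<sigma> (\<lambda>\<zeta>. h (\<zeta> \<bullet> b)) \<longleftrightarrow> integrable (axial CARD('n)) h"
    unfolding distr_surface_axial[OF n b, symmetric] by (rule integrable_distr_eq[OF m h', symmetric])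
  show "(\<lambda>\<zeta>. h (\<zeta> \<bullet> b)) \<in> borel_measurable \<sigma>"
    by (rule measurable_compose[OF m h'])
qed

lemma poisson_kernel_axial:
  fixes b \<zeta> :: "real ^ 'n"
  assumes b: "norm b = 1" and z: "norm \<zeta> = 1"
  shows "P\<^sub>h (r *\<^sub>R b) \<zeta> = axial_kernel (CARD('n) - 1) r (\<zeta> \<bullet> b)"
proof -
  have "(norm (r *\<^sub>R b - \<zeta>))\<^sup>2 = 1 + r\<^sup>2 - 2 * r * (\<zeta> \<bullet> b)"
    using b z by (simp add: power2_norm_eq_inner inner_diff_left inner_diff_right norm_eq_1 inner_commute)
      (simp add: power2_eq_square)
  then show ?thesis using b by (simp add: poisson_kernel_def axial_kernel_def ball_ratio_def power_mult_distrib)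
qed

definition interval_norm :: "nat \<Rightarrow> ennreal \<Rightarrow> (real \<Rightarrow> real) \<Rightarrow> real" where
  "interval_norm n q h =
     (if q = \<infinity> then SUP t\<in>{-1..1}. \<bar>h t\<bar>
      else (\<integral>t. \<bar>h t\<bar> powr enn2real q \<partial>axial n) powr (1 / enn2real q))"

text \<open>The measure is finite; for finite \<open>p\<close> the bound
  \<open>norm v \<le> 1 + norm v powr p\<close> suffices.\<close>

lemma in_Lp_integrable:
  fixes \<phi> :: "real ^ 'n \<Rightarrow> real ^ 'm"
  assumes p: "1 \<le> p" and \<phi>: "in_Lp p \<phi>"
  shows "integrable \<sigma> \<phi>"
proof -
  interpret prob_space "\<sigma> :: (real ^ 'n) measure" by (rule prob_space_surface_measure)
  have m: "\<phi> \<in> borel_measurable \<sigma>" using \<phi> by (simp add: in_Lp_def)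
  show ?thesis
  proof (cases "p = \<infinity>")
    case True
    then have fin: "esssup \<sigma> (\<lambda>\<zeta>. ereal (norm (\<phi> \<zeta>))) < \<infinity>" using \<phi> by (simp add: in_Lp_def)
    then obtain B where "esssup \<sigma> (\<lambda>\<zeta>. ereal (norm (\<phi> \<zeta>))) \<le> ereal B"
      by (cases "esssup \<sigma> (\<lambda>\<zeta>. ereal (norm (\<phi> \<zeta>)))") auto
    then have "AE \<zeta> in \<sigma>. norm (\<phi> \<zeta>) \<le> B"
      using esssup_AE[of "\<lambda>\<zeta>. ereal (norm (\<phi> \<zeta>))" \<sigma>] by (auto elim!: eventually_mono dest: order_trans)
    then show ?thesis using m by (intro integrable_const_bound[of _ B])
  next
    case False
    then obtain p' where p': "p = ennreal p'" "p' \<ge> 1"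
      using p by (cases p) (auto simp flip: ennreal_1 simp: ennreal_le_iff)
    then have int: "integrable \<sigma> (\<lambda>\<zeta>. norm (\<phi> \<zeta>) powr p')" using \<phi> False by (simp add: in_Lp_def)
    show ?thesis
    proof (rule Bochner_Integration.integrable_bound)
      show "integrable \<sigma> (\<lambda>\<zeta>. 1 + norm (\<phi> \<zeta>) powr p')" using int by simp
      have "norm v \<le> 1 + norm v powr p'" for v :: "real ^ 'm"
      proof (cases "norm v \<le> 1")
        case True
        then show ?thesis by (simp add: add_increasing2)
      next
        case False
        then have "norm v powr 1 \<le> norm v powr p'" using p' by (intro powr_mono) auto
        then show ?thesis using False by simp
      qed
      then show "AE \<zeta> in \<sigma>. norm (\<phi> \<zeta>) \<le> norm (1 + norm (\<phi> \<zeta>) powr p')" by (auto simp: abs_of_nonneg)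
    qed (rule m)
  qed
qed

lemma integrable_axial_scaleR:
  fixes b :: "real ^ 'n::{finite,wellorder}" and \<phi> :: "real ^ 'n::_ \<Rightarrow> real ^ 'm"
  assumes n: "CARD('n) \<ge> 3" and b: "norm b = 1" and h: "continuous_on {-1..1} h"
    and \<phi>: "integrable \<sigma> \<phi>"
  shows "integrable \<sigma> (\<lambda>\<zeta>. h (\<zeta> \<bullet> b) *\<^sub>R \<phi> \<zeta>)"
proof -
  interpret A: interval_prob "axial CARD('n)" by (rule interval_prob_axial[OF n])
  obtain B where B: "\<And>t. t \<in> {-1..1} \<Longrightarrow> \<bar>h t\<bar> \<le> B" using A.continuous_bounded[OF h] by blast
  show ?thesis
  proof (rule Bochner_Integration.integrable_bound)
    show "integrable \<sigma> (\<lambda>\<zeta>. B *\<^sub>R \<phi> \<zeta>)" using \<phi> by simp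
    show "(\<lambda>\<zeta>. h (\<zeta> \<bullet> b) *\<^sub>R \<phi> \<zeta>) \<in> borel_measurable \<sigma>"
      using \<phi> integral_surface_axial(3)[OF n b A.measurable_continuous[OF h]] by auto
    show "AE \<zeta> in \<sigma>. norm (h (\<zeta> \<bullet> b) *\<^sub>R \<phi> \<zeta>) \<le> norm (B *\<^sub>R \<phi> \<zeta>)"
    proof (rule AE_I2)
      fix \<zeta> :: "real ^ 'n::_" assume "\<zeta> \<in> space \<sigma>"
      then have "\<bar>h (\<zeta> \<bullet> b)\<bar> \<le> \<bar>B\<bar>"
        using B[of "\<zeta> \<bullet> b"] inner_sphere_le[OF _ b, of \<zeta>] by (force simp: abs_le_iff)
      then show "norm (h (\<zeta> \<bullet> b) *\<^sub>R \<phi> \<zeta>) \<le> norm (B *\<^sub>R \<phi> \<zeta>)" by (simp add: mult_right_mono)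
    qed
  qed
qed

text \<open>Moving the norm inside the integral reduces to Hoelder's inequality for the scalar
  function \<open>norm (\<phi> \<zeta>)\<close>, so vector values cost no extra constant.\<close>

lemma pairing_le:
  fixes b :: "real ^ 'n::{finite,wellorder}" and \<phi> :: "real ^ 'n::_ \<Rightarrow> real ^ 'm"
  assumes n: "CARD('n) \<ge> 3" and pq: "1 \<le> p" "1 \<le> q" "1 / p + 1 / q = 1"
    and b: "norm b = 1" and h: "continuous_on {-1..1} h" and \<phi>: "in_Lp p \<phi>"
  shows "norm (\<integral>\<zeta>. h (\<zeta> \<bullet> b) *\<^sub>R \<phi> \<zeta> \<partial>\<sigma>) \<le> interval_norm CARD('n) q h * Lp_norm p \<phi>"
proof -
  interpret prob_space "\<sigma> :: (real ^ 'n::_) measure" by (rule prob_space_surface_measure)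
  interpret A: interval_prob "axial CARD('n)" by (rule interval_prob_axial[OF n])
  have m[measurable]: "\<phi> \<in> borel_measurable \<sigma>" using \<phi> by (simp add: in_Lp_def)
  have int: "integrable \<sigma> \<phi>" by (rule in_Lp_integrable[OF pq(1) \<phi>])
  then have nint: "integrable \<sigma> (\<lambda>\<zeta>. norm (\<phi> \<zeta>))" by simp
  note hm[measurable] = integral_surface_axial(3)[OF n b A.measurable_continuous[OF h]]
  have habs: "continuous_on {-1..1} (\<lambda>t. \<bar>h t\<bar>)" using h by (intro continuous_intros)
  have hint: "integrable \<sigma> (\<lambda>\<zeta>. \<bar>h (\<zeta> \<bullet> b)\<bar>)"
    using integral_surface_axial(2)[OF n b A.measurable_continuous[OF habs]] A.integrable_continuous[OF habs] by simp
  have pint: "integrable \<sigma> (\<lambda>\<zeta>. \<bar>h (\<zeta> \<bullet> b)\<bar> * norm (\<phi> \<zeta>))"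
    using integrable_norm[OF integrable_axial_scaleR[OF n b h int]] by simp
  have "norm (\<integral>\<zeta>. h (\<zeta> \<bullet> b) *\<^sub>R \<phi> \<zeta> \<partial>\<sigma>) \<le> (\<integral>\<zeta>. norm (h (\<zeta> \<bullet> b) *\<^sub>R \<phi> \<zeta>) \<partial>\<sigma>)"
    by (rule integral_norm_bound)
  also have "\<dots> = (\<integral>\<zeta>. \<bar>h (\<zeta> \<bullet> b)\<bar> * norm (\<phi> \<zeta>) \<partial>\<sigma>)" by simp
  also have "\<dots> \<le> interval_norm CARD('n) q h * Lp_norm p \<phi>"
    using pq
  proof (cases rule: conjugate_exponent_cases)
    case inf_one
    let ?S = "esssup \<sigma> (\<lambda>\<zeta>. ereal (norm (\<phi> \<zeta>)))"
    have "?S < \<infinity>" using \<phi> inf_one by (simp add: in_Lp_def)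
    \<comment> \<open>\<open>in_Lp\<close> bounds the essential supremum from above only; with a
      lower bound it is a real number and \<open>real_of_ereal\<close> returns its true
      value.\<close>
    moreover have "0 \<le> ?S"
    proof -
      have "esssup \<sigma> (\<lambda>\<zeta>::real ^ 'n::_. 0) \<le> ?S" by (rule esssup_mono) auto
      then show ?thesis by (subst (asm) esssup_const) (use emeasure_space_1 in auto)
    qed
    ultimately obtain B where B: "?S = ereal B" by (cases ?S) auto
    then have LB: "Lp_norm p \<phi> = B" using inf_one by (simp add: Lp_norm_def)
    have "AE \<zeta> in \<sigma>. norm (\<phi> \<zeta>) \<le> B"
      using esssup_AE[of "\<lambda>\<zeta>. ereal (norm (\<phi> \<zeta>))" \<sigma>] B by simp
    then have "(\<integral>\<zeta>. \<bar>h (\<zeta> \<bullet> b)\<bar> * norm (\<phi> \<zeta>) \<partial>\<sigma>) \<le> (\<integral>\<zeta>. \<bar>h (\<zeta> \<bullet> b)\<bar> * B \<partial>\<sigma>)"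
      using pint hint by (intro integral_mono_AE) (auto elim!: eventually_mono intro: mult_left_mono)
    also have "\<dots> = interval_norm CARD('n) q h * B"
      using integral_surface_axial(1)[OF n b A.measurable_continuous[OF habs]] inf_one
      by (simp add: interval_norm_def)
    finally show ?thesis unfolding LB .
  next
    case one_inf
    let ?S = "SUP t\<in>{-1..1}. \<bar>h t\<bar>"
    have bdd: "bdd_above ((\<lambda>t. \<bar>h t\<bar>) ` {-1..1})"
      using habs by (intro bounded_imp_bdd_above compact_imp_bounded compact_continuous_image) auto
    have "(\<integral>\<zeta>. \<bar>h (\<zeta> \<bullet> b)\<bar> * norm (\<phi> \<zeta>) \<partial>\<sigma>) \<le> (\<integral>\<zeta>. ?S * norm (\<phi> \<zeta>) \<partial>\<sigma>)"
    proof (rule integral_mono)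
      fix \<zeta> :: "real ^ 'n::_" assume "\<zeta> \<in> space \<sigma>"
      then have "\<bar>h (\<zeta> \<bullet> b)\<bar> \<le> ?S"
        using inner_sphere_le[OF _ b, of \<zeta>] by (intro cSUP_upper bdd) (auto simp: abs_le_iff)
      then show "\<bar>h (\<zeta> \<bullet> b)\<bar> * norm (\<phi> \<zeta>) \<le> ?S * norm (\<phi> \<zeta>)" by (intro mult_right_mono) auto
    qed (use pint nint in auto)
    also have "\<dots> = interval_norm CARD('n) q h * Lp_norm p \<phi>"
      using one_inf by (simp add: interval_norm_def Lp_norm_def)
    finally show ?thesis .
  next
    case (finite p' q')
    have hq: "continuous_on {-1..1} (\<lambda>t. \<bar>h t\<bar> powr q')" using h finite by (intro continuous_intros) auto
    have q1: "integrable \<sigma> (\<lambda>\<zeta>. \<bar>h (\<zeta> \<bullet> b)\<bar> powr q')"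
      using integral_surface_axial(2)[OF n b A.measurable_continuous[OF hq]] A.integrable_continuous[OF hq] by simp
    have p1: "integrable \<sigma> (\<lambda>\<zeta>. \<bar>norm (\<phi> \<zeta>)\<bar> powr p')"
      using \<phi> finite by (simp add: in_Lp_def)
    have "(\<integral>\<zeta>. \<bar>h (\<zeta> \<bullet> b) * norm (\<phi> \<zeta>)\<bar> \<partial>\<sigma>) \<le>
       (\<integral>\<zeta>. \<bar>h (\<zeta> \<bullet> b)\<bar> powr q' \<partial>\<sigma>) powr (1 / q') * (\<integral>\<zeta>. \<bar>norm (\<phi> \<zeta>)\<bar> powr p' \<partial>\<sigma>) powr (1 / p')"
      using finite by (intro Holder_inequality(2) q1 p1) auto
    then show ?thesis
      using finite integral_surface_axial(1)[OF n b A.measurable_continuous[OF hq]]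
      by (simp add: interval_norm_def Lp_norm_def abs_mult)
  qed
  finally show ?thesis .
qed

section \<open>Evaluation of the best constant\<close>

lemma inner_e\<^sub>n: "\<zeta> \<bullet> e\<^sub>n = \<zeta> $ Max UNIV"
  by (simp add: e\<^sub>n_def inner_axis)

lemma norm_e\<^sub>n [simp]: "norm (e\<^sub>n :: real ^ 'n::{finite,wellorder}) = 1"
  by (simp add: e\<^sub>n_def norm_axis_1)

lemma inner_e\<^sub>n_image_sphere:
  assumes n: "CARD('n::{finite,wellorder}) \<ge> 3"
  shows "(\<lambda>\<zeta> :: real ^ 'n::_. \<zeta> \<bullet> e\<^sub>n) ` sphere 0 1 = {-1..1}"
proof (intro equalityI subsetI)
  fix t assume "t \<in> (\<lambda>\<zeta> :: real ^ 'n::_. \<zeta> \<bullet> e\<^sub>n) ` sphere 0 1"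
  then obtain \<zeta> :: "real ^ 'n::_" where "norm \<zeta> = 1" "t = \<zeta> \<bullet> e\<^sub>n" by auto
  then show "t \<in> {-1..1}" using inner_sphere_le[of \<zeta> e\<^sub>n] by (simp add: abs_le_iff)
next
  fix t :: real assume t: "t \<in> {-1..1}"
  let ?m = "Max UNIV :: 'n"
  have "\<exists>j. j \<noteq> ?m"
  proof (rule ccontr)
    assume "\<not> ?thesis"
    then have "UNIV = {?m}" by auto
    then have "CARD('n) = card {?m}" by (rule arg_cong)
    then show False using n by simp
  qed
  then obtain j where j: "j \<noteq> ?m" by blast
  let ?z = "t *\<^sub>R axis ?m 1 + sqrt (1 - t\<^sup>2) *\<^sub>R axis j 1 :: real ^ 'n::_"
  have t2: "t\<^sup>2 \<le> 1" using t by (auto simp: abs_square_le_1)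
  have "?z \<bullet> ?z = t * t + sqrt (1 - t\<^sup>2) * sqrt (1 - t\<^sup>2)"
    using j by (simp add: inner_add_left inner_add_right inner_axis_axis)
  also have "\<dots> = 1" using t2 by (simp add: power2_eq_square)
  finally have "norm ?z = 1" by (simp add: norm_eq_1)
  moreover have "?z \<bullet> e\<^sub>n = t" using j by (simp add: e\<^sub>n_def inner_add_left inner_axis_axis)
  ultimately show "t \<in> (\<lambda>\<zeta> :: real ^ 'n::_. \<zeta> \<bullet> e\<^sub>n) ` sphere 0 1"
    by (intro image_eqI[of _ _ ?z]) auto
qed

lemma G_eq_interval_norm:
  assumes n: "CARD('n::{finite,wellorder}) \<ge> 3" and q: "1 \<le> q" and r: "0 \<le> r" "r < 1"
  shows "G TYPE('n) q r =
    (INF a\<in>{0..}. interval_norm CARD('n) q (\<lambda>t. axial_kernel (CARD('n) - 1) r t - a))"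
proof -
  interpret A: axial_prob "axial CARD('n)" "CARD('n) - 1" by (rule axial_prob_axial[OF n])
  let ?k = "axial_kernel (CARD('n) - 1) r"
  have r': "\<bar>r\<bar> < 1" using r by simp
  have pk: "P\<^sub>h (r *\<^sub>R e\<^sub>n) \<zeta> = ?k (\<zeta> \<bullet> e\<^sub>n)" if "\<zeta> \<in> sphere 0 1" for \<zeta> :: "real ^ 'n::_"
    using that by (intro poisson_kernel_axial) auto
  show ?thesis
  proof (cases "q = \<infinity>")
    case True
    have "(SUP \<eta>\<in>sphere 0 1. \<bar>P\<^sub>h (r *\<^sub>R e\<^sub>n :: real ^ 'n::_) \<eta> - a\<bar>) = (SUP t\<in>{-1..1}. \<bar>?k t - a\<bar>)" for a
    proof -
      have "(\<lambda>\<eta> :: real ^ 'n::_. \<bar>P\<^sub>h (r *\<^sub>R e\<^sub>n) \<eta> - a\<bar>) ` sphere 0 1 = (\<lambda>\<eta> :: real ^ 'n::_. \<bar>?k (\<eta> \<bullet> e\<^sub>n) - a\<bar>) ` sphere 0 1"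
        by (intro image_cong) (auto simp: pk)
      also have "\<dots> = (\<lambda>t. \<bar>?k t - a\<bar>) ` {-1..1}"
        unfolding inner_e\<^sub>n_image_sphere[OF n, symmetric] image_image ..
      finally show ?thesis by simp
    qed
    then show ?thesis using True by (simp add: G_def interval_norm_def)
  next
    case False
    then have q': "enn2real q > 0" using q by (cases q) (auto simp flip: ennreal_1 simp: ennreal_le_iff)
    have "(\<integral>\<eta>. \<bar>P\<^sub>h (r *\<^sub>R e\<^sub>n :: real ^ 'n::_) \<eta> - a\<bar> powr enn2real q \<partial>\<sigma>) =
        (\<integral>t. \<bar>?k t - a\<bar> powr enn2real q \<partial>axial CARD('n))" for a
    proof -
      have "continuous_on {-1..1} (\<lambda>t. \<bar>?k t - a\<bar> powr enn2real q)"
        using r' q' by (intro continuous_intros A.continuous_axial_kernel) auto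
      then have "(\<integral>\<eta>. \<bar>?k (\<eta> \<bullet> (e\<^sub>n :: real ^ 'n::_)) - a\<bar> powr enn2real q \<partial>\<sigma>) =
        (\<integral>t. \<bar>?k t - a\<bar> powr enn2real q \<partial>axial CARD('n))"
        by (intro integral_surface_axial(1)[OF n] A.measurable_continuous) auto
      then show ?thesis
        by (subst (asm) Bochner_Integration.integral_cong[OF refl]) (auto simp: pk)
    qed
    then show ?thesis using False by (simp add: G_def interval_norm_def)
  qed
qed

text \<open>The value of the infimum in each regime. The endpoint exponents are separate because the
  envelope argument requires 1 < q < infinity.\<close>

definition gain :: "nat \<Rightarrow> ennreal \<Rightarrow> real \<Rightarrow> real" where
  "gain n q r =
     (if q = \<infinity> then oscillation_gain (n - 1) r
      else if q = 1 then hemisphere_gain n r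
      else axial_prob.radial_gain (axial n) (n - 1) (enn2real q) r)"

text \<open>The optimality condition for approximating a continuous function by constants in \<open>L\<^sup>q\<close>;
  for \<open>q = \<infinity>\<close> it is stated for monotone functions.\<close>

definition balanced :: "nat \<Rightarrow> ennreal \<Rightarrow> (real \<Rightarrow> real) \<Rightarrow> bool" where
  "balanced n q h \<longleftrightarrow>
     (if q = \<infinity> then h 1 + h (- 1) = 0
      else (\<integral>t. signed_power (enn2real q) (h t) \<partial>axial n) = 0)"

lemma signed_power_1 [simp]: "signed_power 1 y = sgn y"
  by (auto simp: signed_power_def sgn_if)

lemma integral_axial_sgn:
  assumes n: "n \<ge> 3" shows "(\<integral>t. sgn t \<partial>axial n) = 0"
  using hemisphere_gain_eq[OF n, of 0] by (simp add: axial_kernel_def ball_ratio_def hemisphere_gain_def)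

text \<open>A single constant serves both directions: being optimal it gives the upper bound, being
  balanced it makes the extremal field admissible. It is the midrange of the kernel for
  \<open>q = \<infinity>\<close>, a median for \<open>q = 1\<close>, and the zero of the
  signed-power integral in between. It competes with all real \<open>a'\<close>, and
  \<open>a \<ge> 0\<close> places it within the range of the infimum.\<close>

lemma gain_optimal:
  assumes n: "n \<ge> 3" and q: "1 \<le> q" and r: "0 \<le> r" "r < 1"
  obtains a where "a \<ge> 0" "balanced n q (\<lambda>t. axial_kernel (n - 1) r t - a)"
    "interval_norm n q (\<lambda>t. axial_kernel (n - 1) r t - a) = gain n q r"
    "\<And>a'. gain n q r \<le> interval_norm n q (\<lambda>t. axial_kernel (n - 1) r t - a')"
proof -
  interpret A: axial_prob "axial n" "n - 1" by (rule axial_prob_axial[OF n])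
  let ?k = "axial_kernel (n - 1) r"
  have r': "\<bar>r\<bar> < 1" using r by simp
  have kc: "continuous_on {-1..1} ?k" by (rule A.continuous_axial_kernel[OF r'])
  have kmono: "?k s \<le> ?k t" if "s \<in> {-1..1}" "t \<in> {-1..1}" "s \<le> t" for s t
  proof (cases "r = 0 \<or> s = t")
    case True
    then show ?thesis by (auto simp: axial_kernel_def ball_ratio_def)
  next
    case False
    then show ?thesis using axial_kernel_strict_mono[of r s t "n - 1"] r that A.k_pos by (auto simp: abs_le_iff)
  qed
  have kpos: "0 < ?k t" if "t \<in> {-1..1}" for t using that r' by (intro axial_kernel_pos) auto
  have minimal: "(\<integral>t. \<bar>?k t - a\<bar> powr q' \<partial>axial n) powr (1 / q') \<le> (\<integral>t. \<bar>?k t - a'\<bar> powr q' \<partial>axial n) powr (1 / q')"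
    if "q' \<ge> 1" "(\<lambda>t. signed_power q' (?k t - a)) \<in> borel_measurable (axial n)"
      "(\<integral>t. signed_power q' (?k t - a) \<partial>axial n) = 0" for q' a a'
    using A.center_minimal[OF that(1) kc that(2,3)] that(1) by (intro powr_mono2) auto
  show thesis
  proof (cases "q = \<infinity>")
    case True
    define a where "a = (?k 1 + ?k (- 1)) / 2"
    have bdd: "bdd_above ((\<lambda>t. \<bar>?k t - a'\<bar>) ` {-1..1})" for a'
      by (intro bounded_imp_bdd_above compact_imp_bounded compact_continuous_image compact_Icc
        continuous_on_rabs continuous_on_diff kc continuous_on_const)
    have low: "oscillation_gain (n - 1) r \<le> (SUP t\<in>{-1..1}. \<bar>?k t - a'\<bar>)" for a'
    proof -
      have "\<bar>?k 1 - a'\<bar> \<le> (SUP t\<in>{-1..1}. \<bar>?k t - a'\<bar>)" "\<bar>?k (- 1) - a'\<bar> \<le> (SUP t\<in>{-1..1}. \<bar>?k t - a'\<bar>)"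
        by (rule cSUP_upper[OF _ bdd], simp)+
      then show ?thesis by (simp add: oscillation_gain_def abs_le_iff)
    qed
    have up: "(SUP t\<in>{-1..1}. \<bar>?k t - a\<bar>) \<le> oscillation_gain (n - 1) r"
    proof (rule cSUP_least)
      fix t :: real assume "t \<in> {-1..1}"
      then have "?k (- 1) \<le> ?k t" "?k t \<le> ?k 1" using kmono[of "-1" t] kmono[of t 1] by auto
      moreover have "\<bar>x - (v + u) / 2\<bar> \<le> (v - u) / 2" if "u \<le> x" "x \<le> v" for u v x :: real
        unfolding abs_le_iff using that by (simp add: field_simps)
      ultimately show "\<bar>?k t - a\<bar> \<le> oscillation_gain (n - 1) r"
        unfolding oscillation_gain_def a_def by blast
    qed simp
    show thesis
    proof
      show "a \<ge> 0" using kpos[of 1] kpos[of "-1"] by (simp add: a_def)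
    qed (use True low low[of a] up in \<open>auto simp: balanced_def interval_norm_def gain_def a_def field_simps\<close>)
  next
    case False
    then obtain q' where q': "q = ennreal q'" "q' \<ge> 1"
      using q by (cases q) (auto simp flip: ennreal_1 simp: ennreal_le_iff)
    show thesis
    proof (cases "q' = 1")
      case True
      then have q1: "q = 1" using q' by simp
      \<comment> \<open>A median: the kernel increases with \<open>t\<close> and the law of
        \<open>t\<close> is symmetric, so the value on the equator splits the mass evenly.\<close>
      define a where "a = ?k 0"
      have sgnm: "sgn \<in> borel_measurable (axial n)"
        by (simp add: measurable_cong_sets[OF sets_axial refl] measurable_restrict_space1)
      \<comment> \<open>At \<open>r = 0\<close> the kernel is constant, and the sign vanishes
        identically instead of following \<open>t\<close>.\<close>
      have sg: "sgn (?k t - a) = (if r = 0 then 0 else sgn t)" if "t \<in> {-1..1}" for t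
      proof (cases "r = 0")
        case True
        then show ?thesis by (simp add: a_def axial_kernel_def ball_ratio_def)
      next
        case False
        then have "0 < r" using r by simp
        then show ?thesis
          using axial_kernel_strict_mono[of r 0 t "n - 1"] axial_kernel_strict_mono[of r t 0 "n - 1"] r that A.k_pos
          by (cases t "0::real" rule: linorder_cases) (auto simp: a_def abs_le_iff)
      qed
      have zero: "(\<integral>t. sgn (?k t - a) \<partial>axial n) = 0"
      proof -
        have "(\<integral>t. sgn (?k t - a) \<partial>axial n) = (\<integral>t. (if r = 0 then 0 else sgn t) \<partial>axial n)"
          by (intro Bochner_Integration.integral_cong refl sg) (simp add: space_axial)
        then show ?thesis by (cases "r = 0") (simp_all add: integral_axial_sgn[OF n])
      qed
      have m: "(\<lambda>t. signed_power 1 (?k t - a)) \<in> borel_measurable (axial n)"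
      proof -
        have "(\<lambda>t. ?k t - a) \<in> borel_measurable (axial n)"
          by (intro A.measurable_continuous continuous_on_diff kc continuous_on_const)
        then show ?thesis by simp
      qed
      have val: "(\<integral>t. \<bar>?k t - a\<bar> \<partial>axial n) = hemisphere_gain n r"
      proof (cases "r = 0")
        case True
        then show ?thesis by (simp add: a_def axial_kernel_def ball_ratio_def hemisphere_gain_def)
      next
        case False
        have int: "integrable (axial n) (\<lambda>t. sgn t * ?k t)" "integrable (axial n) (\<lambda>t. a * sgn t)"
        proof -
          obtain B where B: "\<And>t. t \<in> {-1..1} \<Longrightarrow> \<bar>?k t\<bar> \<le> B" using A.continuous_bounded[OF kc] by blast
          show "integrable (axial n) (\<lambda>t. sgn t * ?k t)"
          proof (rule A.integrable_const_bound[of _ B])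
            show "AE t in axial n. norm (sgn t * ?k t) \<le> B"
            proof (rule AE_I2)
              fix t assume "t \<in> space (axial n)"
              then have "\<bar>?k t\<bar> \<le> B" using B[of t] by (simp add: space_axial)
              moreover have "norm (sgn t * ?k t) \<le> \<bar>?k t\<bar>" by (simp add: abs_mult sgn_if)
              ultimately show "norm (sgn t * ?k t) \<le> B" by (rule order_trans[rotated])
            qed
          qed (intro borel_measurable_times sgnm A.measurable_continuous kc)
          show "integrable (axial n) (\<lambda>t. a * sgn t)"
            using sgnm by (intro integrable_mult_right A.integrable_const_bound[of _ 1] AE_I2) (simp_all add: abs_sgn_eq)
        qed
        have "(\<integral>t. \<bar>?k t - a\<bar> \<partial>axial n) = (\<integral>t. sgn t * ?k t - a * sgn t \<partial>axial n)"
        proof (intro Bochner_Integration.integral_cong refl)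
          fix t assume "t \<in> space (axial n)"
          then have "sgn (?k t - a) = sgn t" using sg False by (simp add: space_axial)
          then show "\<bar>?k t - a\<bar> = sgn t * ?k t - a * sgn t"
            using abs_sgn[of "?k t - a"] by (simp add: algebra_simps)
        qed
        also have "\<dots> = hemisphere_gain n r"
          using int hemisphere_gain_eq[OF n r] integral_axial_sgn[OF n] by simp
        finally show ?thesis .
      qed
      show thesis
      proof
        show "a \<ge> 0" using kpos[of 0] by (simp add: a_def)
        show "balanced n q (\<lambda>t. ?k t - a)" using zero by (simp add: balanced_def q1)
        show v: "interval_norm n q (\<lambda>t. ?k t - a) = gain n q r"
        proof -
          have "0 \<le> hemisphere_gain n r" unfolding val[symmetric] by simp
          then show ?thesis using val by (simp add: interval_norm_def q1 gain_def)
        qed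
        show "gain n q r \<le> interval_norm n q (\<lambda>t. ?k t - a')" for a'
          using minimal[of 1 a a'] m zero unfolding v[symmetric] by (simp add: interval_norm_def q1)
      qed
    next
      case False
      then have q1: "q' > 1" using q' by simp
      obtain a where a: "a \<ge> 0" "(\<integral>t. signed_power q' (?k t - a) \<partial>axial n) = 0"
        "A.radial_gain q' r = (\<integral>t. \<bar>?k t - a\<bar> powr q' \<partial>axial n) powr (1 / q')"
        using A.radial_gain_attained[OF q1 r] by metis
      have m: "(\<lambda>t. signed_power q' (?k t - a)) \<in> borel_measurable (axial n)"
        using q1 by (intro A.measurable_continuous continuous_on_signed_power continuous_on_diff kc continuous_on_const)
      have "q \<noteq> 1" using q' q1 by (simp flip: ennreal_1)
      show thesis
      proof
        show "balanced n q (\<lambda>t. ?k t - a)" using a q' by (simp add: balanced_def)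
        show v: "interval_norm n q (\<lambda>t. ?k t - a) = gain n q r"
          using a q' \<open>q \<noteq> 1\<close> by (simp add: interval_norm_def gain_def)
        show "gain n q r \<le> interval_norm n q (\<lambda>t. ?k t - a')" for a'
          using minimal[of q' a a'] m a q' unfolding v[symmetric] by (simp add: interval_norm_def)
      qed (rule a)
    qed
  qed
qed

lemma G_eq_gain:
  assumes n: "CARD('n::{finite,wellorder}) \<ge> 3" and q: "1 \<le> q" and r: "0 \<le> r" "r < 1"
  shows "G TYPE('n) q r = gain CARD('n) q r"
proof -
  obtain a where a: "a \<ge> 0"
    "interval_norm CARD('n) q (\<lambda>t. axial_kernel (CARD('n) - 1) r t - a) = gain CARD('n) q r"
    "\<And>a'. gain CARD('n) q r \<le> interval_norm CARD('n) q (\<lambda>t. axial_kernel (CARD('n) - 1) r t - a')"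
    using gain_optimal[OF n q r] by metis
  show ?thesis
    unfolding G_eq_interval_norm[OF n q r]
  proof (rule cInf_eq_minimum)
    show "gain CARD('n) q r \<in> (\<lambda>a. interval_norm CARD('n) q (\<lambda>t. axial_kernel (CARD('n) - 1) r t - a)) ` {0..}"
      using a(1,2) by (auto simp flip: a(2))
  qed (use a(3) in auto)
qed

text \<open>\<open>G\<close> agrees with \<open>gain\<close> only on \<open>{0..<1}\<close>, and
  \<open>inv_into\<close> sees only the values on its domain.\<close>

lemma increasing_diffeomorphism_cong:
  assumes f: "increasing_diffeomorphism f S T" and eq: "\<And>x. x \<in> S \<Longrightarrow> g x = f x"
  shows "increasing_diffeomorphism g S T"
proof -
  have inv: "inv_into S g = inv_into S f"
    unfolding inv_into_def using eq by (intro ext arg_cong[where f = Eps]) auto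
  have "C1_on S f" using f by (simp add: increasing_diffeomorphism_def)
  then have "C1_on S g"
    unfolding C1_on_def
  proof (elim exE conjE, intro exI conjI ballI)
    fix f' x assume "\<forall>x\<in>S. (f has_real_derivative f' x) (at x within S)" "x \<in> S"
    then have "(f has_real_derivative f' x) (at x within S)" by blast
    then show "(g has_real_derivative f' x) (at x within S)"
      by (rule has_field_derivative_transform_within[where d = 1]) (use \<open>x \<in> S\<close> eq in auto)
  qed
  moreover have "strict_mono_on S g" "bij_betw g S T"
    using f eq bij_betw_cong[of S g f T] by (auto simp: increasing_diffeomorphism_def strict_mono_on_def)
  ultimately show ?thesis
    using f by (simp add: increasing_diffeomorphism_def inv)
qed

lemma gain_diffeomorphism:
  assumes n: "n \<ge> 3" and q: "1 < q"
  shows "increasing_diffeomorphism (gain n q) {0..<1} {0..}"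
proof (cases "q = \<infinity>")
  case True
  then have "gain n q = oscillation_gain (n - 1)" by (auto simp: gain_def fun_eq_iff)
  then show ?thesis using oscillation_gain_diffeomorphism[of "n - 1"] n by simp
next
  case False
  then obtain q' where q': "q = ennreal q'" "q' > 1"
    using q by (cases q) (auto simp flip: ennreal_1 simp: ennreal_less_iff)
  interpret A: axial_prob "axial n" "n - 1" by (rule axial_prob_axial[OF n])
  have "gain n q = A.radial_gain q'" using False q q' by (auto simp: gain_def fun_eq_iff)
  then show ?thesis using A.radial_gain_diffeomorphism[OF q'(2)] by simp
qed

text \<open>For \<open>q < \<infinity>\<close> the extremal function is \<open>signed_power q h\<close>; for \<open>q = \<infinity>\<close> the bound is approached
  by normalised differences of indicators of opposite polar caps.\<close>

lemma pairing_sharp: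
  fixes b :: "real ^ 'n::{finite,wellorder}"
  assumes n: "CARD('n) \<ge> 3" and pq: "1 \<le> p" "1 \<le> q" "1 / p + 1 / q = 1"
    and b: "norm b = 1" and h: "continuous_on {-1..1} h"
    and mono: "\<And>s t. s \<in> {-1..1} \<Longrightarrow> t \<in> {-1..1} \<Longrightarrow> s < t \<Longrightarrow> h s < h t"
    and bal: "balanced CARD('n) q h"
    and C: "\<And>\<phi> :: real ^ 'n::_ \<Rightarrow> real ^ 'n::_. in_Lp p \<phi> \<Longrightarrow> (\<integral>\<zeta>. \<phi> \<zeta> \<partial>\<sigma>) = 0 \<Longrightarrow>
      norm (\<integral>\<zeta>. h (\<zeta> \<bullet> b) *\<^sub>R \<phi> \<zeta> \<partial>\<sigma>) \<le> C * Lp_norm p \<phi>"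
  shows "interval_norm CARD('n) q h \<le> C"
proof -
  interpret S: prob_space "\<sigma> :: (real ^ 'n::_) measure" by (rule prob_space_surface_measure)
  interpret A: axial_prob "axial CARD('n)" "CARD('n) - 1" by (rule axial_prob_axial[OF n])
  let ?M = "axial CARD('n)"
  \<comment> \<open>Fields pointing along \<open>b\<close> and depending only on
    \<open>\<zeta> \<bullet> b\<close> turn the vector-valued hypothesis into a scalar one on the
    interval.\<close>
  have test: "\<bar>\<integral>t. h t * g t \<partial>?M\<bar> \<le> C * Lp_norm p (\<lambda>\<zeta>. g (\<zeta> \<bullet> b) *\<^sub>R b)"
    if g: "g \<in> borel_measurable ?M" "(\<integral>t. g t \<partial>?M) = 0" "in_Lp p (\<lambda>\<zeta>. g (\<zeta> \<bullet> b) *\<^sub>R b)" for g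
  proof -
    have "integrable \<sigma> (\<lambda>\<zeta>. (g (\<zeta> \<bullet> b) *\<^sub>R b) \<bullet> b)"
      by (rule integrable_inner_left[OF in_Lp_integrable[OF pq(1) g(3)]])
    then have ig: "integrable \<sigma> (\<lambda>\<zeta>. g (\<zeta> \<bullet> b))"
      using b by (auto simp: norm_eq_1)
    have ihg: "integrable \<sigma> (\<lambda>\<zeta>. h (\<zeta> \<bullet> b) * g (\<zeta> \<bullet> b))"
      using integrable_inner_left[OF integrable_axial_scaleR[OF n b h in_Lp_integrable[OF pq(1) g(3)]], of b] b
      by (auto simp: norm_eq_1)
    have "(\<integral>\<zeta>. g (\<zeta> \<bullet> b) *\<^sub>R b \<partial>\<sigma>) = (\<integral>\<zeta>. g (\<zeta> \<bullet> b) \<partial>\<sigma>) *\<^sub>R b"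
      by (intro integral_scaleR_left ig)
    then have z: "(\<integral>\<zeta>. g (\<zeta> \<bullet> b) *\<^sub>R b \<partial>\<sigma>) = 0"
      by (simp add: integral_surface_axial(1)[OF n b g(1)] g(2))
    have hg: "(\<lambda>t. h t * g t) \<in> borel_measurable ?M"
      using g(1) A.measurable_continuous[OF h] by (intro borel_measurable_times)
    have "(\<integral>\<zeta>. h (\<zeta> \<bullet> b) *\<^sub>R g (\<zeta> \<bullet> b) *\<^sub>R b \<partial>\<sigma>) = (\<integral>\<zeta>. (h (\<zeta> \<bullet> b) * g (\<zeta> \<bullet> b)) *\<^sub>R b \<partial>\<sigma>)" by simp
    also have "\<dots> = (\<integral>\<zeta>. h (\<zeta> \<bullet> b) * g (\<zeta> \<bullet> b) \<partial>\<sigma>) *\<^sub>R b"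
      by (intro integral_scaleR_left ihg)
    also have "\<dots> = (\<integral>t. h t * g t \<partial>?M) *\<^sub>R b"
      using integral_surface_axial(1)[OF n b hg] by simp
    finally show ?thesis using C[OF g(3) z] b by simp
  qed
  have gb: "(\<lambda>\<zeta>. g (\<zeta> \<bullet> b) *\<^sub>R b) \<in> borel_measurable \<sigma>" if "g \<in> borel_measurable ?M" for g
    using integral_surface_axial(3)[OF n b that] by simp
  show ?thesis
  proof (cases "q = \<infinity>")
    case True
    with pq have p: "p = 1" by (cases rule: conjugate_exponent_cases[OF pq]) auto
    have h1: "h (- 1) = - h 1" using bal True by (simp add: balanced_def)
    have cap: "(h c - h (- c)) / 2 \<le> C" if c: "0 < c" "c < 1" for c
    proof -
      let ?B = "Beta (1/2) ((real CARD('n) - 1) / 2)"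
      define s where "s = integral {c..1} (axial_weight CARD('n)) / ?B"
      have s: "s > 0" unfolding s_def
        using c axial_Beta_pos[OF n] by (intro divide_pos_pos integral_axial_weight_pos) auto
      let ?U = "indicator {c..1} :: real \<Rightarrow> real" and ?L = "indicator {-1..-c} :: real \<Rightarrow> real"
      have one: "continuous_on X (\<lambda>t. 1 :: real)" for X :: "real set" by simp
      have hU: "continuous_on {c..1} h" "continuous_on {-1..-c} h"
        by (rule continuous_on_subset[OF h], use c in auto)+
      have iU: "integrable ?M ?U" "(\<integral>t. ?U t \<partial>?M) = s"
        using integral_axial_indicator[OF n _ _ one, of c 1] c by (simp_all add: s_def)
      have "integral {-1..-c} (axial_weight CARD('n)) = integral {c..1} (axial_weight CARD('n))"
        using Henstock_Kurzweil_Integration.integral_reflect_real[of 1 c "axial_weight CARD('n)"] by simp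
      then have iL: "integrable ?M ?L" "(\<integral>t. ?L t \<partial>?M) = s"
        using integral_axial_indicator[OF n _ _ one, of "-1" "-c"] c by (simp_all add: s_def)
      have ihU: "integrable ?M (\<lambda>t. ?U t * h t)" "integrable ?M (\<lambda>t. ?L t * h t)"
        using integral_axial_indicator(1)[OF n _ _ hU(1)] integral_axial_indicator(1)[OF n _ _ hU(2)] c by auto
      \<comment> \<open>Opposite caps have the same mass \<open>s\<close>, so the mean is 0 and the
        factor \<open>2 * s\<close> normalises the L^1 norm to 1. On the caps the increasing
        \<open>h\<close> is at least \<open>h c\<close> and at most \<open>h (- c)\<close>,
        respectively.\<close>
      define g where "g t = (?U t - ?L t) / (2 * s)" for t
      have gm: "g \<in> borel_measurable ?M"
        unfolding g_def[abs_def] using iU iL by (auto dest: borel_measurable_integrable)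
      have g0: "(\<integral>t. g t \<partial>?M) = 0" using iU iL by (simp add: g_def)
      have gabs: "\<bar>g t\<bar> = (?U t + ?L t) / (2 * s)" for t
        using c s by (auto simp: g_def indicator_def)
      have igabs: "integrable ?M (\<lambda>t. \<bar>g t\<bar>)" "(\<integral>t. \<bar>g t\<bar> \<partial>?M) = 1"
        using iU iL s by (simp_all add: gabs)
      have gabsm: "(\<lambda>t. \<bar>g t\<bar>) \<in> borel_measurable ?M" using gm by simp
      have Lp: "in_Lp p (\<lambda>\<zeta>. g (\<zeta> \<bullet> b) *\<^sub>R b)" "Lp_norm p (\<lambda>\<zeta>. g (\<zeta> \<bullet> b) *\<^sub>R b) = 1"
        using gb[OF gm] igabs b integral_surface_axial[OF n b gabsm] by (simp_all add: in_Lp_def Lp_norm_def p)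
      have "(h c - h (- c)) / 2 = (\<integral>t. (?U t * h c - ?L t * h (- c)) / (2 * s) \<partial>?M)"
        using iU iL s by (simp add: field_simps)
      also have "\<dots> \<le> (\<integral>t. (?U t * h t - ?L t * h t) / (2 * s) \<partial>?M)"
      proof (rule integral_mono)
        fix t assume "t \<in> space ?M"
        then have t: "t \<in> {-1..1}" by simp
        have "?U t * h c \<le> ?U t * h t" using mono[of c t] c t by (cases "t = c") (auto simp: indicator_def)
        moreover have "?L t * h t \<le> ?L t * h (- c)" using mono[of t "-c"] c t by (cases "t = - c") (auto simp: indicator_def)
        ultimately show "(?U t * h c - ?L t * h (- c)) / (2 * s) \<le> (?U t * h t - ?L t * h t) / (2 * s)"
          using s by (intro divide_right_mono) auto
      qed (use iU iL ihU in auto)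
      also have "\<dots> = (\<integral>t. h t * g t \<partial>?M)"
        by (intro Bochner_Integration.integral_cong) (auto simp: g_def algebra_simps)
      also have "\<dots> \<le> C" using test[OF gm g0 Lp(1)] Lp(2) by simp
      finally show ?thesis .
    qed
    \<comment> \<open>As \<open>c\<close> tends to 1 the caps shrink to the poles; balance gives
      \<open>h (- 1) = - h 1\<close>, so the limit is \<open>h 1\<close>, which dominates
      \<open>\<bar>h t\<bar>\<close> by monotonicity.\<close>
    have "h 1 \<le> C"
    proof -
      define c where "c k = 1 - inverse (real (Suc (Suc k)))" for k
      have c: "0 < c k" "c k < 1" for k by (auto simp: c_def field_simps)
      have cl: "c \<longlonglongrightarrow> 1"
        unfolding c_def[abs_def]
        using tendsto_diff[OF tendsto_const LIMSEQ_Suc[OF LIMSEQ_inverse_real_of_nat], of 1] by simp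
      have cin: "c k \<in> {-1..1}" "- c k \<in> {-1..1}" for k using c[of k] by auto
      have "(\<lambda>k. h (c k)) \<longlonglongrightarrow> h 1"
        by (rule continuous_on_tendsto_compose[OF h cl _ always_eventually]) (simp, rule allI, rule cin)
      moreover have "(\<lambda>k. h (- c k)) \<longlonglongrightarrow> h (- 1)"
        by (rule continuous_on_tendsto_compose[OF h tendsto_minus[OF cl] _ always_eventually])
          (simp, rule allI, rule cin)
      ultimately have "(\<lambda>k. (h (c k) - h (- c k)) / 2) \<longlonglongrightarrow> (h 1 - h (- 1)) / 2"
        by (intro tendsto_intros) auto
      then have "(h 1 - h (- 1)) / 2 \<le> C"
        by (rule LIMSEQ_le_const2) (use cap[OF c] in auto)
      then show ?thesis using h1 by simp
    qed
    moreover have "(SUP t\<in>{-1..1}. \<bar>h t\<bar>) \<le> h 1"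
    proof (rule cSUP_least)
      fix t :: real assume t: "t \<in> {-1..1}"
      have "h t \<le> h 1" using mono[of t 1] t by (cases "t = 1") auto
      moreover have "h (- 1) \<le> h t" using mono[of "-1" t] t by (cases "t = - 1") auto
      ultimately show "\<bar>h t\<bar> \<le> h 1" using h1 by linarith
    qed simp
    ultimately show ?thesis using True by (simp add: interval_norm_def)
  next
    case False
    then obtain q' where q': "q = ennreal q'" "q' \<ge> 1"
      using pq(2) by (cases q) (auto simp flip: ennreal_1 simp: ennreal_le_iff)
    let ?g = "\<lambda>t. signed_power q' (h t)"
    have hm: "h \<in> borel_measurable ?M" by (rule A.measurable_continuous[OF h])
    have gm: "?g \<in> borel_measurable ?M" using hm by (rule measurable_compose) simp
    have g0: "(\<integral>t. ?g t \<partial>?M) = 0" using bal q' by (simp add: balanced_def)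
    have hq: "continuous_on {-1..1} (\<lambda>t. \<bar>h t\<bar> powr q')" using h q' by (intro continuous_on_abs_powr) auto
    note hqi = A.integrable_continuous[OF hq] and hqm = A.measurable_continuous[OF hq]
    define I where "I = (\<integral>t. \<bar>h t\<bar> powr q' \<partial>?M)"
    \<comment> \<open>An increasing \<open>h\<close> vanishing almost everywhere would contradict
      its positive pairing with \<open>t\<close>.\<close>
    have "I \<noteq> 0"
    proof
      assume "I = 0"
      then have "AE t in ?M. \<bar>h t\<bar> powr q' = 0"
        unfolding I_def using hqi by (subst (asm) integral_nonneg_eq_0_iff_AE) auto
      then have "AE t in ?M. h t * t = 0" by eventually_elim auto
      then have "(\<integral>t. h t * t \<partial>?M) = (\<integral>t. 0 \<partial>?M)"
        by (intro integral_cong_AE A.measurable_continuous continuous_intros h) auto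
      then show False using A.integral_mult_increasing_pos[OF h mono] by simp
    qed
    moreover have "I \<ge> 0" by (simp add: I_def)
    ultimately have I: "I > 0" by simp
    have hg: "(\<integral>t. h t * ?g t \<partial>?M) = I"
      unfolding I_def by (intro Bochner_Integration.integral_cong) (auto simp: mult.commute[of "h _"] signed_power_mult_self)
    have ng: "norm (?g t *\<^sub>R b) = \<bar>?g t\<bar>" for t using b by simp
    from pq show ?thesis
    proof (cases rule: conjugate_exponent_cases)
      case inf_one
      then have q1: "q' = 1" using q' by (simp flip: ennreal_1)
      have "esssup \<sigma> (\<lambda>\<zeta>. ereal (norm (?g (\<zeta> \<bullet> b) *\<^sub>R b))) \<le> 1"
      proof (rule esssup_I)
        show "(\<lambda>\<zeta>. ereal (norm (?g (\<zeta> \<bullet> b) *\<^sub>R b))) \<in> borel_measurable \<sigma>"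
          by (rule borel_measurable_ereal[OF measurable_compose[OF gb[OF gm] borel_measurable_norm]])
        show "AE \<zeta> in \<sigma>. ereal (norm (?g (\<zeta> \<bullet> b) *\<^sub>R b)) \<le> 1"
          unfolding ng by (simp add: q1 abs_sgn_eq)
      qed
      moreover have "esssup \<sigma> (\<lambda>\<zeta>::real^'n::_. 0) \<le> esssup \<sigma> (\<lambda>\<zeta>. ereal (norm (?g (\<zeta> \<bullet> b) *\<^sub>R b)))"
        using gb[OF gm] by (intro esssup_mono) auto
      then have "0 \<le> esssup \<sigma> (\<lambda>\<zeta>. ereal (norm (?g (\<zeta> \<bullet> b) *\<^sub>R b)))"
        by (subst (asm) esssup_const) (use S.emeasure_space_1 in auto)
      \<comment> \<open>These bounds on \<open>L\<close> suffice: \<open>0 < I \<le> C * L\<close>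
        forces \<open>C > 0\<close>, and then \<open>C * L \<le> C\<close>.\<close>
      ultimately obtain L where L: "esssup \<sigma> (\<lambda>\<zeta>. ereal (norm (?g (\<zeta> \<bullet> b) *\<^sub>R b))) = ereal L" "0 \<le> L" "L \<le> 1"
        by (cases "esssup \<sigma> (\<lambda>\<zeta>. ereal (norm (?g (\<zeta> \<bullet> b) *\<^sub>R b)))") auto
      have Lp: "in_Lp p (\<lambda>\<zeta>. ?g (\<zeta> \<bullet> b) *\<^sub>R b)" "Lp_norm p (\<lambda>\<zeta>. ?g (\<zeta> \<bullet> b) *\<^sub>R b) = L"
        using gb[OF gm] L(1) inf_one by (simp_all add: in_Lp_def Lp_norm_def)
      have "I \<le> C * L" using test[OF gm g0 Lp(1)] I Lp(2) unfolding hg by simp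
      then have "0 < C * L" using I by linarith
      then have "C > 0" using L(2) by (simp add: zero_less_mult_iff)
      then have "C * L \<le> C" using L(3) by simp
      then have "I \<le> C" using \<open>I \<le> C * L\<close> by simp
      then show ?thesis using q1 q' I by (simp add: interval_norm_def I_def)
    next
      case one_inf
      then show ?thesis using False by simp
    next
      case (finite p' q'')
      then have qq: "q'' = q'" using q' by (simp add: ennreal_inj)
      have p': "p' = q' / (q' - 1)" using finite qq by (auto simp: field_simps)
      have eq: "norm (?g t *\<^sub>R b) powr p' = \<bar>h t\<bar> powr q'" for t
        unfolding ng p' using finite qq by (intro abs_signed_power_powr) auto
      have Lp: "in_Lp p (\<lambda>\<zeta>. ?g (\<zeta> \<bullet> b) *\<^sub>R b)" "Lp_norm p (\<lambda>\<zeta>. ?g (\<zeta> \<bullet> b) *\<^sub>R b) = I powr (1 / p')"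
        using gb[OF gm] finite hqi integral_surface_axial[OF n b hqm] eq
        by (simp_all add: in_Lp_def Lp_norm_def I_def del: norm_scaleR)
      have "I \<le> C * I powr (1 / p')" using test[OF gm g0 Lp(1)] I Lp(2) unfolding hg by simp
      moreover have "I = I powr (1 / q') * I powr (1 / p')"
      proof -
        have "1 / q' + 1 / p' = 1" using finite qq by simp
        then show ?thesis using I by (simp flip: powr_add)
      qed
      ultimately have "I powr (1 / q') * I powr (1 / p') \<le> C * I powr (1 / p')" by simp
      then have "I powr (1 / q') \<le> C" using I by simp
      then show ?thesis using q' finite by (simp add: interval_norm_def I_def)
    qed
  qed
qed

text \<open>The linear function is \<open>kernel_slope (n - 1) 0\<close>, the integral kernel of the
  derivative at the origin; its norm is a moment of one coordinate.\<close>

lemma interval_norm_linear: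
  assumes n: "n \<ge> 3" and q: "1 \<le> q"
  shows "interval_norm n q (\<lambda>t. 2 * (real n - 1) * t) = gradient_const n q"
proof (cases "q = \<infinity>")
  case True
  have "(SUP t\<in>{-1..1}. \<bar>2 * (real n - 1) * t\<bar>) = 2 * (real n - 1)"
  proof (rule cSup_eq_maximum)
    show "2 * (real n - 1) \<in> (\<lambda>t. \<bar>2 * (real n - 1) * t\<bar>) ` {-1..1}"
      using n by (intro image_eqI[of _ _ 1]) auto
    fix x assume "x \<in> (\<lambda>t. \<bar>2 * (real n - 1) * t\<bar>) ` {-1..1}"
    then obtain t where t: "t \<in> {-1..1}" "x = \<bar>2 * (real n - 1) * t\<bar>" by blast
    have "x = 2 * (real n - 1) * \<bar>t\<bar>" using n t by (simp add: abs_mult)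
    also have "\<dots> \<le> 2 * (real n - 1) * 1" using n t by (intro mult_left_mono) auto
    finally show "x \<le> 2 * (real n - 1)" by simp
  qed
  then show ?thesis using True by (simp add: interval_norm_def gradient_const_def)
next
  case False
  then obtain q' where q': "q = ennreal q'" "q' \<ge> 1"
    using q by (cases q) (auto simp flip: ennreal_1 simp: ennreal_le_iff)
  let ?m = "\<integral>t. \<bar>t\<bar> powr q' \<partial>axial n"
  have "(\<integral>t. \<bar>2 * (real n - 1) * t\<bar> powr q' \<partial>axial n) = (\<integral>t. (2 * (real n - 1)) powr q' * \<bar>t\<bar> powr q' \<partial>axial n)"
    using n by (intro Bochner_Integration.integral_cong) (auto simp: abs_mult powr_mult)
  also have "\<dots> = (2 * (real n - 1)) powr q' * ?m" by simp
  finally have "interval_norm n q (\<lambda>t. 2 * (real n - 1) * t) = ((2 * (real n - 1)) powr q' * ?m) powr (1 / q')"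
    using q' by (simp add: interval_norm_def)
  also have "\<dots> = 2 * (real n - 1) * ?m powr (1 / q')"
    using n q' by (simp add: powr_mult powr_powr)
  finally show ?thesis
    using q' axial_moment[OF n q'(2)] by (simp add: gradient_const_def)
qed

lemma gradient_const_pos:
  assumes n: "n \<ge> 3" and q: "1 \<le> q"
  shows "gradient_const n q > 0"
proof (cases "q = \<infinity>")
  case False
  then obtain q' where q': "q = ennreal q'" "q' \<ge> 1"
    using q by (cases q) (auto simp flip: ennreal_1 simp: ennreal_le_iff)
  let ?x = "Gamma (real n / 2) * Gamma ((1 + q') / 2) / (sqrt pi * Gamma ((real n + q') / 2))"
  have "?x > 0" using n q' by (intro divide_pos_pos mult_pos_pos Gamma_real_pos) auto
  then have "0 < ?x powr (1 / q')" by (metis powr_gt_zero less_irrefl)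
  moreover have "gradient_const n q = 2 * (real n - 1) * ?x powr (1 / q')"
    using q' by (simp add: gradient_const_def)
  moreover have "0 < 2 * (real n - 1)" using n by simp
  ultimately show ?thesis by (simp only: mult_pos_pos)
qed (use n in \<open>simp add: gradient_const_def\<close>)

text \<open>The signed power of an odd function is odd, so 0 is the best constant and
  \<open>pairing_sharp\<close> applies to the linear kernel without recentring.\<close>

lemma balanced_linear:
  assumes n: "n \<ge> 3" and q: "1 \<le> q" and c: "c > 0"
  shows "balanced n q (\<lambda>t. c * t)"
proof (cases "q = \<infinity>")
  case False
  then obtain q' where q': "q = ennreal q'" "q' \<ge> 1"
    using q by (cases q) (auto simp flip: ennreal_1 simp: ennreal_le_iff)
  interpret A: axial_prob "axial n" "n - 1" by (rule axial_prob_axial[OF n])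
  have "(\<integral>t. signed_power q' (c * t) \<partial>axial n) = 0"
  proof (cases "q' = 1")
    case True
    then show ?thesis using c integral_axial_sgn[OF n] by (simp add: sgn_mult)
  next
    case False
    then have "continuous_on {-1..1} (\<lambda>t. signed_power q' (c * t))"
      using q' by (intro continuous_intros) auto
    from A.symmetric[OF this] show ?thesis by (simp add: signed_power_minus)
  qed
  then show ?thesis using q' by (simp add: balanced_def)
qed (simp add: balanced_def)

section \<open>Poisson integrals and their derivative at the origin\<close>

lemma poisson_integral_axial:
  fixes b :: "real ^ 'n" and \<phi> :: "real ^ 'n \<Rightarrow> real ^ 'm"
  assumes b: "norm b = 1"
  shows "P\<^sub>h[\<phi>] (r *\<^sub>R b) = (\<integral>\<zeta>. axial_kernel (CARD('n) - 1) r (\<zeta> \<bullet> b) *\<^sub>R \<phi> \<zeta> \<partial>\<sigma>)"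
  unfolding poisson_integral_def
  by (intro Bochner_Integration.integral_cong) (auto simp: poisson_kernel_axial[OF b])

lemma axial_kernel_0 [simp]: "axial_kernel k 0 t = 1"
  by (simp add: axial_kernel_def ball_ratio_def)

lemma poisson_integral_0:
  fixes \<phi> :: "real ^ 'n \<Rightarrow> real ^ 'm"
  shows "P\<^sub>h[\<phi>] 0 = (\<integral>\<zeta>. \<phi> \<zeta> \<partial>\<sigma>)"
proof -
  obtain b :: "real ^ 'n" where "b \<in> Basis" using nonempty_Basis by blast
  then show ?thesis using poisson_integral_axial[of b \<phi> 0] by simp
qed

lemma unit_direction:
  fixes x :: "'a::euclidean_space"
  obtains b where "norm b = 1" "x = norm x *\<^sub>R b"
proof (cases "x = 0")
  case True
  obtain b :: 'a where "b \<in> Basis" using nonempty_Basis by blast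
  then show thesis using True by (intro that[of b]) auto
next
  case False
  then show thesis by (intro that[of "sgn x"]) (auto simp: norm_sgn sgn_div_norm)
qed

lemma poisson_integral_centered:
  fixes b :: "real ^ 'n::{finite,wellorder}" and \<phi> :: "real ^ 'n::_ \<Rightarrow> real ^ 'm"
  assumes n: "CARD('n) \<ge> 3" and b: "norm b = 1" and r: "\<bar>r\<bar> < 1"
    and \<phi>: "integrable \<sigma> \<phi>" "(\<integral>\<zeta>. \<phi> \<zeta> \<partial>\<sigma>) = 0"
  shows "P\<^sub>h[\<phi>] (r *\<^sub>R b) = (\<integral>\<zeta>. (axial_kernel (CARD('n) - 1) r (\<zeta> \<bullet> b) - a) *\<^sub>R \<phi> \<zeta> \<partial>\<sigma>)"
proof -
  have c: "continuous_on {-1..1} (axial_kernel (CARD('n) - 1) r)"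
    using r by (intro continuous_on_axial_kernel continuous_on_const continuous_on_id) auto
  have "(\<integral>\<zeta>. (axial_kernel (CARD('n) - 1) r (\<zeta> \<bullet> b) - a) *\<^sub>R \<phi> \<zeta> \<partial>\<sigma>) =
    (\<integral>\<zeta>. axial_kernel (CARD('n) - 1) r (\<zeta> \<bullet> b) *\<^sub>R \<phi> \<zeta> - a *\<^sub>R \<phi> \<zeta> \<partial>\<sigma>)"
    by (simp only: scaleR_left_diff_distrib)
  also have "\<dots> = (\<integral>\<zeta>. axial_kernel (CARD('n) - 1) r (\<zeta> \<bullet> b) *\<^sub>R \<phi> \<zeta> \<partial>\<sigma>)"
    using integrable_axial_scaleR[OF n b c \<phi>(1)] \<phi> by simp
  finally show ?thesis by (simp only: poisson_integral_axial[OF b])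
qed

text \<open>Comes from the first-order expansion of the kernel at the origin: in a unit direction
  \<open>b\<close> it is 1 + 2(n-1) r (\<zeta> \<bullet> b) + o(r).\<close>

definition gradient_map :: "(real ^ 'n \<Rightarrow> real ^ 'm) \<Rightarrow> real ^ 'n \<Rightarrow> real ^ 'm" where
  "gradient_map \<phi> \<xi> = (\<integral>\<zeta>. (2 * (real CARD('n) - 1) * (\<zeta> \<bullet> \<xi>)) *\<^sub>R \<phi> \<zeta> \<partial>\<sigma>)"

lemma integrable_gradient_map:
  fixes \<phi> :: "real ^ 'n \<Rightarrow> real ^ 'm"
  assumes "integrable \<sigma> \<phi>"
  shows "integrable \<sigma> (\<lambda>\<zeta>. (c * (\<zeta> \<bullet> \<xi>)) *\<^sub>R \<phi> \<zeta>)"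
proof (rule Bochner_Integration.integrable_bound)
  show "integrable \<sigma> (\<lambda>\<zeta>. (c * norm \<xi>) *\<^sub>R \<phi> \<zeta>)" using assms by simp
  have "(\<lambda>\<zeta>. c * (\<zeta> \<bullet> \<xi>)) \<in> borel_measurable \<sigma>" by (rule surface_measurable) simp
  then show "(\<lambda>\<zeta>. (c * (\<zeta> \<bullet> \<xi>)) *\<^sub>R \<phi> \<zeta>) \<in> borel_measurable \<sigma>"
    using assms by (intro borel_measurable_scaleR) auto
  show "AE \<zeta> in \<sigma>. norm ((c * (\<zeta> \<bullet> \<xi>)) *\<^sub>R \<phi> \<zeta>) \<le> norm ((c * norm \<xi>) *\<^sub>R \<phi> \<zeta>)"
  proof (rule AE_I2)
    fix \<zeta> :: "real ^ 'n" assume "\<zeta> \<in> space \<sigma>"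
    then have "\<bar>\<zeta> \<bullet> \<xi>\<bar> \<le> norm \<xi>" using Cauchy_Schwarz_ineq2[of \<zeta> \<xi>] by simp
    then show "norm ((c * (\<zeta> \<bullet> \<xi>)) *\<^sub>R \<phi> \<zeta>) \<le> norm ((c * norm \<xi>) *\<^sub>R \<phi> \<zeta>)"
      by (auto simp: abs_mult intro!: mult_right_mono mult_left_mono)
  qed
qed

lemma linear_gradient_map:
  fixes \<phi> :: "real ^ 'n \<Rightarrow> real ^ 'm"
  assumes \<phi>: "integrable \<sigma> \<phi>" shows "linear (gradient_map \<phi>)"
proof (rule linearI)
  let ?c = "2 * (real CARD('n) - 1)"
  show "gradient_map \<phi> (x + y) = gradient_map \<phi> x + gradient_map \<phi> y" for x y
  proof -
    have "gradient_map \<phi> (x + y) = (\<integral>\<zeta>. (?c * (\<zeta> \<bullet> x)) *\<^sub>R \<phi> \<zeta> + (?c * (\<zeta> \<bullet> y)) *\<^sub>R \<phi> \<zeta> \<partial>\<sigma>)"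
      unfolding gradient_map_def by (simp only: inner_add_right distrib_left scaleR_left_distrib)
    also have "\<dots> = gradient_map \<phi> x + gradient_map \<phi> y"
      unfolding gradient_map_def by (intro Bochner_Integration.integral_add integrable_gradient_map \<phi>)
    finally show ?thesis .
  qed
  show "gradient_map \<phi> (a *\<^sub>R x) = a *\<^sub>R gradient_map \<phi> x" for a x
  proof -
    have "gradient_map \<phi> (a *\<^sub>R x) = (\<integral>\<zeta>. a *\<^sub>R ((?c * (\<zeta> \<bullet> x)) *\<^sub>R \<phi> \<zeta>) \<partial>\<sigma>)"
      unfolding gradient_map_def by (simp add: mult_ac)
    also have "\<dots> = a *\<^sub>R gradient_map \<phi> x"
      unfolding gradient_map_def by (intro integral_scaleR_right integrable_gradient_map \<phi>)
    finally show ?thesis .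
  qed
qed

text \<open>The remainder of the kernel at radius \<open>r\<close> is \<open>r\<close> times the
  change of \<open>kernel_slope\<close> between radius 0 and \<open>r\<close>. This change is small
  uniformly on the interval, so the estimate is uniform in the direction and asks no more of
  \<open>\<phi>\<close> than integrability.\<close>

lemma poisson_integral_has_derivative:
  fixes \<phi> :: "real ^ 'n::{finite,wellorder} \<Rightarrow> real ^ 'm"
  assumes n: "CARD('n) \<ge> 3" and \<phi>: "integrable \<sigma> \<phi>"
  shows "(P\<^sub>h[\<phi>] has_derivative gradient_map \<phi>) (at 0)"
  unfolding has_derivative_at_alt
proof (intro conjI allI impI)
  let ?k = "CARD('n) - 1"
  have rk: "real ?k = real CARD('n) - 1" using n by simp
  show "bounded_linear (gradient_map \<phi>)"
    using linear_gradient_map[OF \<phi>] by (simp add: linear_conv_bounded_linear)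
  interpret A: axial_prob "axial CARD('n)" "?k" by (rule axial_prob_axial[OF n])
  define N where "N = (\<integral>\<zeta>. norm (\<phi> \<zeta>) \<partial>\<sigma>)"
  have N: "N \<ge> 0" by (simp add: N_def)
  have nint: "integrable \<sigma> (\<lambda>\<zeta>. norm (\<phi> \<zeta>))" using \<phi> by simp
  fix e :: real assume e: "e > 0"
  have "uniform_limit {-1..1} (kernel_slope ?k) (kernel_slope ?k 0) (at 0)"
    by (rule uniform_limit_of_continuous_on_prod[OF A.continuous_on_slope_prod]) auto
  \<comment> \<open>\<open>N + 1\<close> in place of \<open>N\<close> keeps the tolerance meaningful
    when \<open>\<phi>\<close> vanishes almost everywhere.\<close>
  moreover have "e / (N + 1) > 0" using e N by simp
  ultimately have "\<forall>\<^sub>F r in at 0. \<forall>t\<in>{-1..1}. dist (kernel_slope ?k r t) (kernel_slope ?k 0 t) < e / (N + 1)"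
    unfolding uniform_limit_iff by blast
  then obtain d where d: "d > 0" "\<And>r t. r \<noteq> 0 \<Longrightarrow> dist r 0 < d \<Longrightarrow> t \<in> {-1..1} \<Longrightarrow>
      dist (kernel_slope ?k r t) (kernel_slope ?k 0 t) < e / (N + 1)"
    unfolding eventually_at by blast
  show "\<exists>d>0. \<forall>y. norm (y - 0) < d \<longrightarrow>
      norm (P\<^sub>h[\<phi>] y - P\<^sub>h[\<phi>] 0 - gradient_map \<phi> (y - 0)) \<le> e * norm (y - 0)"
  proof (intro exI[of _ "min d 1"] conjI allI impI)
    show "min d 1 > 0" using d by simp
    fix y :: "real ^ 'n::_" assume y: "norm (y - 0) < min d 1"
    obtain b where b: "norm b = 1" "y = norm y *\<^sub>R b" using unit_direction by blast
    define r where "r = norm y"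
    have r: "0 \<le> r" "r < 1" "r < d" using y by (auto simp: r_def)
    have r': "\<bar>r\<bar> < 1" using r by simp
    have yb: "y = r *\<^sub>R b" using b by (simp add: r_def)
    have kc: "continuous_on {-1..1} (axial_kernel ?k r)" by (rule A.continuous_axial_kernel[OF r'])
    let ?D = "\<lambda>t. axial_kernel ?k r t - 1 - 2 * (real CARD('n) - 1) * (r * t)"
    have D: "\<bar>?D t\<bar> \<le> r * (e / (N + 1))" if t: "t \<in> {-1..1}" for t
    proof (cases "r = 0")
      case False
      have "?D t = r * (kernel_slope ?k r t - kernel_slope ?k 0 t)"
        using axial_kernel_eq[OF r', of t ?k] t unfolding kernel_slope_0 rk
        by (simp add: abs_le_iff right_diff_distrib)
      moreover have "\<bar>kernel_slope ?k r t - kernel_slope ?k 0 t\<bar> \<le> e / (N + 1)"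
        using d(2)[of r t] False r t by (simp add: dist_real_def)
      ultimately show ?thesis
        using r by (simp only: abs_mult abs_of_nonneg) (intro mult_left_mono)
    qed simp
    have Dc: "continuous_on {-1..1} ?D"
      by (intro continuous_on_diff kc continuous_on_mult continuous_on_const continuous_on_id)
    have i1: "integrable \<sigma> (\<lambda>\<zeta>. axial_kernel ?k r (\<zeta> \<bullet> b) *\<^sub>R \<phi> \<zeta>)"
      by (rule integrable_axial_scaleR[OF n b(1) kc \<phi>])
    have "P\<^sub>h[\<phi>] y - P\<^sub>h[\<phi>] 0 - gradient_map \<phi> (y - 0) =
      (\<integral>\<zeta>. axial_kernel ?k r (\<zeta> \<bullet> b) *\<^sub>R \<phi> \<zeta> - \<phi> \<zeta> - (2 * (real CARD('n) - 1) * (\<zeta> \<bullet> y)) *\<^sub>R \<phi> \<zeta> \<partial>\<sigma>)"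
    proof -
      note lin = integrable_gradient_map[OF \<phi>, of "2 * (real CARD('n) - 1)" y]
      note i2 = Bochner_Integration.integrable_diff[OF i1 \<phi>]
      have "P\<^sub>h[\<phi>] y = (\<integral>\<zeta>. axial_kernel ?k r (\<zeta> \<bullet> b) *\<^sub>R \<phi> \<zeta> \<partial>\<sigma>)"
        unfolding yb by (rule poisson_integral_axial[OF b(1)])
      then show ?thesis
        unfolding poisson_integral_0 gradient_map_def diff_zero Bochner_Integration.integral_diff[OF i2 lin]
          Bochner_Integration.integral_diff[OF i1 \<phi>] by simp
    qed
    also have "\<dots> = (\<integral>\<zeta>. ?D (\<zeta> \<bullet> b) *\<^sub>R \<phi> \<zeta> \<partial>\<sigma>)"
      unfolding yb by (simp add: scaleR_left_diff_distrib)
    also have "norm \<dots> \<le> (\<integral>\<zeta>. norm (?D (\<zeta> \<bullet> b) *\<^sub>R \<phi> \<zeta>) \<partial>\<sigma>)" by (rule integral_norm_bound)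
    also have "\<dots> \<le> (\<integral>\<zeta>. r * (e / (N + 1)) * norm (\<phi> \<zeta>) \<partial>\<sigma>)"
    proof (rule integral_mono)
      show "integrable \<sigma> (\<lambda>\<zeta>. norm (?D (\<zeta> \<bullet> b) *\<^sub>R \<phi> \<zeta>))"
        by (rule integrable_norm[OF integrable_axial_scaleR[OF n b(1) Dc \<phi>]])
      show "integrable \<sigma> (\<lambda>\<zeta>. r * (e / (N + 1)) * norm (\<phi> \<zeta>))" by (intro integrable_mult_right nint)
      fix \<zeta> :: "real ^ 'n::_" assume "\<zeta> \<in> space \<sigma>"
      then have "\<zeta> \<bullet> b \<in> {-1..1}" using inner_sphere_le[OF _ b(1), of \<zeta>] by (simp add: abs_le_iff)
      then show "norm (?D (\<zeta> \<bullet> b) *\<^sub>R \<phi> \<zeta>) \<le> r * (e / (N + 1)) * norm (\<phi> \<zeta>)"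
        unfolding norm_scaleR by (intro mult_right_mono D) auto
    qed
    also have "\<dots> = r * (e / (N + 1)) * N" by (simp add: N_def)
    also have "\<dots> \<le> e * r"
    proof -
      have "N / (N + 1) \<le> 1" using N by simp
      then have "e * r * (N / (N + 1)) \<le> e * r * 1" using e r by (intro mult_left_mono) auto
      then show ?thesis by (simp add: mult_ac)
    qed
    finally show "norm (P\<^sub>h[\<phi>] y - P\<^sub>h[\<phi>] 0 - gradient_map \<phi> (y - 0)) \<le> e * norm (y - 0)"
      by (simp add: r_def)
  qed
qed

lemma jacobian_poisson_integral:
  fixes \<phi> :: "real ^ 'n::{finite,wellorder} \<Rightarrow> real ^ 'm"
  assumes n: "CARD('n) \<ge> 3" and \<phi>: "integrable \<sigma> \<phi>"
  shows "jacobian P\<^sub>h[\<phi>] (at 0) *v \<xi> = gradient_map \<phi> \<xi>"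
proof -
  have "frechet_derivative P\<^sub>h[\<phi>] (at 0) = gradient_map \<phi>"
    using frechet_derivative_at[OF poisson_integral_has_derivative[OF n \<phi>]] by simp
  then show ?thesis
    unfolding jacobian_def by (simp add: matrix_vector_mul(2)[OF linear_gradient_map[OF \<phi>]])
qed

lemma norm_gradient_map_le:
  fixes \<phi> :: "real ^ 'n::{finite,wellorder} \<Rightarrow> real ^ 'm"
  assumes n: "CARD('n) \<ge> 3" and pq: "1 \<le> p" "1 \<le> q" "1 / p + 1 / q = 1"
    and b: "norm b = 1" and \<phi>: "in_Lp p \<phi>"
  shows "norm (gradient_map \<phi> b) \<le> gradient_const CARD('n) q * Lp_norm p \<phi>"
  using pairing_le[OF n pq b _ \<phi>, of "\<lambda>t. 2 * (real CARD('n) - 1) * t"]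
  unfolding gradient_map_def interval_norm_linear[OF n pq(2)]
  by (auto intro: continuous_intros)

lemma matrix_norm_jacobian:
  fixes \<phi> :: "real ^ 'n::{finite,wellorder} \<Rightarrow> real ^ 'm"
  assumes n: "CARD('n) \<ge> 3" and pq: "1 \<le> p" "1 \<le> q" "1 / p + 1 / q = 1" and \<phi>: "in_Lp p \<phi>"
  shows "matrix_norm (jacobian P\<^sub>h[\<phi>] (at 0)) \<le> gradient_const CARD('n) q * Lp_norm p \<phi>"
    and "norm b = 1 \<Longrightarrow> norm (gradient_map \<phi> b) \<le> matrix_norm (jacobian P\<^sub>h[\<phi>] (at 0))"
proof -
  have int: "integrable \<sigma> \<phi>" by (rule in_Lp_integrable[OF pq(1) \<phi>])
  have eq: "matrix_norm (jacobian P\<^sub>h[\<phi>] (at 0)) = (SUP \<xi>\<in>sphere 0 1. norm (gradient_map \<phi> \<xi>))"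
    unfolding matrix_norm_def jacobian_poisson_integral[OF n int] ..
  have le: "norm (gradient_map \<phi> \<xi>) \<le> gradient_const CARD('n) q * Lp_norm p \<phi>" if "\<xi> \<in> sphere 0 1" for \<xi>
    using that by (intro norm_gradient_map_le[OF n pq _ \<phi>]) auto
  show "matrix_norm (jacobian P\<^sub>h[\<phi>] (at 0)) \<le> gradient_const CARD('n) q * Lp_norm p \<phi>"
    unfolding eq
  proof (rule cSUP_least)
    obtain b :: "real ^ 'n::_" where "b \<in> Basis" using nonempty_Basis by blast
    then show "sphere (0 :: real ^ 'n::_) 1 \<noteq> {}" by auto
  qed (rule le)
  show "norm (gradient_map \<phi> b) \<le> matrix_norm (jacobian P\<^sub>h[\<phi>] (at 0))" if "norm b = 1"
    unfolding eq using that le by (intro cSUP_upper bdd_aboveI2) auto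
qed

theorem theorem1p1:
  fixes p q :: ennreal
  assumes n: "CARD('n::{finite,wellorder}) \<ge> 3"
    and pq: "1 \<le> p" "1 \<le> q" "1 / p + 1 / q = 1"
  shows
    "(\<forall>\<phi> :: real ^ 'n::_ \<Rightarrow> real ^ 'n::_. in_Lp p \<phi> \<and> P\<^sub>h[\<phi>] 0 = 0 \<longrightarrow>
        (\<forall>x \<in> ball 0 1. norm (P\<^sub>h[\<phi>] x) \<le> G TYPE('n) q (norm x) * Lp_norm p \<phi>) \<and>
        P\<^sub>h[\<phi>] differentiable (at 0) \<and>
        matrix_norm (jacobian P\<^sub>h[\<phi>] (at 0)) \<le> gradient_const CARD('n) q * Lp_norm p \<phi>)
     \<and> (\<forall>x \<in> ball (0 :: real ^ 'n::_) 1. \<forall>C.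
          (\<forall>\<phi> :: real ^ 'n::_ \<Rightarrow> real ^ 'n::_. in_Lp p \<phi> \<and> P\<^sub>h[\<phi>] 0 = 0 \<longrightarrow>
             norm (P\<^sub>h[\<phi>] x) \<le> C * Lp_norm p \<phi>) \<longrightarrow> G TYPE('n) q (norm x) \<le> C)
     \<and> (\<forall>C.
          (\<forall>\<phi> :: real ^ 'n::_ \<Rightarrow> real ^ 'n::_. in_Lp p \<phi> \<and> P\<^sub>h[\<phi>] 0 = 0 \<longrightarrow>
             matrix_norm (jacobian P\<^sub>h[\<phi>] (at 0)) \<le> C * Lp_norm p \<phi>) \<longrightarrow>
          gradient_const CARD('n) q \<le> C)
     \<and> (p < \<infinity> \<longrightarrow> increasing_diffeomorphism (G TYPE('n) q) {0..<1} {0..} \<and> G TYPE('n) q 0 = 0)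
     \<and> (p = \<infinity> \<longrightarrow>
          (\<forall>r \<in> {0..<1}. G TYPE('n) q r = U\<^sub>h (r *\<^sub>R e\<^sub>n :: real ^ 'n::_)) \<and>
          increasing_diffeomorphism (G TYPE('n) q) {0..<1} {0..<1})"
proof -
  let ?n = "CARD('n)"
  let ?k = "axial_kernel (?n - 1)"
  let ?N = "gradient_const ?n q"
  let ?lin = "\<lambda>t. 2 * (real ?n - 1) * t"
  have c2: "0 < 2 * (real ?n - 1)" using n by simp
  have lin: "continuous_on {-1..1} ?lin" "balanced ?n q ?lin"
    "\<And>s t. s \<in> {-1..1} \<Longrightarrow> t \<in> {-1..1} \<Longrightarrow> s < t \<Longrightarrow> ?lin s < ?lin t"
    using c2 balanced_linear[OF n pq(2) c2] by (auto intro: continuous_intros)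
  have Npos: "0 < ?N" by (rule gradient_const_pos[OF n pq(2)])
  have gain0: "gain ?n q 0 = 0"
  proof -
    have "axial_prob.radial_gain (axial ?n) (?n - 1) q' 0 = 0" for q'
      by (subst axial_prob.radial_gain_def[OF axial_prob_axial[OF n]]) simp
    then show ?thesis by (simp add: gain_def oscillation_gain_def hemisphere_gain_def)
  qed
  have kc: "continuous_on {-1..1} (\<lambda>t. ?k r t - a)" if "\<bar>r\<bar> < 1" for r a
    using that by (intro continuous_on_diff continuous_on_axial_kernel continuous_on_const continuous_on_id) auto
  have A: "norm (P\<^sub>h[\<phi>] x) \<le> G TYPE('n) q (norm x) * Lp_norm p \<phi>"
    if \<phi>: "in_Lp p \<phi>" "P\<^sub>h[\<phi>] 0 = 0" and x: "x \<in> ball 0 1"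
    for \<phi> :: "real ^ 'n::_ \<Rightarrow> real ^ 'n::_" and x
  proof -
    have int: "integrable \<sigma> \<phi>" by (rule in_Lp_integrable[OF pq(1) \<phi>(1)])
    have z: "(\<integral>\<zeta>. \<phi> \<zeta> \<partial>\<sigma>) = 0" using \<phi>(2) by (simp add: poisson_integral_0)
    obtain b where b: "norm b = 1" "x = norm x *\<^sub>R b" using unit_direction by blast
    have r: "0 \<le> norm x" "norm x < 1" "\<bar>norm x\<bar> < 1" using x by auto
    obtain a where a: "interval_norm ?n q (\<lambda>t. ?k (norm x) t - a) = gain ?n q (norm x)"
      using gain_optimal[OF n pq(2) r(1,2)] by metis
    have "P\<^sub>h[\<phi>] x = (\<integral>\<zeta>. (?k (norm x) (\<zeta> \<bullet> b) - a) *\<^sub>R \<phi> \<zeta> \<partial>\<sigma>)"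
      using poisson_integral_centered[OF n b(1) r(3) int z] b(2) by metis
    then show ?thesis
      using pairing_le[OF n pq b(1) kc[OF r(3)] \<phi>(1), of a] a G_eq_gain[OF n pq(2) r(1,2)] by simp
  qed
  have B: "P\<^sub>h[\<phi>] differentiable (at 0) \<and> matrix_norm (jacobian P\<^sub>h[\<phi>] (at 0)) \<le> ?N * Lp_norm p \<phi>"
    if \<phi>: "in_Lp p \<phi>" for \<phi> :: "real ^ 'n::_ \<Rightarrow> real ^ 'n::_"
    using poisson_integral_has_derivative[OF n in_Lp_integrable[OF pq(1) \<phi>]] matrix_norm_jacobian(1)[OF n pq \<phi>]
    by (auto simp: differentiable_def)
  have A_sharp: "G TYPE('n) q (norm x) \<le> C"
    if x: "x \<in> ball (0 :: real ^ 'n::_) 1"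
      and C: "\<And>\<phi> :: real ^ 'n::_ \<Rightarrow> real ^ 'n::_. in_Lp p \<phi> \<Longrightarrow> P\<^sub>h[\<phi>] 0 = 0 \<Longrightarrow>
        norm (P\<^sub>h[\<phi>] x) \<le> C * Lp_norm p \<phi>" for x C
  proof -
    obtain b where b: "norm b = 1" "x = norm x *\<^sub>R b" using unit_direction by blast
    have r: "0 \<le> norm x" "norm x < 1" "\<bar>norm x\<bar> < 1" using x by auto
    show ?thesis
    proof (cases "x = 0")
      case True
      \<comment> \<open>At the centre sharpness means that no negative constant works, which needs
        an admissible field of positive norm. A negative \<open>C\<close> would force
        \<open>Lp_norm p \<phi> \<le> 0\<close> throughout, and \<open>pairing_sharp\<close> with
        constant 0 would then make \<open>gradient_const\<close> nonpositive.\<close>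
      have "C \<ge> 0"
      proof (rule ccontr)
        assume "\<not> C \<ge> 0"
        then have "C < 0" by simp
        have "interval_norm ?n q ?lin \<le> 0"
        proof (rule pairing_sharp[OF n pq b(1) lin(1) lin(3) lin(2)])
          fix \<phi> :: "real ^ 'n::_ \<Rightarrow> real ^ 'n::_"
          assume \<phi>: "in_Lp p \<phi>" "(\<integral>\<zeta>. \<phi> \<zeta> \<partial>\<sigma>) = 0"
          then have "0 \<le> C * Lp_norm p \<phi>" using C[of \<phi>] True by (simp add: poisson_integral_0)
          then have L: "Lp_norm p \<phi> \<le> 0" using \<open>C < 0\<close> by (simp add: zero_le_mult_iff)
          have "norm (\<integral>\<zeta>. ?lin (\<zeta> \<bullet> b) *\<^sub>R \<phi> \<zeta> \<partial>\<sigma>) \<le> ?N * Lp_norm p \<phi>"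
            using norm_gradient_map_le[OF n pq b(1) \<phi>(1)] by (simp add: gradient_map_def)
          also have "\<dots> \<le> 0" using L Npos by (simp add: mult_le_0_iff)
          finally show "norm (\<integral>\<zeta>. ?lin (\<zeta> \<bullet> b) *\<^sub>R \<phi> \<zeta> \<partial>\<sigma>) \<le> 0 * Lp_norm p \<phi>" by simp
        qed auto
        then show False using Npos unfolding interval_norm_linear[OF n pq(2)] by simp
      qed
      then show ?thesis using True gain0 G_eq_gain[OF n pq(2), of 0] by simp
    next
      case False
      obtain a where a: "balanced ?n q (\<lambda>t. ?k (norm x) t - a)"
        "interval_norm ?n q (\<lambda>t. ?k (norm x) t - a) = gain ?n q (norm x)"
        using gain_optimal[OF n pq(2) r(1,2)] by metis
      \<comment> \<open>Here \<open>x \<noteq> 0\<close> makes the kernel strictly increasing along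
        the axis, as \<open>pairing_sharp\<close> demands.\<close>
      have "interval_norm ?n q (\<lambda>t. ?k (norm x) t - a) \<le> C"
      proof (rule pairing_sharp[OF n pq b(1) kc[OF r(3)] _ a(1)])
        show "?k (norm x) s - a < ?k (norm x) t - a" if "s \<in> {-1..1}" "t \<in> {-1..1}" "s < t" for s t
          using that False r n by (intro diff_strict_right_mono axial_kernel_strict_mono) (auto simp: abs_le_iff)
        fix \<phi> :: "real ^ 'n::_ \<Rightarrow> real ^ 'n::_"
        assume \<phi>: "in_Lp p \<phi>" "(\<integral>\<zeta>. \<phi> \<zeta> \<partial>\<sigma>) = 0"
        have "P\<^sub>h[\<phi>] x = (\<integral>\<zeta>. (?k (norm x) (\<zeta> \<bullet> b) - a) *\<^sub>R \<phi> \<zeta> \<partial>\<sigma>)"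
          using poisson_integral_centered[OF n b(1) r(3) in_Lp_integrable[OF pq(1) \<phi>(1)] \<phi>(2)] b(2) by metis
        then show "norm (\<integral>\<zeta>. (?k (norm x) (\<zeta> \<bullet> b) - a) *\<^sub>R \<phi> \<zeta> \<partial>\<sigma>) \<le> C * Lp_norm p \<phi>"
          using C[OF \<phi>(1)] \<phi>(2) by (simp add: poisson_integral_0)
      qed
      then show ?thesis using a(2) G_eq_gain[OF n pq(2) r(1,2)] by simp
    qed
  qed
  have B_sharp: "?N \<le> C"
    if C: "\<And>\<phi> :: real ^ 'n::_ \<Rightarrow> real ^ 'n::_. in_Lp p \<phi> \<Longrightarrow> P\<^sub>h[\<phi>] 0 = 0 \<Longrightarrow>
        matrix_norm (jacobian P\<^sub>h[\<phi>] (at 0)) \<le> C * Lp_norm p \<phi>" for C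
    unfolding interval_norm_linear[OF n pq(2), symmetric]
  proof (rule pairing_sharp[OF n pq norm_e\<^sub>n lin(1) lin(3) lin(2)])
    fix \<phi> :: "real ^ 'n::_ \<Rightarrow> real ^ 'n::_"
    assume \<phi>: "in_Lp p \<phi>" "(\<integral>\<zeta>. \<phi> \<zeta> \<partial>\<sigma>) = 0"
    have "norm (gradient_map \<phi> e\<^sub>n) \<le> matrix_norm (jacobian P\<^sub>h[\<phi>] (at 0))"
      by (rule matrix_norm_jacobian(2)[OF n pq \<phi>(1) norm_e\<^sub>n])
    also have "\<dots> \<le> C * Lp_norm p \<phi>" using \<phi> by (intro C) (simp_all add: poisson_integral_0)
    finally show "norm (\<integral>\<zeta>. ?lin (\<zeta> \<bullet> e\<^sub>n) *\<^sub>R \<phi> \<zeta> \<partial>\<sigma>) \<le> C * Lp_norm p \<phi>"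
      by (simp add: gradient_map_def)
  qed auto
  have Ggain: "G TYPE('n) q r = gain ?n q r" if "r \<in> {0..<1}" for r
    using that by (intro G_eq_gain[OF n pq(2)]) auto
  have i: "increasing_diffeomorphism (G TYPE('n) q) {0..<1} {0..} \<and> G TYPE('n) q 0 = 0" if "p < \<infinity>"
  proof
    have "1 < q"
      using pq
    proof (cases rule: conjugate_exponent_cases)
      case (finite p' q')
      then show ?thesis by (simp flip: ennreal_1 add: ennreal_less_iff)
    qed (use that in auto)
    then show "increasing_diffeomorphism (G TYPE('n) q) {0..<1} {0..}"
      by (rule increasing_diffeomorphism_cong[OF gain_diffeomorphism[OF n] Ggain])
    show "G TYPE('n) q 0 = 0" using Ggain[of 0] gain0 by simp
  qed
  have ii: "(\<forall>r \<in> {0..<1}. G TYPE('n) q r = U\<^sub>h (r *\<^sub>R e\<^sub>n :: real ^ 'n::_)) \<and>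
      increasing_diffeomorphism (G TYPE('n) q) {0..<1} {0..<1}" if "p = \<infinity>"
  proof -
    have q: "q = 1" using pq that by (cases rule: conjugate_exponent_cases) auto
    then have g: "gain ?n q = hemisphere_gain ?n" by (auto simp: gain_def fun_eq_iff)
    have "G TYPE('n) q r = U\<^sub>h (r *\<^sub>R e\<^sub>n :: real ^ 'n::_)" if r: "r \<in> {0..<1}" for r
    proof -
      interpret I: axial_prob "axial ?n" "?n - 1" by (rule axial_prob_axial[OF n])
      have r': "\<bar>r\<bar> < 1" using r by auto
      have m: "(\<lambda>t. sgn t * ?k r t) \<in> borel_measurable (axial ?n)"
      proof (rule borel_measurable_times)
        show "sgn \<in> borel_measurable (axial ?n)"
          by (simp add: measurable_cong_sets[OF sets_axial refl] measurable_restrict_space1)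
      qed (rule I.measurable_continuous[OF I.continuous_axial_kernel[OF r']])
      have "U\<^sub>h (r *\<^sub>R e\<^sub>n :: real ^ 'n::_) =
          (\<integral>\<zeta>. sgn (\<zeta> \<bullet> e\<^sub>n) * ?k r (\<zeta> \<bullet> e\<^sub>n) \<partial>(\<sigma> :: (real ^ 'n::_) measure))"
        unfolding U\<^sub>h_def poisson_integral_def
        \<comment> \<open>The two closed hemispheres overlap on the equator, where the difference of
          the indicators is 0, in agreement with \<open>sgn 0 = 0\<close>.\<close>
        by (intro Bochner_Integration.integral_cong)
          (auto simp: poisson_kernel_axial inner_e\<^sub>n upper_hemisphere_def lower_hemisphere_def sgn_if indicator_def)
      also have "\<dots> = (\<integral>t. sgn t * ?k r t \<partial>axial ?n)"
        using integral_surface_axial(1)[OF n norm_e\<^sub>n m] by simp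
      also have "\<dots> = hemisphere_gain ?n r" using r by (intro hemisphere_gain_eq[OF n]) auto
      finally show ?thesis using Ggain[OF r] g by simp
    qed
    moreover have "increasing_diffeomorphism (G TYPE('n) q) {0..<1} {0..<1}"
      using hemisphere_gain_diffeomorphism[OF n] Ggain unfolding g by (rule increasing_diffeomorphism_cong)
    ultimately show ?thesis by blast
  qed
  show ?thesis
    using A B A_sharp B_sharp i ii by blast
qed

end
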